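(* Let $\nu$ be a radial weight and let $\omega\in\widehat{\mathcal{D}}$. Then the following conditions are equivalent: (i) $P_\omega: L^\infty_{\widehat{\nu}}\to H^\infty_{\widehat{\nu}}$ is bounded; (ii) $\nu\in\check{\mathcal{D}}$ and $\displaystyle \sup_{x\ge 0}\frac{\nu_x}{\omega_{2x}}\left(\frac{\omega}{\widehat{\nu}}\right)_x<\infty$; (iii) $\nu\in\check{\mathcal{D}}$ and $\displaystyle \sup_{0\le r<1}\frac{\widehat{\nu}(r)}{\widehat{\omega}(r)}\int_r^1\frac{\omega(s)}{\widehat{\nu}(s)}\,ds<\infty$; (iv) $\frac{\omega}{\widehat{\nu}}\in\mathcal{D}$ and $\nu\in\mathcal{D}$.
   Context: Let $\mathbb{D}$ be the open unit disc of $\mathbb{C}$, $\mathcal{H}(\mathbb{D})$ the space of analytic functions in $\mathbb{D}$, and $dA(z)=\frac{dx\,dy}{\pi}$ the normalized area measure. A radial weight is a nonnegative function $\omega\in L^1([0,1))$, extended to $\mathbb{D}$ by $\omega(z)=\omega(|z|)$. Write $\widehat{\omega}(z)=\widehat{\omega}(|z|)=\int_{|z|}^1\omega(s)\,ds$; it is assumed throughout that $\widehat{\omega}(z)>0$ for all $z\in\mathbb{D}$. The moments of a nonnegative function $\omega$ on $[0,1)$ are $\omega_x=\int_0^1 r^x\omega(r)\,dr$, $x\ge0$; in particular $\left(\frac{\omega}{\widehat{\nu}}\right)_x=\int_0^1 r^x\frac{\omega(r)}{\widehat{\nu}(r)}\,dr$. A radial weight $\omega$ belongs to $\widehat{\mathcal{D}}$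 if there is $C>0$ such that $\widehat{\omega}(r)\le C\,\widehat{\omega}\left(\frac{1+r}{2}\right)$ as $r\to1^-$ (i.e. for all $r<1$ close enough to $1$). It belongs to $\check{\mathcal{D}}$ if there are $K>1$ and $C>1$ such that $\widehat{\omega}(r)\ge C\,\widehat{\omega}\left(1-\frac{1-r}{K}\right)$ as $r\to1^-$. Set $\mathcal{D}=\widehat{\mathcal{D}}\cap\check{\mathcal{D}}$. (Membership of a function in one of these classes includes that it is a radial weight.) For a radial weight $\omega$, the Bergman projection is $$P_\omega(f)(z)=\int_{\mathbb{D}}f(\zeta)\,\overline{B^\omega_z(\zeta)}\,\omega(\zeta)\,dA(\zeta),\qquad B^\omega_z(\zeta)=\sum_{n=0}^\infty\frac{(\overline{z}\zeta)^n}{2\omega_{2n+1}},$$ where $B^\omega_z$ is the reproducing kernel of the Bergman space $A^2_\omega=L^2(\mathbb{D},\omega\,dA)\cap\mathcal{H}(\mathbb{D})$. For a radial weight $\nu$, $L^\infty_{\widehat{\nu}}$ is the space of measurable $f:\mathbb{D}\to\mathbb{C}$ with $\|f\|_{\infty,\widehat{\nu}}=\operatorname{ess\,sup}_{z\in\mathbb{D}}|f(z)|\widehat{\nu}(z)<\infty$, and $H^\infty_{\widehat{\nu}}=L^\infty_{\widehat{\nu}}\cap\mathcal{H}(\mathbb{D})$. Boundedness of $P_\omega:X\to Y$ means that for every $f\in X$ the integral $\int_{\mathbb{D}}f(\zeta)\,\overline{B^\omega_z(\zeta)}\,\omega(\zeta)\,dA(\zeta)$, as a function of $z\in\mathbb{D}$,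 defines an element of $Y$, and $\|P_\omega f\|_Y\le C\|f\|_X$ with $C$ independent of $f$. *)

theory Defs
  imports "HOL-Complex_Analysis.Complex_Analysis" "HOL-Probability.Essential_Supremum"
begin

text \<open>
  A radial weight is represented by its profile \<open>\<omega> :: real \<Rightarrow> real\<close>; only the values on \<open>[0,1)\<close>
  matter, and the weight on the disc is \<open>\<lambda>z. \<omega> (cmod z)\<close>. Measurability is Lebesgue measurability.
  Quantities that are possibly infinite (moments, suprema, norms) take values in \<^typ>\<open>ennreal\<close>.
\<close>

abbreviation unit_disc :: "complex set" where
  "unit_disc \<equiv> ball 0 1"

definition disc_area :: "complex measure" where
  "disc_area = density (lebesgue_on unit_disc) (\<lambda>_. ennreal (1 / pi))"

text \<open>The tail is real valued and is only meaningful for integrable \<open>\<omega>\<close>; everywhere below this is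
  guaranteed by \<open>radial_weight\<close>.\<close>

definition tail :: "(real \<Rightarrow> real) \<Rightarrow> real \<Rightarrow> real" where
  "tail \<omega> r = (LINT s:{r..<1}|lebesgue. \<omega> s)"

definition radial_weight :: "(real \<Rightarrow> real) \<Rightarrow> bool" where
  "radial_weight \<omega> \<longleftrightarrow>
     (\<forall>r\<in>{0..<1}. 0 \<le> \<omega> r) \<and> set_integrable lebesgue {0..<1} \<omega> \<and> (\<forall>r\<in>{0..<1}. 0 < tail \<omega> r)"

text \<open>\<^term>\<open>0 powr 0 = (0::real)\<close> in the library, but the point \<open>r = 0\<close> is a null set.\<close>

definition moment :: "(real \<Rightarrow> real) \<Rightarrow> real \<Rightarrow> ennreal" where
  "moment \<omega> x = (\<integral>\<^sup>+ r\<in>{0..<1}. ennreal (r powr x * \<omega> r) \<partial>lebesgue)"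

definition D_hat :: "(real \<Rightarrow> real) set" where
  "D_hat = {\<omega>. radial_weight \<omega> \<and>
     (\<exists>C>0. \<forall>\<^sub>F r in at_left 1. tail \<omega> r \<le> C * tail \<omega> ((1 + r) / 2))}"

definition D_check :: "(real \<Rightarrow> real) set" where
  "D_check = {\<omega>. radial_weight \<omega> \<and>
     (\<exists>K>1. \<exists>C>1. \<forall>\<^sub>F r in at_left 1. tail \<omega> r \<ge> C * tail \<omega> (1 - (1 - r) / K))}"

definition D_class :: "(real \<Rightarrow> real) set" where
  "D_class = D_hat \<inter> D_check"

definition bergman_kernel :: "(real \<Rightarrow> real) \<Rightarrow> complex \<Rightarrow> complex \<Rightarrow> complex" where
  "bergman_kernel \<omega> z \<zeta> =
     (\<Sum>n. (cnj z * \<zeta>) ^ n / of_real (2 * enn2real (moment \<omega> (real (2 * n + 1)))))"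

definition bergman_integrand ::
    "(real \<Rightarrow> real) \<Rightarrow> (complex \<Rightarrow> complex) \<Rightarrow> complex \<Rightarrow> complex \<Rightarrow> complex" where
  "bergman_integrand \<omega> f z \<zeta> = f \<zeta> * cnj (bergman_kernel \<omega> z \<zeta>) * of_real (\<omega> (cmod \<zeta>))"

definition bergman_projection ::
    "(real \<Rightarrow> real) \<Rightarrow> (complex \<Rightarrow> complex) \<Rightarrow> complex \<Rightarrow> complex" where
  "bergman_projection \<omega> f z = (LINT \<zeta>|disc_area. bergman_integrand \<omega> f z \<zeta>)"

definition Linf_norm :: "(real \<Rightarrow> real) \<Rightarrow> (complex \<Rightarrow> complex) \<Rightarrow> ennreal" where
  "Linf_norm \<nu> f = esssup disc_area (\<lambda>z. ennreal (cmod (f z) * tail \<nu> (cmod z)))"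

definition Linf :: "(real \<Rightarrow> real) \<Rightarrow> (complex \<Rightarrow> complex) set" where
  "Linf \<nu> = {f. f \<in> borel_measurable disc_area \<and> Linf_norm \<nu> f < \<infinity>}"

definition Hinf :: "(real \<Rightarrow> real) \<Rightarrow> (complex \<Rightarrow> complex) set" where
  "Hinf \<nu> = Linf \<nu> \<inter> {f. f holomorphic_on unit_disc}"

text \<open>Convergence of the defining integral at every point of the disc is part of boundedness, since
  the library integral of a non-integrable function is \<open>0\<close>.\<close>

definition bergman_projection_bounded :: "(real \<Rightarrow> real) \<Rightarrow> (real \<Rightarrow> real) \<Rightarrow> bool" where
  "bergman_projection_bounded \<omega> \<nu> \<longleftrightarrow>
     (\<exists>C::real. C \<ge> 0 \<and> (\<forall>f\<in>Linf \<nu>.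
        (\<forall>z\<in>unit_disc. integrable disc_area (bergman_integrand \<omega> f z)) \<and>
        bergman_projection \<omega> f \<in> Hinf \<nu> \<and>
        Linf_norm \<nu> (bergman_projection \<omega> f) \<le> ennreal C * Linf_norm \<nu> f))"

end

theory Submission
  imports Defs
begin

text \<open>
  The conditions (ii), (iii) and (iv) are compared through \<open>\<omega>\<^sub>x \<asymp> tail \<omega> (1 - 1/x)\<close>, valid for \<open>\<omega> \<in> D_hat\<close>.
  The bridge to (i) is the series \<open>S(\<rho>) = \<Sum> \<sigma>\<^sub>n\<^sub>+\<^sub>1 \<rho>\<^sup>n / ((n+1) \<omega>\<^sub>2\<^sub>n\<^sub>+\<^sub>1)\<close>. Sufficiency: since \<open>1 / \<omega>\<^sub>2\<^sub>n\<^sub>+\<^sub>1\<close>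
  has second differences of relative size \<open>1 / (n+1)\<^sup>2\<close>, summing the kernel by parts twice bounds
  \<open>\<integral> \<bar>B\<^sub>z\<bar> \<sigma> dA\<close> by \<open>S(\<bar>z\<bar>)\<close>, and (ii) with \<open>\<nu> \<in> D_hat \<inter> D_check\<close> gives \<open>S(\<rho>) \<lesssim> 1 / tail \<nu> \<rho>\<close>.
  Necessity: testing the projection on \<open>Im (Ln (1 - t\<zeta>)) / tail \<nu> \<bar>\<zeta>\<bar>\<close> bounds a series comparable to \<open>S\<close>;
  one dyadic block of it yields (iii), and many blocks, each at least a multiple of \<open>1 / tail \<nu> r\<close>,
  force \<open>\<nu> \<in> D_check\<close>.
\<close>

section \<open>Area integrals of radial functions\<close>

text \<open>For a general weight the kernel has no closed form, so all information on it is drawn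
  from the moments. One summation by parts would not do: it leaves a decay of order 1 / ((n+1) |1 -
  z|), whose circular means carry a logarithm, whereas the square of this quantity is governed by
  the Poisson kernel. The doubling of \<nu> is absent from (i), (ii) and (iii); it is extracted from
  the tail inequality in (iii), and this is why the way from (ii) to (i) passes through that
  inequality. The test function works because 1 - t\<zeta> stays in the right half plane, so the
  imaginary part of its logarithm is bounded uniformly in t, while the pairing with conjugate
  monomials sees only the analytic half, whose coefficients t^n / n are those of an unbounded
  function and are nonnegative. Weights are merely Lebesgue measurable, so radial functions on the
  disc are treated through Borel versions of their profiles.\<close>

lemma borel_measurable_Complex [measurable]:
  "(\<lambda>(x, y). Complex x y) \<in> borel_measurable (borel \<Otimes>\<^sub>M borel)"
  "(\<lambda>(x, y). Complex x y) \<in> borel_measurable (lborel \<Otimes>\<^sub>M lborel)"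
proof -
  have "continuous_on UNIV (\<lambda>p::real \<times> real. Complex (fst p) (snd p))"
    by (auto simp: Complex_eq intro!: continuous_intros)
  then show "(\<lambda>(x, y). Complex x y) \<in> borel_measurable (borel \<Otimes>\<^sub>M borel)"
    "(\<lambda>(x, y). Complex x y) \<in> borel_measurable (lborel \<Otimes>\<^sub>M lborel)"
    by (simp_all add: borel_prod lborel_prod borel_measurable_continuous_onI case_prod_beta')
qed

lemma distr_Complex_lborel:
  "distr (lborel \<Otimes>\<^sub>M lborel) borel (\<lambda>(x, y). Complex x y) = (lborel :: complex measure)"
proof (rule lborel_eqI[symmetric])
  fix l u :: complex assume "\<And>b. b \<in> Basis \<Longrightarrow> l \<bullet> b \<le> u \<bullet> b"
  from this[of 1] this[of \<i>] have le: "Re l \<le> Re u" "Im l \<le> Im u"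
    by (auto simp: Basis_complex_def)
  have "(\<lambda>(x, y). Complex x y) -` box l u \<inter> space (lborel \<Otimes>\<^sub>M lborel) = {Re l<..<Re u} \<times> {Im l<..<Im u}"
    by (auto simp: space_pair_measure box_Complex_eq in_box_complex_iff)
  then show "emeasure (distr (lborel \<Otimes>\<^sub>M lborel) borel (\<lambda>(x, y). Complex x y)) (box l u)
      = ennreal (\<Prod>b\<in>Basis. (u - l) \<bullet> b)"
    using le by (subst emeasure_distr)
       (auto simp: lborel.emeasure_pair_measure_Times Basis_complex_def ennreal_mult'[symmetric])
qed auto

lemma nn_integral_lborel_complex:
  assumes [measurable]: "f \<in> borel_measurable borel"
  shows "(\<integral>\<^sup>+ z. f z \<partial>(lborel :: complex measure)) = (\<integral>\<^sup>+ y. \<integral>\<^sup>+ x. f (Complex x y) \<partial>lborel \<partial>lborel)"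
proof -
  show ?thesis
    by (subst distr_Complex_lborel[symmetric])
       (simp add: nn_integral_distr lborel_pair.nn_integral_snd[symmetric] case_prod_beta')
qed

text \<open>A rotation factors into two affine substitutions, one in each coordinate, whose
  Jacobians 1 / |a| and |a| cancel. The division by \<open>a = Re c\<close> accounts for the
  assumption \<open>Re c \<noteq> 0\<close>.\<close>

lemma nn_integral_lborel_rotate:
  assumes f[measurable]: "f \<in> borel_measurable borel" and c: "cmod c = 1" "Re c \<noteq> 0"
  shows "(\<integral>\<^sup>+ z. f (c * z) \<partial>(lborel :: complex measure)) = (\<integral>\<^sup>+ z. f z \<partial>lborel)"
proof -
  define a b where "a = Re c" and "b = Im c"
  have a: "a \<noteq> 0" and ab: "a\<^sup>2 + b\<^sup>2 = 1"
    using c cmod_power2[of c] by (auto simp: a_def b_def)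
  define F where "F x y = f (Complex x y)" for x y
  have F[measurable]: "(\<lambda>(x, y). F x y) \<in> borel_measurable (borel \<Otimes>\<^sub>M borel)"
    unfolding F_def by measurable
  have cz: "c * Complex x y = Complex (a * x - b * y) (b * x + a * y)" for x y
    by (simp add: complex_eq_iff a_def b_def)
  have sub1: "(\<integral>\<^sup>+ y. F (a * x - b * y) (b * x + a * y) \<partial>lborel)
      = ennreal (1 / \<bar>a\<bar>) * (\<integral>\<^sup>+ y. F ((x - b * y) / a) y \<partial>lborel)" for x
  proof -
    have "(\<integral>\<^sup>+ y. F (a * x - b * y) (b * x + a * y) \<partial>lborel)
      = ennreal \<bar>1 / a\<bar> * (\<integral>\<^sup>+ y. F (a * x - b * (- b * x / a + 1 / a * y)) (b * x + a * (- b * x / a + 1 / a * y)) \<partial>lborel)"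
      by (rule nn_integral_real_affine) (use a in auto)
    moreover have "a * x - b * (- b * x / a + 1 / a * y) = (x - b * y) / a" for y
    proof -
      have "a * (a * x - b * (- b * x / a + 1 / a * y)) = (a\<^sup>2 + b\<^sup>2) * x - b * y"
        using a by (simp add: field_simps power2_eq_square)
      then have "a * (a * x - b * (- b * x / a + 1 / a * y)) = x - b * y"
        by (simp add: ab)
      then show ?thesis using a by (metis nonzero_mult_div_cancel_left)
    qed
    moreover have "b * x + a * (- b * x / a + 1 / a * y) = y" for y
      using a by (simp add: field_simps)
    ultimately show ?thesis by (simp only:) simp
  qed
  have sub2: "(\<integral>\<^sup>+ x. F ((x - b * y) / a) y \<partial>lborel) = ennreal \<bar>a\<bar> * (\<integral>\<^sup>+ x. F x y \<partial>lborel)" for y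
  proof -
    have "(\<integral>\<^sup>+ x. F ((x - b * y) / a) y \<partial>lborel)
      = ennreal \<bar>a\<bar> * (\<integral>\<^sup>+ x. F ((b * y + a * x - b * y) / a) y \<partial>lborel)"
      by (rule nn_integral_real_affine) (use a in auto)
    then show ?thesis using a by simp
  qed
  have "(\<integral>\<^sup>+ z. f (c * z) \<partial>(lborel :: complex measure))
      = (\<integral>\<^sup>+ y. \<integral>\<^sup>+ x. F (a * x - b * y) (b * x + a * y) \<partial>lborel \<partial>lborel)"
    by (subst nn_integral_lborel_complex) (simp_all add: cz F_def)
  also have "\<dots> = (\<integral>\<^sup>+ x. \<integral>\<^sup>+ y. F (a * x - b * y) (b * x + a * y) \<partial>lborel \<partial>lborel)"
    by (rule lborel_pair.Fubini') measurable
  also have "\<dots> = (\<integral>\<^sup>+ x. ennreal (1 / \<bar>a\<bar>) * (\<integral>\<^sup>+ y. F ((x - b * y) / a) y \<partial>lborel) \<partial>lborel)"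
    by (simp add: sub1)
  also have "\<dots> = ennreal (1 / \<bar>a\<bar>) * (\<integral>\<^sup>+ x. \<integral>\<^sup>+ y. F ((x - b * y) / a) y \<partial>lborel \<partial>lborel)"
    by (rule nn_integral_cmult) measurable
  also have "(\<integral>\<^sup>+ x. \<integral>\<^sup>+ y. F ((x - b * y) / a) y \<partial>lborel \<partial>lborel) = (\<integral>\<^sup>+ y. \<integral>\<^sup>+ x. F ((x - b * y) / a) y \<partial>lborel \<partial>lborel)"
    by (rule lborel_pair.Fubini'[symmetric]) measurable
  also have "\<dots> = (\<integral>\<^sup>+ y. ennreal \<bar>a\<bar> * (\<integral>\<^sup>+ x. F x y \<partial>lborel) \<partial>lborel)"
    by (simp add: sub2)
  also have "\<dots> = ennreal \<bar>a\<bar> * (\<integral>\<^sup>+ y. \<integral>\<^sup>+ x. F x y \<partial>lborel \<partial>lborel)"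
    by (rule nn_integral_cmult) measurable
  also have "ennreal (1 / \<bar>a\<bar>) * \<dots> = (\<integral>\<^sup>+ y. \<integral>\<^sup>+ x. F x y \<partial>lborel \<partial>lborel)"
    using a by (simp add: mult.assoc[symmetric] ennreal_mult'[symmetric])
  also have "\<dots> = (\<integral>\<^sup>+ z. f z \<partial>lborel)"
    by (subst nn_integral_lborel_complex) (simp_all add: F_def)
  finally show ?thesis .
qed

lemma distr_lborel_rotate:
  assumes c: "cmod c = 1" "Re c \<noteq> 0"
  shows "distr lborel borel ((*) c) = (lborel :: complex measure)"
proof (rule measure_eqI)
  fix A :: "complex set" assume "A \<in> sets (distr lborel borel ((*) c))"
  then have [measurable]: "A \<in> sets borel" by simp
  have "emeasure (distr lborel borel ((*) c)) A = (\<integral>\<^sup>+ z. indicator A (c * z) \<partial>lborel)"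
    by (subst nn_integral_indicator[symmetric], simp, subst nn_integral_distr) auto
  also have "\<dots> = emeasure lborel A"
    using c by (subst nn_integral_lborel_rotate) auto
  finally show "emeasure (distr lborel borel ((*) c)) A = emeasure lborel A" .
qed auto

section \<open>Normalized area on the disc and its image under the modulus\<close>

lemma space_disc_area [simp]: "space disc_area = unit_disc"
  by (simp add: disc_area_def)

lemma measurable_disc_area: "measurable disc_area N = measurable (lebesgue_on unit_disc) N"
  by (simp add: disc_area_def measurable_def)

lemma borel_measurable_disc_area:
  "f \<in> borel_measurable borel \<Longrightarrow> f \<in> borel_measurable disc_area"
  unfolding measurable_disc_area
  by (intro measurable_restrict_space1 measurable_completion) auto

lemma borel_measurable_indicator_disc [measurable]:
  "(indicator unit_disc :: complex \<Rightarrow> real) \<in> borel_measurable borel"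
  "(indicator unit_disc :: complex \<Rightarrow> ennreal) \<in> borel_measurable borel"
  by (simp_all add: borel_measurable_indicator)

lemma AE_disc_area: "(AE z in disc_area. P z) \<longleftrightarrow> (AE z in lborel. z \<in> unit_disc \<longrightarrow> P z)"
  unfolding disc_area_def by (subst AE_density) (auto simp: AE_restrict_space_iff AE_completion_iff)

lemma nn_integral_disc_area:
  assumes [measurable]: "f \<in> borel_measurable borel"
  shows "(\<integral>\<^sup>+ z. f z \<partial>disc_area) = (\<integral>\<^sup>+ z. ennreal (1 / pi) * indicator unit_disc z * f z \<partial>lborel)"
proof -
  have "(\<integral>\<^sup>+ z. f z \<partial>disc_area) = (\<integral>\<^sup>+ z. ennreal (1 / pi) * f z \<partial>lebesgue_on unit_disc)"
    unfolding disc_area_def using borel_measurable_disc_area[OF assms]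
    by (subst nn_integral_density) (auto simp: measurable_disc_area)
  also have "\<dots> = (\<integral>\<^sup>+ z. ennreal (1 / pi) * f z * indicator unit_disc z \<partial>lebesgue)"
    by (subst nn_integral_restrict_space) auto
  finally show ?thesis by (simp add: nn_integral_completion mult_ac)
qed

text \<open>This takes the place of polar coordinates. Both sides are finite measures on the line,
  hence determined by the half-lines; the annulus beyond radius x has normalized area 1 - x^2, which
  is also the integral of 2r from x to 1.\<close>

lemma distr_cmod_disc:
  "distr (density lborel (\<lambda>z. ennreal (1 / pi) * indicator unit_disc z)) borel cmod
    = density lborel (\<lambda>r. ennreal (2 * r) * indicator {0..<1} r)"
proof (rule measure_eqI_lessThan)
  let ?M = "density lborel (\<lambda>z. ennreal (1 / pi) * indicator unit_disc z)"
  let ?N = "density lborel (\<lambda>r::real. ennreal (2 * r) * indicator {0..<1} r)"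
  have ball: "emeasure lborel (cball (0::complex) r) = ennreal (pi * r\<^sup>2)" if "r \<ge> 0" for r
    using that by (simp add: emeasure_cball eval_unit_ball_vol mult.commute)
  have eq1: "emeasure (distr ?M borel cmod) {x<..} = ennreal (1 - (max 0 x)\<^sup>2)" (is "?L = _") for x
  proof -
    have "?L = emeasure ?M {z. x < cmod z}"
      by (subst emeasure_distr) (auto simp: greaterThan_def vimage_def)
    also have "\<dots> = (\<integral>\<^sup>+ z. ennreal (1 / pi) * indicator (unit_disc \<inter> {z. x < cmod z}) z \<partial>lborel)"
      by (subst emeasure_density) (auto intro!: nn_integral_cong simp: indicator_def)
    also have "\<dots> = ennreal (1 / pi) * emeasure lborel (unit_disc \<inter> {z. x < cmod z})"
      by (subst nn_integral_cmult_indicator) auto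
    also have "emeasure lborel (unit_disc \<inter> {z. x < cmod z}) = ennreal (pi * (1 - (max 0 x)\<^sup>2))"
    proof (cases "x < 0 \<or> x \<ge> 1")
      case True
      then consider "x < 0" | "x \<ge> 1" by auto
      then show ?thesis
      proof cases
        case 1
        then have "unit_disc \<inter> {z. x < cmod z} = unit_disc"
          by (auto intro: less_le_trans)
        then show ?thesis using 1 by (simp add: emeasure_ball eval_unit_ball_vol)
      next
        case 2
        then have "unit_disc \<inter> {z. x < cmod z} = {}" by auto
        moreover have "pi * (1 - (max 0 x)\<^sup>2) \<le> 0"
          using 2 by (intro mult_nonneg_nonpos) (auto simp: max_def)
        ultimately show ?thesis by (simp add: ennreal_neg)
      qed
    next
      case False
      then have x: "0 \<le> x" "x < 1" by auto
      have "unit_disc \<inter> {z. x < cmod z} = unit_disc - cball 0 x"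
        by (auto simp: dist_norm)
      also have "emeasure lborel \<dots> = emeasure lborel unit_disc - emeasure lborel (cball (0::complex) x)"
        using x by (subst emeasure_Diff) (auto simp: ball dist_norm)
      also have "\<dots> = ennreal (pi * (1 - (max 0 x)\<^sup>2))"
        using x by (simp add: ball emeasure_ball eval_unit_ball_vol ennreal_minus max_def algebra_simps)
      finally show ?thesis .
    qed
    also have "ennreal (1 / pi) * \<dots> = ennreal (1 - (max 0 x)\<^sup>2)"
      by (simp add: ennreal_mult'[symmetric])
    finally show ?thesis .
  qed
  have eq2: "emeasure ?N {x<..} = ennreal (1 - (max 0 x)\<^sup>2)" for x
  proof -
    have "emeasure ?N {x<..} = (\<integral>\<^sup>+ r. ennreal (2 * r) * indicator {max 0 x..1} r \<partial>lborel)"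
    proof (subst emeasure_density, simp, simp, rule nn_integral_cong_AE)
      have "AE r in lborel. r \<noteq> x \<and> r \<noteq> (1::real)"
        using AE_lborel_singleton[of x] AE_lborel_singleton[of 1] by eventually_elim auto
      then show "AE r in lborel. ennreal (2 * r) * indicator {0..<1} r * indicator {x<..} r =
          ennreal (2 * r) * indicator {max 0 x..1} r"
        by eventually_elim (auto simp: indicator_def max_def)
    qed
    also have "\<dots> = ennreal (1 - (max 0 x)\<^sup>2)"
    proof (cases "max 0 x \<le> 1")
      case True
      have "(\<integral>\<^sup>+ r. ennreal (2 * r) * indicator {max 0 x..1} r \<partial>lborel) = ennreal (1\<^sup>2 - (max 0 x)\<^sup>2)"
        by (rule nn_integral_FTC_Icc) (use True in \<open>auto intro!: derivative_eq_intros\<close>)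
      then show ?thesis by simp
    next
      case False
      then have "{max 0 x..1} = {}" by auto
      then have "(\<integral>\<^sup>+ r. ennreal (2 * r) * indicator {max 0 x..1} r \<partial>lborel) = 0"
        by (simp only:) simp
      moreover have "1 - (max 0 x)\<^sup>2 \<le> 0" using False by (simp add: one_le_power)
      ultimately show ?thesis by (simp only: ennreal_neg)
    qed
    finally show ?thesis .
  qed
  show "emeasure (distr ?M borel cmod) {x<..} < \<infinity>" for x
    by (simp add: eq1)
  show "emeasure (distr ?M borel cmod) {x<..} = emeasure ?N {x<..}" for x
    by (simp add: eq1 eq2)
qed auto


text \<open>A Lebesgue measurable profile composed with \<open>cmod\<close> is not obviously
  measurable. It is replaced by a Borel function equal to it almost everywhere, and
  \<open>AE_radial\<close> carries the equality over to the disc.\<close>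

lemma borel_version:
  fixes \<phi> :: "real \<Rightarrow> real"
  assumes "set_borel_measurable lebesgue {0..<1} \<phi>"
  obtains \<phi>' where "\<phi>' \<in> borel_measurable borel" "AE r in lborel. r \<in> {0..<1} \<longrightarrow> \<phi> r = \<phi>' r"
proof -
  obtain g where g: "g \<in> borel_measurable lborel" "AE r in lborel. indicator {0..<1} r *\<^sub>R \<phi> r = g r"
    using completion_ex_borel_measurable_real[OF assms[unfolded set_borel_measurable_def]] by auto
  show thesis
  proof (rule that)
    show "g \<in> borel_measurable borel" using g(1) by simp
    show "AE r in lborel. r \<in> {0..<1} \<longrightarrow> \<phi> r = g r"
      using g(2) by eventually_elim (auto simp: indicator_def)
  qed
qed

text \<open>By \<open>distr_cmod_disc\<close> the image of area under the modulus is absolutely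
  continuous, so a null set of radii pulls back to a null set of the disc.\<close>

lemma AE_radial:
  assumes "AE r in lborel. r \<in> {0..<1} \<longrightarrow> P r"
  shows "AE z in disc_area. P (cmod z)"
proof -
  obtain N where N: "{r \<in> space lborel. \<not> (r \<in> {0..<1} \<longrightarrow> P r)} \<subseteq> N" "emeasure lborel N = 0" "N \<in> sets lborel"
    using AE_E[OF assms] by blast
  then have [measurable]: "N \<in> sets borel" by simp
  have "AE r in density lborel (\<lambda>r. ennreal (2 * r) * indicator {0..<1} r). r \<notin> N"
  proof (subst AE_density)
    have "AE r in lborel. r \<notin> N" using N by (intro AE_not_in null_setsI) auto
    then show "AE r in lborel. 0 < ennreal (2 * r) * indicator {0..<1} r \<longrightarrow> r \<notin> N"
      by eventually_elim simp
  qed auto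
  then have "AE z in density lborel (\<lambda>z. ennreal (1 / pi) * indicator unit_disc z). cmod z \<notin> N"
    unfolding distr_cmod_disc[symmetric] by (subst (asm) AE_distr_iff) simp_all
  then have "AE z in lborel. (0::ennreal) < ennreal (1 / pi) * indicator unit_disc z \<longrightarrow> cmod z \<notin> N"
    by (subst (asm) AE_density) measurable
  then show ?thesis
    unfolding AE_disc_area
  proof eventually_elim
    case (elim z)
    show ?case
    proof
      assume z: "z \<in> unit_disc"
      then have "cmod z \<notin> N" using elim by (simp add: ennreal_zero_less_mult_iff)
      then show "P (cmod z)" using N(1) z subsetD[OF N(1), of "cmod z"] by fastforce
    qed
  qed
qed

lemma borel_measurable_disc_area_AE:
  fixes f g :: "complex \<Rightarrow> 'a::topological_space"
  assumes g: "g \<in> borel_measurable disc_area" and eq: "AE z in disc_area. f z = g z"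
  shows "f \<in> borel_measurable disc_area"
proof (rule measurableI)
  fix A :: "'a set" assume A: "A \<in> sets borel"
  have sets: "sets disc_area = sets (lebesgue_on unit_disc)" by (simp add: disc_area_def)
  have g: "g -` A \<inter> unit_disc \<in> sets lebesgue"
    using measurable_sets[OF g A] by (simp add: sets sets_restrict_space_iff)
  have ae: "AE z in lebesgue. z \<in> g -` A \<inter> unit_disc \<longleftrightarrow> z \<in> f -` A \<inter> unit_disc"
    using eq unfolding AE_disc_area AE_completion_iff by eventually_elim auto
  have "f -` A \<inter> unit_disc \<in> sets lebesgue"
    by (rule completion.in_sets_AE[OF ae g]) simp
  then show "f -` A \<inter> space disc_area \<in> sets disc_area"
    by (simp add: sets sets_restrict_space_iff)
qed auto

lemma borel_measurable_radial:
  fixes \<phi> :: "real \<Rightarrow> real"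
  assumes "set_borel_measurable lebesgue {0..<1} \<phi>"
  shows "(\<lambda>z. \<phi> (cmod z)) \<in> borel_measurable disc_area"
proof -
  obtain \<phi>' where \<phi>': "\<phi>' \<in> borel_measurable borel" "AE r in lborel. r \<in> {0..<1} \<longrightarrow> \<phi> r = \<phi>' r"
    using borel_version[OF assms] .
  have "(\<lambda>z. \<phi>' (cmod z)) \<in> borel_measurable disc_area"
    by (rule borel_measurable_disc_area) (use \<phi>'(1) in measurable)
  then show ?thesis
    by (rule borel_measurable_disc_area_AE) (rule AE_radial[OF \<phi>'(2)])
qed

lemma nn_integral_radial:
  fixes \<phi> :: "real \<Rightarrow> real"
  assumes "set_borel_measurable lebesgue {0..<1} \<phi>"
  shows "(\<integral>\<^sup>+ z. ennreal (\<phi> (cmod z)) \<partial>disc_area) = (\<integral>\<^sup>+ r\<in>{0..<1}. ennreal (2 * r * \<phi> r) \<partial>lebesgue)"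
proof -
  obtain \<phi>' where \<phi>'[measurable]: "\<phi>' \<in> borel_measurable borel" and eq: "AE r in lborel. r \<in> {0..<1} \<longrightarrow> \<phi> r = \<phi>' r"
    using borel_version[OF assms] .
  have "(\<integral>\<^sup>+ z. ennreal (\<phi> (cmod z)) \<partial>disc_area) = (\<integral>\<^sup>+ z. ennreal (\<phi>' (cmod z)) \<partial>disc_area)"
    using AE_radial[OF eq] by (intro nn_integral_cong_AE) auto
  also have "\<dots> = (\<integral>\<^sup>+ z. ennreal (1 / pi) * indicator unit_disc z * ennreal (\<phi>' (cmod z)) \<partial>lborel)"
    by (rule nn_integral_disc_area) measurable
  also have "\<dots> = (\<integral>\<^sup>+ r. ennreal (\<phi>' r) \<partial>distr (density lborel (\<lambda>z. ennreal (1 / pi) * indicator unit_disc z)) borel cmod)"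
    by (subst nn_integral_distr, simp, simp, subst nn_integral_density) measurable
  also have "\<dots> = (\<integral>\<^sup>+ r. ennreal (2 * r) * indicator {0..<1} r * ennreal (\<phi>' r) \<partial>lborel)"
    by (simp add: distr_cmod_disc nn_integral_density)
  also have "\<dots> = (\<integral>\<^sup>+ r\<in>{0..<1}. ennreal (2 * r * \<phi> r) \<partial>lborel)"
    by (rule nn_integral_cong_AE, use eq in eventually_elim) (auto simp: indicator_def ennreal_mult')
  finally show ?thesis by (simp add: nn_integral_completion)
qed

lemma integral_disc_area:
  fixes f :: "complex \<Rightarrow> complex"
  assumes f[measurable]: "f \<in> borel_measurable borel"
  shows "(LINT z|disc_area. f z) = (LINT z|lborel. indicator unit_disc z *\<^sub>R (1 / pi) *\<^sub>R f z)"
proof -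
  have "(LINT z|disc_area. f z) = (LINT z|lebesgue_on unit_disc. (1 / pi) *\<^sub>R f z)"
    unfolding disc_area_def using borel_measurable_disc_area[OF f]
    by (intro integral_density) (auto simp: measurable_disc_area)
  also have "\<dots> = (LINT z|lebesgue. indicator unit_disc z *\<^sub>R (1 / pi) *\<^sub>R f z)"
    by (subst integral_restrict_space) auto
  also have "\<dots> = (LINT z|lborel. indicator unit_disc z *\<^sub>R (1 / pi) *\<^sub>R f z)"
    by (rule integral_completion) measurable
  finally show ?thesis .
qed

text \<open>Rotation by a unimodular c preserves the measure and the radial factor but multiplies
  the integral by c^k, so the integral vanishes as soon as c^k differs from 1.\<close>

lemma integral_radial_power:
  fixes \<phi> :: "real \<Rightarrow> real"
  assumes "set_borel_measurable lebesgue {0..<1} \<phi>" and k: "k > 0"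
  shows "(LINT z|disc_area. of_real (\<phi> (cmod z)) * z ^ k) = 0"
proof -
  obtain \<phi>' where \<phi>'[measurable]: "\<phi>' \<in> borel_measurable borel" and eq: "AE r in lborel. r \<in> {0..<1} \<longrightarrow> \<phi> r = \<phi>' r"
    using borel_version[OF assms(1)] .
  \<comment> \<open>The angle makes c^k = exp(i pi / 3), which is not 1, and keeps c itself in the
    open right half plane, where \<open>distr_lborel_rotate\<close> applies.\<close>
  define c where "c = cis (pi / (3 * real k))"
  have "0 < pi / (3 * real k)" "pi / (3 * real k) < pi / 2" using k by (auto simp: field_simps)
  then have c: "cmod c = 1" "Re c \<noteq> 0"
    using cos_gt_zero_pi[of "pi / (3 * real k)"] by (auto simp: c_def)
  have "c ^ k = cis (real k * (pi / (3 * real k)))"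
    unfolding c_def by (rule Complex.DeMoivre)
  also have "real k * (pi / (3 * real k)) = pi / 3" using k by simp
  finally have "c ^ k = cis (pi / 3)" .
  then have ck: "c ^ k \<noteq> 1" using k by (auto simp: complex_eq_iff cos_60)
  define G where "G z = indicator unit_disc z *\<^sub>R (1 / pi) *\<^sub>R (of_real (\<phi>' (cmod z)) * z ^ k)" for z :: complex
  have [measurable]: "G \<in> borel_measurable borel" unfolding G_def by measurable
  have "(LINT z|disc_area. of_real (\<phi> (cmod z)) * z ^ k) = (LINT z|disc_area. of_real (\<phi>' (cmod z)) * z ^ k)"
  proof (rule integral_cong_AE)
    have "(\<lambda>z. of_real (\<phi> (cmod z)) :: complex) \<in> borel_measurable disc_area"
      using borel_measurable_radial[OF assms(1)] by measurable
    moreover have "(\<lambda>z::complex. z ^ k) \<in> borel_measurable disc_area"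
      by (rule borel_measurable_disc_area) measurable
    ultimately show "(\<lambda>z. of_real (\<phi> (cmod z)) * z ^ k :: complex) \<in> borel_measurable disc_area"
      by measurable
    show "(\<lambda>z. of_real (\<phi>' (cmod z)) * z ^ k :: complex) \<in> borel_measurable disc_area"
      by (rule borel_measurable_disc_area) measurable
    show "AE z in disc_area. of_real (\<phi> (cmod z)) * z ^ k = of_real (\<phi>' (cmod z)) * z ^ k"
      using AE_radial[OF eq] by eventually_elim simp
  qed
  also have "\<dots> = (LINT z|lborel. G z)"
    unfolding G_def by (rule integral_disc_area) measurable
  finally have 1: "(LINT z|disc_area. of_real (\<phi> (cmod z)) * z ^ k) = (LINT z|lborel. G z)" .
  have "(LINT z|lborel. G z) = (LINT z|distr lborel borel ((*) c). G z)"
    using distr_lborel_rotate[OF c] by simp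
  also have "\<dots> = (LINT z|lborel. G (c * z))"
    by (rule integral_distr) auto
  also have "\<dots> = (LINT z|lborel. c ^ k * G z)"
    by (intro Bochner_Integration.integral_cong)
       (auto simp: G_def norm_mult c power_mult_distrib indicator_def scaleR_conv_of_real)
  also have "\<dots> = c ^ k * (LINT z|lborel. G z)" by simp
  finally have "(1 - c ^ k) * (LINT z|lborel. G z) = 0" by (simp add: algebra_simps)
  then show ?thesis using ck 1 by simp
qed

section \<open>Tails and moments of radial weights\<close>

lemma radial_weight_nonneg: "radial_weight w \<Longrightarrow> 0 \<le> r \<Longrightarrow> r < 1 \<Longrightarrow> 0 \<le> w r"
  by (auto simp: radial_weight_def)

lemma tail_pos: "radial_weight w \<Longrightarrow> 0 \<le> r \<Longrightarrow> r < 1 \<Longrightarrow> 0 < tail w r"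
  by (auto simp: radial_weight_def)

lemma radial_weight_set_integrable:
  "radial_weight w \<Longrightarrow> 0 \<le> r \<Longrightarrow> t \<le> 1 \<Longrightarrow> set_integrable lebesgue {r..<t} w"
  by (rule set_integrable_subset[where A="{0..<1}"]) (auto simp: radial_weight_def)

lemma radial_weight_mult_integrable:
  assumes w: "radial_weight w" and g: "g \<in> borel_measurable borel" "\<And>r. 0 \<le> r \<Longrightarrow> r < 1 \<Longrightarrow> \<bar>g r\<bar> \<le> 1"
  shows "set_integrable lebesgue {0..<1} (\<lambda>r. g r * w r)"
proof (rule set_integrable_bound)
  show "set_integrable lebesgue {0..<1} w" using radial_weight_set_integrable[OF w, of 0 1] by simp
  have "g \<in> borel_measurable lebesgue"
    using g(1) by (intro measurable_completion) auto
  moreover have "(\<lambda>r. indicator {0..<1} r *\<^sub>R w r) \<in> borel_measurable lebesgue"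
    using radial_weight_set_integrable[OF w, of 0 1] by (auto simp: set_integrable_def)
  ultimately have "(\<lambda>r. g r * (indicator {0..<1} r *\<^sub>R w r)) \<in> borel_measurable lebesgue"
    by measurable
  then show "set_borel_measurable lebesgue {0..<1} (\<lambda>r. g r * w r)"
    unfolding set_borel_measurable_def by (simp add: mult_ac)
  show "AE r in lebesgue. r \<in> {0..<1} \<longrightarrow> norm (g r * w r) \<le> norm (w r)"
    using g(2) by (auto simp: abs_mult intro!: mult_left_le_one_le AE_I2)
qed

lemma tail_antimono:
  assumes w: "radial_weight w" and "0 \<le> r" "r \<le> t" "t < 1"
  shows "tail w t \<le> tail w r"
  unfolding tail_def set_lebesgue_integral_def
  using radial_weight_set_integrable[OF w, of r 1] radial_weight_set_integrable[OF w, of t 1] assms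
  by (intro integral_mono) (auto simp: set_integrable_def indicator_def radial_weight_nonneg)

lemma tail_split:
  assumes i: "set_integrable lebesgue {0..<1} f" and rt: "0 \<le> r" "r \<le> t" "t < 1"
  shows "tail f r = (LINT s:{r..<t}|lebesgue. f s) + tail f t"
proof -
  have "{r..<1} = {r..<t} \<union> {t..<1}" using rt by auto
  moreover have "set_integrable lebesgue {r..<t} f" "set_integrable lebesgue {t..<1} f"
    by (rule set_integrable_subset[OF i]; use rt in auto)+
  ultimately show ?thesis unfolding tail_def by (simp add: set_integral_Un disjoint_iff)
qed

text \<open>A real-valued companion of \<open>moment\<close>, so that the estimates can be done in
  real arithmetic; \<open>moment_eq_mom\<close> links the two for radial weights.\<close>

definition mom :: "(real \<Rightarrow> real) \<Rightarrow> real \<Rightarrow> real" where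
  "mom w x = (LINT r:{0..<1}|lebesgue. r powr x * w r)"

lemma powr_integrable:
  assumes "radial_weight w" "0 \<le> x"
  shows "set_integrable lebesgue {0..<1} (\<lambda>r. r powr x * w r)"
  using assms by (intro radial_weight_mult_integrable) (auto intro: powr_le1)

lemma moment_eq_mom:
  assumes "radial_weight w" "0 \<le> x"
  shows "moment w x = ennreal (mom w x)"
proof -
  have "moment w x = (\<integral>\<^sup>+ r. ennreal (indicator {0..<1} r *\<^sub>R (r powr x * w r)) \<partial>lebesgue)"
    unfolding moment_def by (intro nn_integral_cong) (auto simp: indicator_def)
  also have "\<dots> = ennreal (mom w x)"
    unfolding mom_def set_lebesgue_integral_def
    using powr_integrable[OF assms] radial_weight_nonneg[OF assms(1)]
    by (intro nn_integral_eq_integral) (auto simp: set_integrable_def indicator_def)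
  finally show ?thesis .
qed

lemma mom_antimono:
  assumes "radial_weight w" "0 \<le> x" "x \<le> y"
  shows "mom w y \<le> mom w x"
  unfolding mom_def using assms
  by (intro set_integral_mono powr_integrable)
     (auto intro!: mult_right_mono powr_mono' simp: radial_weight_nonneg)

lemma mom_le_tail: "radial_weight w \<Longrightarrow> 0 \<le> x \<Longrightarrow> mom w x \<le> tail w 0"
  unfolding mom_def tail_def
  by (intro set_integral_mono powr_integrable)
     (auto intro!: mult_left_le_one_le powr_le1 simp: radial_weight_nonneg radial_weight_set_integrable)

lemma mom_ge:
  assumes w: "radial_weight w" and "0 \<le> x" "0 \<le> t" "t < 1"
  shows "t powr x * tail w t \<le> mom w x"
proof -
  have "t powr x * tail w t = (LINT s:{t..<1}|lebesgue. t powr x * w s)"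
    unfolding tail_def by simp
  also have "\<dots> \<le> mom w x"
    unfolding mom_def set_lebesgue_integral_def
  proof (rule integral_mono)
    show "integrable lebesgue (\<lambda>s. indicator {t..<1} s *\<^sub>R (t powr x * w s))"
      using set_integrable_mult_right[OF radial_weight_set_integrable[OF w, of t 1], of "t powr x"] assms
      by (simp add: set_integrable_def)
    show "integrable lebesgue (\<lambda>s. indicator {0..<1} s *\<^sub>R (s powr x * w s))"
      using powr_integrable[OF w \<open>0 \<le> x\<close>] by (simp add: set_integrable_def)
    show "indicator {t..<1} s *\<^sub>R (t powr x * w s) \<le> indicator {0..<1} s *\<^sub>R (s powr x * w s)" for s
    proof (cases "0 \<le> s \<and> s < 1")
      case True
      then have "0 \<le> w s" by (simp add: radial_weight_nonneg[OF w])
      moreover have "t powr x \<le> s powr x" if "t \<le> s" using that assms by (intro powr_mono2) auto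
      ultimately show ?thesis using True by (auto simp: indicator_def mult_right_mono)
    qed (use assms in \<open>auto simp: indicator_def\<close>)
  qed
  finally show ?thesis .
qed

lemma mom_pos:
  assumes "radial_weight w" "0 \<le> x"
  shows "0 < mom w x"
proof -
  have "0 < (1 / 2) powr x * tail w (1 / 2)"
    using tail_pos[OF assms(1), of "1/2"] by (intro mult_pos_pos) auto
  also have "\<dots> \<le> mom w x" using assms by (intro mom_ge) auto
  finally show ?thesis .
qed

lemma exp_le_one_minus_powr:
  assumes "0 \<le> u" "u \<le> 1/2" "0 \<le> (y::real)"
  shows "exp (- 2 * u * y) \<le> (1 - u) powr y"
proof -
  \<comment> \<open>For u at most 1/2 the quadratic error 2 u^2 in the lower bound for ln (1 - u) is
    at most u; this is the origin of the factor 2 in all later exponents.\<close>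
  have "- 2 * u \<le> - u - 2 * u\<^sup>2" 
    using assms mult_left_mono[of u "1/2" u] by (simp add: power2_eq_square)
  also have "\<dots> \<le> ln (1 - u)"
    using assms by (intro ln_one_minus_pos_lower_bound) auto
  finally have "y * (- 2 * u) \<le> y * ln (1 - u)"
    using assms by (intro mult_left_mono) auto
  then show ?thesis using assms by (simp add: powr_def mult_ac)
qed

text \<open>The point 1 - 1/x and the order y are kept independent, so that one tail bounds from
  below all moments whose order is comparable to x. No regularity of the weight enters, in contrast
  to the upper bound \<open>D_hat_mom_le\<close>.\<close>

lemma mom_ge_tail:
  assumes w: "radial_weight w" and "2 \<le> x" "0 \<le> y"
  shows "exp (- 2 * y / x) * tail w (1 - 1 / x) \<le> mom w y"
proof -
  have "exp (- 2 * (1 / x) * y) \<le> (1 - 1 / x) powr y"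
    using assms by (intro exp_le_one_minus_powr) (auto simp: field_simps)
  then have "exp (- 2 * y / x) * tail w (1 - 1 / x) \<le> (1 - 1 / x) powr y * tail w (1 - 1 / x)"
    using assms tail_pos[OF w, of "1 - 1 / x"] by (intro mult_right_mono) (auto simp: field_simps)
  also have "\<dots> \<le> mom w y"
    using assms by (intro mom_ge) (auto simp: field_simps)
  finally show ?thesis .
qed

lemma ex_power_sandwich:
  assumes "1 \<le> (q::real)" "1 < K"
  obtains j :: nat where "K ^ j \<le> q" "q < K ^ Suc j"
proof -
  have j: "real_of_int \<lfloor>log K q\<rfloor> = real (nat \<lfloor>log K q\<rfloor>)"
    using assms by simp
  have "K powr real (nat \<lfloor>log K q\<rfloor>) \<le> q"
    using assms unfolding j[symmetric] by (subst le_log_iff[symmetric]) auto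
  moreover have "q < K powr real (Suc (nat \<lfloor>log K q\<rfloor>))"
    using assms j by (subst log_less_iff[symmetric]) (auto, linarith)
  ultimately show thesis
    using assms powr_realpow[of K "nat \<lfloor>log K q\<rfloor>"] powr_realpow[of K "Suc (nat \<lfloor>log K q\<rfloor>)"]
    by (intro that[of "nat \<lfloor>log K q\<rfloor>"]) linarith+
qed

section \<open>Polynomial growth and decay of tails\<close>

lemma D_hat_radial_weight: "w \<in> D_hat \<Longrightarrow> radial_weight w"
  and D_check_radial_weight: "w \<in> D_check \<Longrightarrow> radial_weight w"
  by (auto simp: D_hat_def D_check_def)

text \<open>The bound near 1 extends to all radii because on a compact interval [0, R] the ratio of
  the two tails is at most \<open>tail w 0 / tail w ((1 + R) / 2)\<close>.\<close>

lemma D_hat_doubling: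
  assumes "w \<in> D_hat"
  obtains C where "C \<ge> 1" "\<And>r. 0 \<le> r \<Longrightarrow> r < 1 \<Longrightarrow> tail w r \<le> C * tail w ((1 + r) / 2)"
proof -
  note w = D_hat_radial_weight[OF assms]
  obtain C where C: "C > 0" "\<forall>\<^sub>F r in at_left 1. tail w r \<le> C * tail w ((1 + r) / 2)"
    using assms by (auto simp: D_hat_def)
  then obtain a where a: "a < 1" "\<And>r. a < r \<Longrightarrow> r < 1 \<Longrightarrow> tail w r \<le> C * tail w ((1 + r) / 2)"
    using eventually_at_left[of 0 1] by (auto simp: eventually_at_left_field)
  define R where "R = (1 + max a 0) / 2"
  define C' where "C' = max 1 (max C (tail w 0 / tail w ((1 + R) / 2)))"
  have R: "0 \<le> R" "R < 1" "a < R" using a by (auto simp: R_def max_def)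
  have "tail w r \<le> C' * tail w ((1 + r) / 2)" if r: "0 \<le> r" "r < 1" for r
  proof (cases "r \<le> R")
    case True
    have "tail w r \<le> tail w 0" using r by (intro tail_antimono[OF w]) auto
    also have "\<dots> = tail w 0 / tail w ((1 + R) / 2) * tail w ((1 + R) / 2)"
      using tail_pos[OF w, of "(1 + R) / 2"] R by simp
    also have "\<dots> \<le> C' * tail w ((1 + r) / 2)"
      using r R True
      by (intro mult_mono tail_antimono[OF w]) (auto simp: C'_def less_imp_le[OF tail_pos[OF w]])
    finally show ?thesis .
  next
    case False
    then have "tail w r \<le> C * tail w ((1 + r) / 2)" using r R by (intro a) auto
    also have "\<dots> \<le> C' * tail w ((1 + r) / 2)"
      using r by (intro mult_right_mono) (auto simp: C'_def less_imp_le[OF tail_pos[OF w]])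
    finally show ?thesis .
  qed
  then show thesis by (intro that[of C']) (auto simp: C'_def)
qed

lemma D_hatI:
  assumes "radial_weight w" "a < 1" "\<And>r. a \<le> r \<Longrightarrow> 0 \<le> r \<Longrightarrow> r < 1 \<Longrightarrow> tail w r \<le> C * tail w ((1 + r) / 2)"
  shows "w \<in> D_hat"
proof -
  have "\<forall>\<^sub>F r in at_left 1. max a 0 < r \<and> r < (1::real)"
    using assms(2) by (auto simp: eventually_at_left_field intro!: exI[of _ "max a 0"])
  then have "\<forall>\<^sub>F r in at_left 1. tail w r \<le> max C 1 * tail w ((1 + r) / 2)"
  proof eventually_elim
    case (elim r)
    have "tail w r \<le> C * tail w ((1 + r) / 2)" using elim by (intro assms) auto
    also have "\<dots> \<le> max C 1 * tail w ((1 + r) / 2)"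
      using elim tail_pos[OF assms(1), of "(1 + r) / 2"] by (intro mult_right_mono) auto
    finally show ?case .
  qed
  then show ?thesis unfolding D_hat_def using assms(1) by (auto intro!: exI[of _ "max C 1"])
qed

lemma D_checkI:
  assumes "radial_weight w" "a < 1" "K > 1" "C > 1"
    "\<And>r. a \<le> r \<Longrightarrow> 0 \<le> r \<Longrightarrow> r < 1 \<Longrightarrow> C * tail w (1 - (1 - r) / K) \<le> tail w r"
  shows "w \<in> D_check"
proof -
  have "\<forall>\<^sub>F r in at_left 1. max a 0 < r \<and> r < (1::real)"
    using assms(2) by (auto simp: eventually_at_left_field intro!: exI[of _ "max a 0"])
  then have "\<forall>\<^sub>F r in at_left 1. tail w r \<ge> C * tail w (1 - (1 - r) / K)"
    by eventually_elim (rule assms, auto)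
  then show ?thesis unfolding D_check_def using assms(1,3,4) by blast
qed

text \<open>Doubling is iterated about log2 ((1 - r) / (1 - t)) times. The exponent is taken to be a
  natural number so that the power can later be compared with a single term of the exponential
  series.\<close>

lemma D_hat_growth:
  assumes "w \<in> D_hat"
  obtains A :: real and b :: nat where "A \<ge> 1"
    "\<And>r t. 0 \<le> r \<Longrightarrow> r \<le> t \<Longrightarrow> t < 1 \<Longrightarrow> tail w r \<le> A * ((1 - r) / (1 - t)) ^ b * tail w t"
proof -
  note w = D_hat_radial_weight[OF assms]
  obtain C where C: "C \<ge> 1" "\<And>r. 0 \<le> r \<Longrightarrow> r < 1 \<Longrightarrow> tail w r \<le> C * tail w ((1 + r) / 2)"
    using D_hat_doubling[OF assms] by blast
  \<comment> \<open>Replacing the doubling constant by 2^b turns the j-fold iterate (2^b)^j into the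
    b-th power of 2^j, that is, of the ratio of distances to 1.\<close>
  obtain b where b: "C < 2 ^ b" using real_arch_pow[of 2 C] by auto
  have step: "tail w r \<le> 2 ^ b * tail w ((1 + r) / 2)" if "0 \<le> r" "r < 1" for r
  proof -
    have "C * tail w ((1 + r) / 2) \<le> 2 ^ b * tail w ((1 + r) / 2)"
      using b that tail_pos[OF w, of "(1 + r) / 2"] by (intro mult_right_mono) auto
    then show ?thesis using C(2)[OF that] by simp
  qed
  have iter: "tail w r \<le> (2 ^ b) ^ j * tail w t"
    if "0 \<le> r" "r \<le> t" "t < 1" "1 - r \<le> 2 ^ j * (1 - t)" for r t j
    using that
  proof (induction j arbitrary: r)
    case 0
    then have "r = t" by simp
    then show ?case by simp
  next
    case (Suc j)
    show ?case
    proof (cases "(1 + r) / 2 \<le> t")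
      case True
      have "tail w r \<le> 2 ^ b * tail w ((1 + r) / 2)" using Suc.prems by (intro step) auto
      also have "\<dots> \<le> 2 ^ b * ((2 ^ b) ^ j * tail w t)"
        using Suc.prems True by (intro mult_left_mono Suc.IH) (auto simp: field_simps)
      finally show ?thesis by (simp add: mult_ac)
    next
      case False
      have "tail w r \<le> 2 ^ b * tail w ((1 + r) / 2)" using Suc.prems by (intro step) auto
      also have "\<dots> \<le> 2 ^ b * tail w t"
        using Suc.prems False by (intro mult_left_mono tail_antimono[OF w]) auto
      also have "\<dots> \<le> (2 ^ b) ^ Suc j * tail w t"
        using tail_pos[OF w, of t] Suc.prems
        by (intro mult_right_mono) (auto simp: one_le_power)
      finally show ?thesis .
    qed
  qed
  show thesis
  proof (rule that[of "2 ^ b" b])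
    fix r t :: real assume rt: "0 \<le> r" "r \<le> t" "t < 1"
    define q where "q = (1 - r) / (1 - t)"
    have q: "1 \<le> q" "1 - r = q * (1 - t)" using rt by (auto simp: q_def field_simps)
    obtain j where j: "2 ^ j \<le> q" "q < 2 ^ Suc j"
      using ex_power_sandwich[of q 2] q by auto
    have "tail w r \<le> (2 ^ b) ^ Suc j * tail w t"
      using rt j q by (intro iter) (auto intro!: mult_right_mono)
    also have "(2 ^ b) ^ Suc j = (2::real) ^ b * (2 ^ j) ^ b"
      by (simp add: power_mult[symmetric] mult.commute)
    also have "\<dots> * tail w t \<le> 2 ^ b * q ^ b * tail w t"
      using j tail_pos[OF w, of t] rt by (intro mult_right_mono mult_left_mono power_mono) auto
    finally show "tail w r \<le> 2 ^ b * ((1 - r) / (1 - t)) ^ b * tail w t"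
      by (simp add: q_def)
  qed (simp add: one_le_power)
qed

text \<open>The dual of \<open>D_hat_growth\<close>: iterating the defining inequality along
  distances shrinking by the factor K yields a power rate of decay, first near 1 and then, at the
  cost of a constant, everywhere.\<close>

lemma D_check_decay:
  assumes "w \<in> D_check"
  obtains B \<alpha> :: real where "B > 0" "0 < \<alpha>" "\<alpha> \<le> 1"
    "\<And>r t. 0 \<le> r \<Longrightarrow> r \<le> t \<Longrightarrow> t < 1 \<Longrightarrow> tail w t \<le> B * ((1 - t) / (1 - r)) powr \<alpha> * tail w r"
proof -
  note w = D_check_radial_weight[OF assms]
  obtain K C where C: "K > 1" "C > 1" "\<forall>\<^sub>F r in at_left 1. tail w r \<ge> C * tail w (1 - (1 - r) / K)"
    using assms by (auto simp: D_check_def)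
  then obtain a where a: "a < 1" "\<And>r. a < r \<Longrightarrow> r < 1 \<Longrightarrow> tail w r \<ge> C * tail w (1 - (1 - r) / K)"
    by (auto simp: eventually_at_left_field)
  define R where "R = (1 + max a 0) / 2"
  have R: "0 \<le> R" "R < 1" "a < R" using a by (auto simp: R_def max_def)
  \<comment> \<open>The iteration gives the exponent log_K C. The cap at 1 makes powers with
    exponent \<open>\<alpha> - 1\<close> nonincreasing and is what \<open>powr_sum_le\<close> relies
    on.\<close>
  define \<alpha> where "\<alpha> = min 1 (log K C)"
  have \<alpha>: "0 < \<alpha>" "\<alpha> \<le> 1" using C by (auto simp: \<alpha>_def)
  have "K powr \<alpha> \<le> K powr (log K C)"
    using C by (intro powr_mono) (auto simp: \<alpha>_def)
  then have K\<alpha>: "K powr \<alpha> \<le> C" using C by simp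
  have step: "K powr \<alpha> * tail w (1 - (1 - r) / K) \<le> tail w r" if "R \<le> r" "r < 1" for r
  proof -
    have "1 - (1 - r) / K \<ge> 0" "1 - (1 - r) / K < 1" using that R C by (auto simp: field_simps)
    then have "K powr \<alpha> * tail w (1 - (1 - r) / K) \<le> C * tail w (1 - (1 - r) / K)"
      by (intro mult_right_mono K\<alpha> less_imp_le[OF tail_pos[OF w]])
    also have "\<dots> \<le> tail w r" using that R by (intro a) auto
    finally show ?thesis .
  qed
  have bnd: "R \<le> 1 - (1 - r) / K ^ j \<and> 1 - (1 - r) / K ^ j < 1" if "R \<le> r" "r < 1" for r and j :: nat
  proof -
    have "(1 - r) / K ^ j \<le> (1 - r) / 1" using that C by (intro divide_left_mono) auto
    then show ?thesis using that C by auto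
  qed
  have iter: "(K powr \<alpha>) ^ j * tail w (1 - (1 - r) / K ^ j) \<le> tail w r" if "R \<le> r" "r < 1" for r and j :: nat
  proof (induction j)
    case (Suc j)
    have "(K powr \<alpha>) ^ Suc j * tail w (1 - (1 - r) / K ^ Suc j)
        = (K powr \<alpha>) ^ j * (K powr \<alpha> * tail w (1 - (1 - (1 - (1 - r) / K ^ j)) / K))"
      by (simp add: mult_ac)
    also have "\<dots> \<le> (K powr \<alpha>) ^ j * tail w (1 - (1 - r) / K ^ j)"
      using bnd[OF that] by (intro mult_left_mono step) auto
    also have "\<dots> \<le> tail w r" by (rule Suc)
    finally show ?case .
  qed simp
  have main: "tail w t \<le> K powr \<alpha> * ((1 - t) / (1 - r)) powr \<alpha> * tail w r"
    if rt: "R \<le> r" "r \<le> t" "t < 1" for r t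
  proof -
    define q where "q = (1 - r) / (1 - t)"
    have q: "1 \<le> q" "1 - t = (1 - r) / q" using rt by (auto simp: q_def field_simps)
    obtain j where j: "K ^ j \<le> q" "q < K ^ Suc j"
      using ex_power_sandwich[of q K] q C by auto
    have "1 - t \<le> (1 - r) / K ^ j"
      unfolding q(2) using rt j C by (intro divide_left_mono) (auto intro!: mult_pos_pos less_le_trans[of 0 1 q] simp: q)
    then have "tail w t \<le> tail w (1 - (1 - r) / K ^ j)"
      using rt bnd[of r j] R by (intro tail_antimono[OF w]) auto
    then have "(K powr \<alpha>) ^ Suc j * tail w t \<le> K powr \<alpha> * ((K powr \<alpha>) ^ j * tail w (1 - (1 - r) / K ^ j))"
      using C by (auto simp: mult_ac)
    also have "\<dots> \<le> K powr \<alpha> * tail w r"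
      using rt by (intro mult_left_mono iter) auto
    finally have 1: "(K powr \<alpha>) ^ Suc j * tail w t \<le> K powr \<alpha> * tail w r" .
    have "q powr \<alpha> \<le> (K ^ Suc j) powr \<alpha>"
      using j q \<alpha> by (intro powr_mono2) auto
    also have "\<dots> = (K powr \<alpha>) ^ Suc j"
    proof -
      have "(K ^ Suc j) powr \<alpha> = K powr (real (Suc j) * \<alpha>)"
        using C by (simp add: powr_realpow[symmetric] powr_powr del: power_Suc)
      also have "\<dots> = (K powr \<alpha>) ^ Suc j"
        using C by (simp add: powr_realpow[symmetric] powr_powr mult.commute del: power_Suc)
      finally show ?thesis .
    qed
    finally have "q powr \<alpha> * tail w t \<le> (K powr \<alpha>) ^ Suc j * tail w t"
      using rt R tail_pos[OF w, of t] by (intro mult_right_mono) auto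
    with 1 have "q powr \<alpha> * tail w t \<le> K powr \<alpha> * tail w r" by simp
    then have "tail w t \<le> K powr \<alpha> * tail w r / q powr \<alpha>" using q by (simp add: field_simps)
    also have "\<dots> = K powr \<alpha> * (1 / q) powr \<alpha> * tail w r" using q by (simp add: powr_divide)
    finally show ?thesis by (simp add: q_def)
  qed
  \<comment> \<open>The second factor pays for starting at r below R, where only monotonicity of the
    tail is available on [r, R].\<close>
  define B where "B = K powr \<alpha> * (1 / (1 - R)) powr \<alpha>"
  have K1: "1 \<le> K powr \<alpha>" using C \<alpha> by (simp add: ge_one_powr_ge_zero)
  have R1: "1 \<le> (1 / (1 - R)) powr \<alpha>" using R \<alpha> by (intro ge_one_powr_ge_zero) auto
  show thesis
  proof (rule that[of B \<alpha>])
    show "B > 0" using C R by (simp add: B_def)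
    fix r t :: real assume rt: "0 \<le> r" "r \<le> t" "t < 1"
    have pos: "0 \<le> tail w r" using tail_pos[OF w, of r] rt by simp
    consider "R \<le> r" | "r < R" "R \<le> t" | "t < R" by linarith
    then show "tail w t \<le> B * ((1 - t) / (1 - r)) powr \<alpha> * tail w r"
    proof cases
      case 1
      have "K powr \<alpha> * 1 * ((1 - t) / (1 - r)) powr \<alpha> * tail w r \<le> B * ((1 - t) / (1 - r)) powr \<alpha> * tail w r"
        unfolding B_def using R1 pos by (intro mult_right_mono mult_left_mono) auto
      then show ?thesis using main[OF 1 rt(2,3)] by simp
    next
      case 2
      have "tail w t \<le> K powr \<alpha> * ((1 - t) / (1 - R)) powr \<alpha> * tail w R"
        using 2 rt by (intro main) auto
      also have "\<dots> \<le> K powr \<alpha> * ((1 - t) / (1 - R)) powr \<alpha> * tail w r"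
        using 2 rt R by (intro mult_left_mono tail_antimono[OF w]) auto
      also have "\<dots> = B * (1 - t) powr \<alpha> * tail w r"
        using R rt by (simp add: B_def powr_divide)
      also have "\<dots> \<le> B * ((1 - t) / (1 - r)) powr \<alpha> * tail w r"
        using rt \<alpha> pos \<open>B > 0\<close>
        by (intro mult_right_mono mult_left_mono powr_mono2) (auto simp: field_simps mult_left_le)
      finally show ?thesis .
    next
      case 3
      have "1 \<le> (1 / (1 - R) * ((1 - t) / (1 - r))) powr \<alpha>"
      proof (intro ge_one_powr_ge_zero)
        have "(1 - R) * (1 - r) \<le> (1 - t) * 1" using 3 rt R by (intro mult_mono) auto
        moreover have "0 < (1 - R) * (1 - r)" using R rt by (intro mult_pos_pos) auto
        ultimately show "1 \<le> 1 / (1 - R) * ((1 - t) / (1 - r))" by (simp add: le_divide_eq_1)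
      qed (use \<alpha> in auto)
      also have "\<dots> = (1 / (1 - R)) powr \<alpha> * ((1 - t) / (1 - r)) powr \<alpha>"
        using R rt by (intro powr_mult) 
      finally have 4: "1 \<le> (1 / (1 - R)) powr \<alpha> * ((1 - t) / (1 - r)) powr \<alpha>" .
      have "tail w t \<le> 1 * 1 * tail w r" using rt by (simp add: tail_antimono[OF w])
      also have "\<dots> \<le> K powr \<alpha> * ((1 / (1 - R)) powr \<alpha> * ((1 - t) / (1 - r)) powr \<alpha>) * tail w r"
        using K1 4 pos by (intro mult_right_mono mult_mono) auto
      finally show ?thesis by (simp add: B_def mult_ac)
    qed
  qed (use \<alpha> in auto)
qed


section \<open>Moments compared with tails\<close>

lemma power_le_exp_half:
  fixes x :: real
  assumes "0 \<le> x"
  shows "x ^ b \<le> 2 ^ b * fact b * exp (x / 2)"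
proof -
  have s: "(\<lambda>n. (x / 2) ^ n /\<^sub>R fact n) sums exp (x / 2)" by (rule exp_converges)
  \<comment> \<open>A single term of the series of exp (x / 2). Half of the argument is used so
    that, against a decay exp (-x), the other half survives for summation.\<close>
  have "(x / 2) ^ b /\<^sub>R fact b \<le> exp (x / 2)"
    using sum_le_suminf[OF sums_summable[OF s], of "{b}"] sums_unique[OF s] assms by simp
  then show ?thesis by (simp add: field_simps power_divide)
qed

text \<open>The function r^x is dominated by a sum of steps exp (-k) on [1 - (k+1)/x, 1). By
  \<open>D_hat_growth\<close> the corresponding tails grow only polynomially in k relative to the
  tail at 1 - 1/x, so the exponential weights sum them.\<close>

lemma D_hat_mom_le:
  assumes "w \<in> D_hat"
  obtains C where "C > 0" "\<And>x. 1 \<le> x \<Longrightarrow> mom w x \<le> C * tail w (1 - 1 / x)"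
proof -
  note w = D_hat_radial_weight[OF assms]
  obtain A and b :: nat where A: "A \<ge> 1"
    "\<And>r t. 0 \<le> r \<Longrightarrow> r \<le> t \<Longrightarrow> t < 1 \<Longrightarrow> tail w r \<le> A * ((1 - r) / (1 - t)) ^ b * tail w t"
    using D_hat_growth[OF assms] by blast
  define g where "g k = exp (- real k) * real (Suc k) ^ b" for k
  have "summable g"
  proof (rule summable_comparison_test')
    show "summable (\<lambda>k. 2 ^ b * fact b * exp (1 / 2) * exp (- 1 / 2 :: real) ^ k)"
      by (intro summable_mult summable_geometric) simp
    fix k :: nat
    have "g k \<le> exp (- real k) * (2 ^ b * fact b * exp (real (Suc k) / 2))"
      unfolding g_def by (intro mult_left_mono power_le_exp_half) auto
    also have "\<dots> = 2 ^ b * fact b * exp (1 / 2) * exp (- 1 / 2) ^ k"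
    proof -
      have "exp (- 1 / 2) ^ k = exp (real k * (- 1 / 2))" by (rule exp_of_nat_mult[symmetric])
      moreover have "- real k + real (Suc k) / 2 = 1 / 2 + real k * (- 1 / 2)" by (simp add: field_simps)
      ultimately have "exp (- real k) * exp (real (Suc k) / 2) = exp (1 / 2) * exp (- 1 / 2) ^ k"
        by (simp only: exp_add[symmetric])
      then show ?thesis by (metis mult.assoc mult.left_commute)
    qed
    finally show "norm (g k) \<le> 2 ^ b * fact b * exp (1 / 2) * exp (- 1 / 2) ^ k"
      by (simp add: g_def)
  qed
  define C where "C = A * suminf g"
  have g0: "g k > 0" for k by (simp add: g_def)
  show thesis
  proof (rule that[of C])
    show "C > 0" using A suminf_pos[OF \<open>summable g\<close> g0] by (simp add: C_def)
    fix x :: real assume x: "1 \<le> x"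
    \<comment> \<open>The truncation at 0 keeps the points inside [0, 1). Since x (1 - r) is at most
      x, the finitely many steps up to the ceiling J of x suffice.\<close>
    define t where "t k = max 0 (1 - real (Suc k) / x)" for k
    define J where "J = nat \<lceil>x\<rceil>"
    have t: "0 \<le> t k" "t k \<le> 1 - 1 / x" "t k < 1" for k
      using x by (auto simp: t_def field_simps)
    have int: "set_integrable lebesgue {t k..<1} w" for k
      using t by (intro radial_weight_set_integrable[OF w]) auto
    have tail_t: "tail w (t k) \<le> A * real (Suc k) ^ b * tail w (1 - 1 / x)" for k
    proof -
      have "tail w (t k) \<le> A * ((1 - t k) / (1 - (1 - 1 / x))) ^ b * tail w (1 - 1 / x)"
        using t x by (intro A) auto
      also have "\<dots> \<le> A * real (Suc k) ^ b * tail w (1 - 1 / x)"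
        using t x A(1) less_imp_le[OF tail_pos[OF w, of "1 - 1 / x"]]
        by (intro mult_right_mono mult_left_mono power_mono) (auto simp: t_def field_simps max_def)
      finally show ?thesis .
    qed
    have pointwise: "r powr x \<le> (\<Sum>k\<le>J. exp (- real k) * indicator {t k..<1} r)" if r: "0 \<le> r" "r < 1" for r
    proof (cases "r = 0")
      case False
      define k where "k = nat \<lfloor>x * (1 - r)\<rfloor>"
      have k: "real k \<le> x * (1 - r)" "x * (1 - r) < real (Suc k)"
        using r x by (auto simp: k_def) linarith
      have "x * (1 - r) \<le> x" using r x by (simp add: algebra_simps)
      then have kJ: "k \<le> J" using k unfolding J_def by linarith
      have "t k \<le> r" using k r x by (auto simp: t_def field_simps)
      \<comment> \<open>From ln r <= r - 1 follows r^x <= exp (-x (1 - r)), and k is the integer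
        part of x (1 - r).\<close>
      have "x * ln r \<le> x * (r - 1)" using r x False by (intro mult_left_mono ln_le_minus_one) auto
      then have "r powr x \<le> exp (- real k)"
        using k False by (simp add: powr_def algebra_simps)
      also have "\<dots> = exp (- real k) * indicator {t k..<1} r" using \<open>t k \<le> r\<close> r by simp
      also have "\<dots> \<le> (\<Sum>k\<le>J. exp (- real k) * indicator {t k..<1} r)"
        using kJ by (intro member_le_sum) auto
      finally show ?thesis .
    qed (simp add: sum_nonneg)
    have "mom w x \<le> (LINT r|lebesgue. (\<Sum>k\<le>J. exp (- real k) * (indicator {t k..<1} r *\<^sub>R w r)))"
      unfolding mom_def set_lebesgue_integral_def
    proof (rule integral_mono)
      show "integrable lebesgue (\<lambda>r. indicator {0..<1} r *\<^sub>R (r powr x * w r))"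
        using powr_integrable[OF w, of x] x by (simp add: set_integrable_def)
      show "integrable lebesgue (\<lambda>r. \<Sum>k\<le>J. exp (- real k) * (indicator {t k..<1} r *\<^sub>R w r))"
        using int by (intro Bochner_Integration.integrable_sum integrable_mult_right) (auto simp: set_integrable_def)
      fix r :: real
      show "indicator {0..<1} r *\<^sub>R (r powr x * w r) \<le> (\<Sum>k\<le>J. exp (- real k) * (indicator {t k..<1} r *\<^sub>R w r))"
      proof (cases "0 \<le> r \<and> r < 1")
        case True
        then have "r powr x * w r \<le> (\<Sum>k\<le>J. exp (- real k) * indicator {t k..<1} r) * w r"
          by (intro mult_right_mono pointwise radial_weight_nonneg[OF w]) auto
        moreover have "\<dots> = (\<Sum>k\<le>J. exp (- real k) * (indicator {t k..<1} r *\<^sub>R w r))"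
          by (simp only: sum_distrib_right real_scaleR_def mult.assoc)
        ultimately show ?thesis using True by simp
      next
        case False
        then have "indicator {t k..<1} r = (0::real)" for k using t[of k] by (auto simp: indicator_def)
        then show ?thesis using False by (auto simp: indicator_def)
      qed
    qed
    also have "\<dots> = (\<Sum>k\<le>J. exp (- real k) * tail w (t k))"
      using int by (subst Bochner_Integration.integral_sum)
        (auto simp: set_integrable_def tail_def set_lebesgue_integral_def)
    also have "\<dots> \<le> (\<Sum>k\<le>J. exp (- real k) * (A * real (Suc k) ^ b * tail w (1 - 1 / x)))"
      by (intro sum_mono mult_left_mono tail_t) auto
    also have "\<dots> = A * (\<Sum>k\<le>J. g k) * tail w (1 - 1 / x)"
      by (simp add: g_def sum_distrib_left sum_distrib_right mult_ac)
    also have "\<dots> \<le> C * tail w (1 - 1 / x)"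
      unfolding C_def using x A(1) \<open>summable g\<close> g0 less_imp_le[OF tail_pos[OF w, of "1 - 1 / x"]]
      by (intro mult_right_mono mult_left_mono sum_le_suminf) (auto simp: less_imp_le)
    finally show "mom w x \<le> C * tail w (1 - 1 / x)" .
  qed
qed

text \<open>For x at least 1 the moments are exchanged for tails at 1 - 1/x and 1 - 1/(2x), which is
  exactly one doubling step apart. Smaller x only need positivity of the moment of order 2.\<close>

lemma D_hat_mom_doubling:
  assumes "w \<in> D_hat"
  obtains C where "C \<ge> 1" "\<And>x. 0 \<le> x \<Longrightarrow> mom w x \<le> C * mom w (2 * x)"
proof -
  note w = D_hat_radial_weight[OF assms]
  obtain D where D: "D > 0" "\<And>x. 1 \<le> x \<Longrightarrow> mom w x \<le> D * tail w (1 - 1 / x)"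
    using D_hat_mom_le[OF assms] by blast
  obtain E where E: "E \<ge> 1" "\<And>r. 0 \<le> r \<Longrightarrow> r < 1 \<Longrightarrow> tail w r \<le> E * tail w ((1 + r) / 2)"
    using D_hat_doubling[OF assms] by blast
  define C where "C = max 1 (max (D * (E * exp 2)) (tail w 0 / mom w 2))"
  show thesis
  proof (rule that[of C])
    fix x :: real assume x: "0 \<le> x"
    have pos: "0 \<le> mom w (2 * x)" using mom_pos[OF w, of "2 * x"] x by simp
    show "mom w x \<le> C * mom w (2 * x)"
    proof (cases "1 \<le> x")
      case True
      have "mom w x \<le> D * tail w (1 - 1 / x)" using True by (rule D)
      also have "tail w (1 - 1 / x) \<le> E * tail w ((1 + (1 - 1 / x)) / 2)"
        using True by (intro E) auto
      also have "(1 + (1 - 1 / x)) / 2 = 1 - 1 / (2 * x)" using True by (simp add: field_simps)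
      also have "tail w (1 - 1 / (2 * x)) \<le> exp 2 * mom w (2 * x)"
        using mom_ge_tail[OF w, of "2 * x" "2 * x"] True by (simp add: exp_minus field_simps)
      also have "D * (E * (exp 2 * mom w (2 * x))) \<le> C * mom w (2 * x)"
        using pos unfolding C_def mult.assoc[symmetric] by (intro mult_right_mono) auto
      finally show ?thesis using D E by simp
    next
      case False
      have "mom w x \<le> tail w 0" using x by (rule mom_le_tail[OF w])
      also have "\<dots> = tail w 0 / mom w 2 * mom w 2" using mom_pos[OF w, of 2] by simp
      also have "\<dots> \<le> C * mom w (2 * x)"
        using x False mom_pos[OF w, of 2]
        by (intro mult_mono mom_antimono[OF w]) (auto simp: C_def)
      finally show ?thesis .
    qed
  qed (simp add: C_def)
qed

section \<open>The tail and moment conditions\<close>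

definition tail_quotient :: "(real \<Rightarrow> real) \<Rightarrow> (real \<Rightarrow> real) \<Rightarrow> real \<Rightarrow> real" where
  "tail_quotient w v r = w r / tail v r"

lemma tail_quotient_nonneg:
  "radial_weight v \<Longrightarrow> radial_weight w \<Longrightarrow> 0 \<le> r \<Longrightarrow> r < 1 \<Longrightarrow> 0 \<le> tail_quotient w v r"
  by (simp add: tail_quotient_def radial_weight_nonneg less_imp_le[OF tail_pos])

lemma tail_borel_measurable:
  assumes "radial_weight v"
  shows "(\<lambda>r. indicator {0..<1} r * tail v r) \<in> borel_measurable borel"
proof -
  have "mono_on {0..<1} (\<lambda>r. - tail v r)"
    using assms by (intro mono_onI) (auto intro: tail_antimono)
  then have "(\<lambda>r. - tail v r) \<in> borel_measurable (restrict_space borel {0..<1})"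
    by (rule borel_measurable_mono_on_fnc)
  then have "(\<lambda>r. tail v r) \<in> borel_measurable (restrict_space borel {0..<1})"
    by (simp add: borel_measurable_uminus_eq)
  then show ?thesis
    by (subst (asm) borel_measurable_restrict_space_iff) auto
qed

lemma tail_quotient_measurable:
  assumes v: "radial_weight v" and w: "radial_weight w"
  shows "set_borel_measurable lebesgue {0..<1} (tail_quotient w v)"
proof -
  have "(\<lambda>r. indicator {0..<1} r * tail v r) \<in> borel_measurable lebesgue"
    using tail_borel_measurable[OF v] by (intro measurable_completion) auto
  moreover have "(\<lambda>r. indicator {0..<1} r *\<^sub>R w r) \<in> borel_measurable lebesgue"
    using radial_weight_set_integrable[OF w, of 0 1] by (auto simp: set_integrable_def)
  ultimately have "(\<lambda>r. (indicator {0..<1} r *\<^sub>R w r) / (indicator {0..<1} r * tail v r)) \<in> borel_measurable lebesgue"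
    by measurable
  also have "(\<lambda>r. (indicator {0..<1} r *\<^sub>R w r) / (indicator {0..<1} r * tail v r))
      = (\<lambda>r. indicator {0..<1} r *\<^sub>R tail_quotient w v r)"
    by (auto simp: indicator_def tail_quotient_def)
  finally show ?thesis by (simp add: set_borel_measurable_def)
qed

lemma tail_quotient_integrable_on:
  assumes "set_integrable lebesgue {0..<1} (tail_quotient w v)" "0 \<le> r" "t \<le> 1"
  shows "set_integrable lebesgue {r..<t} (tail_quotient w v)"
  by (rule set_integrable_subset[OF assms(1)]) (use assms in auto)

text \<open>Away from 1 the denominator is bounded below, so integrability of the quotient is a
  question about the boundary alone.\<close>

lemma tail_quotient_integrable_below:
  assumes v: "radial_weight v" and w: "radial_weight w" and t: "0 \<le> t" "t < 1"
  shows "set_integrable lebesgue {0..<t} (tail_quotient w v)"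
proof (rule set_integrable_bound)
  show "set_integrable lebesgue {0..<t} (\<lambda>r. w r / tail v t)"
    using radial_weight_set_integrable[OF w, of 0 t] t by simp
  show "set_borel_measurable lebesgue {0..<t} (tail_quotient w v)"
    using tail_quotient_measurable[OF v w]
    by (rule set_borel_measurable_subset) (use t in auto)
  show "AE r in lebesgue. r \<in> {0..<t} \<longrightarrow> norm (tail_quotient w v r) \<le> norm (w r / tail v t)"
  proof (rule AE_I2, intro impI)
    fix r assume "r \<in> {0..<t}"
    then have r: "0 \<le> r" "r < t" by auto
    have "w r / tail v r \<le> w r / tail v t"
      using r t tail_antimono[OF v, of r t] tail_pos[OF v] radial_weight_nonneg[OF w, of r]
      by (intro divide_left_mono mult_pos_pos) auto
    then show "norm (tail_quotient w v r) \<le> norm (w r / tail v t)"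
      using r t radial_weight_nonneg[OF w, of r] tail_pos[OF v, of r] tail_pos[OF v, of t]
      by (simp add: tail_quotient_def)
  qed
qed

text \<open>On [r, t) the denominator of the quotient is at most its value at r. Together with
  \<open>tail_quotient_diff_le\<close>, which uses the value at t instead, this replaces integration
  by parts against the tail of v.\<close>

lemma tail_quotient_diff_ge:
  assumes v: "radial_weight v" and w: "radial_weight w"
    and i: "set_integrable lebesgue {0..<1} (tail_quotient w v)" and rt: "0 \<le> r" "r \<le> t" "t < 1"
  shows "(tail w r - tail w t) / tail v r + tail (tail_quotient w v) t \<le> tail (tail_quotient w v) r"
proof -
  have "(tail w r - tail w t) / tail v r = (LINT s:{r..<t}|lebesgue. w s / tail v r)"
    using tail_split[OF radial_weight_set_integrable[OF w order.refl order.refl] rt] by simp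
  also have "\<dots> \<le> (LINT s:{r..<t}|lebesgue. tail_quotient w v s)"
  proof (rule set_integral_mono)
    show "set_integrable lebesgue {r..<t} (\<lambda>s. w s / tail v r)"
      using radial_weight_set_integrable[OF w, of r t] rt by simp
    show "set_integrable lebesgue {r..<t} (tail_quotient w v)"
      using rt by (intro tail_quotient_integrable_on[OF i]) auto
    fix s assume "s \<in> {r..<t}"
    then have "tail v s \<le> tail v r" "0 < tail v s" "0 \<le> w s"
      using rt by (auto intro: tail_antimono[OF v] tail_pos[OF v] radial_weight_nonneg[OF w])
    then show "w s / tail v r \<le> tail_quotient w v s"
      unfolding tail_quotient_def by (intro divide_left_mono) auto
  qed
  finally show ?thesis using tail_split[OF i rt] by simp
qed

lemma tail_quotient_diff_le:
  assumes v: "radial_weight v" and w: "radial_weight w"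
    and i: "set_integrable lebesgue {0..<1} (tail_quotient w v)" and rt: "0 \<le> r" "r \<le> t" "t < 1"
  shows "tail v t * (tail (tail_quotient w v) r - tail (tail_quotient w v) t) \<le> tail w r - tail w t"
proof -
  have "tail v t * (tail (tail_quotient w v) r - tail (tail_quotient w v) t)
      = (LINT s:{r..<t}|lebesgue. tail v t * tail_quotient w v s)"
    using tail_split[OF i rt] by simp
  also have "\<dots> \<le> (LINT s:{r..<t}|lebesgue. w s)"
  proof (rule set_integral_mono)
    show "set_integrable lebesgue {r..<t} w"
      using radial_weight_set_integrable[OF w, of r t] rt by simp
    show "set_integrable lebesgue {r..<t} (\<lambda>s. tail v t * tail_quotient w v s)"
      using tail_quotient_integrable_on[OF i, of r t] rt by simp
    fix s assume "s \<in> {r..<t}"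
    then have "tail v t \<le> tail v s" "0 < tail v s" "0 \<le> w s"
      using rt by (auto intro: tail_antimono[OF v] tail_pos[OF v] radial_weight_nonneg[OF w])
    then show "tail v t * tail_quotient w v s \<le> w s"
      using mult_right_mono[of "tail v t" "tail v s" "w s"] by (simp add: tail_quotient_def field_simps)
  qed
  finally show ?thesis using tail_split[OF radial_weight_set_integrable[OF w order.refl order.refl] rt] by simp
qed

lemma tail_quotient_ge:
  assumes v: "radial_weight v" and w: "radial_weight w"
    and i: "set_integrable lebesgue {0..<1} (tail_quotient w v)" and r: "0 \<le> r" "r < 1"
  shows "tail w r / tail v r \<le> tail (tail_quotient w v) r"
proof -
  have "tail w r / tail v r = (LINT s:{r..<1}|lebesgue. w s / tail v r)"
    by (simp add: tail_def)
  also have "\<dots> \<le> tail (tail_quotient w v) r"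
    unfolding tail_def[of "tail_quotient w v"]
  proof (rule set_integral_mono)
    show "set_integrable lebesgue {r..<1} (\<lambda>s. w s / tail v r)"
      using radial_weight_set_integrable[OF w, of r 1] r by simp
    show "set_integrable lebesgue {r..<1} (tail_quotient w v)"
      using r by (intro tail_quotient_integrable_on[OF i]) auto
    fix s assume "s \<in> {r..<1}"
    then have "tail v s \<le> tail v r" "0 < tail v s" "0 \<le> w s"
      using r by (auto intro: tail_antimono[OF v] tail_pos[OF v] radial_weight_nonneg[OF w])
    then show "w s / tail v r \<le> tail_quotient w v s"
      unfolding tail_quotient_def by (intro divide_left_mono) auto
  qed
  finally show ?thesis .
qed

lemma radial_weight_tail_quotient:
  assumes v: "radial_weight v" and w: "radial_weight w"
    and i: "set_integrable lebesgue {0..<1} (tail_quotient w v)"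
  shows "radial_weight (tail_quotient w v)"
  unfolding radial_weight_def
proof (intro conjI ballI i)
  fix r :: real assume "r \<in> {0..<1}"
  then have r: "0 \<le> r" "r < 1" by auto
  show "0 \<le> tail_quotient w v r" using tail_quotient_nonneg[OF v w r] .
  have "0 < tail w r / tail v r" using tail_pos[OF v r] tail_pos[OF w r] by simp
  also have "\<dots> \<le> tail (tail_quotient w v) r" by (rule tail_quotient_ge[OF v w i r])
  finally show "0 < tail (tail_quotient w v) r" .
qed

text \<open>The real form of the supremum condition in (iii). Integrability has to be a conjunct:
  the library integral of a nonintegrable quotient is 0 and would make the inequality trivially
  true.\<close>

definition tail_condition :: "(real \<Rightarrow> real) \<Rightarrow> (real \<Rightarrow> real) \<Rightarrow> bool" where
  "tail_condition w v \<longleftrightarrow> set_integrable lebesgue {0..<1} (tail_quotient w v) \<and>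
     (\<exists>C. \<forall>r. 0 \<le> r \<longrightarrow> r < 1 \<longrightarrow> tail v r * tail (tail_quotient w v) r \<le> C * tail w r)"

text \<open>The real form of the supremum condition in (ii), with integrability included for the
  same reason as in \<open>tail_condition\<close>.\<close>

definition moment_condition :: "(real \<Rightarrow> real) \<Rightarrow> (real \<Rightarrow> real) \<Rightarrow> bool" where
  "moment_condition w v \<longleftrightarrow> set_integrable lebesgue {0..<1} (tail_quotient w v) \<and>
     (\<exists>C. \<forall>x\<ge>0. mom v x * mom (tail_quotient w v) x \<le> C * mom w (2 * x))"

section \<open>Extended-valued suprema as real inequalities\<close>

lemma SUP_ennreal_less_top_iff:
  assumes "\<And>x. x \<in> A \<Longrightarrow> f x = ennreal (g x)"
  shows "(SUP x\<in>A. f x) < \<infinity> \<longleftrightarrow> (\<exists>C. \<forall>x\<in>A. g x \<le> C)"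
proof
  assume fin: "(SUP x\<in>A. f x) < \<infinity>"
  then obtain C where C: "(SUP x\<in>A. f x) = ennreal C" "C \<ge> 0"
    by (cases "SUP x\<in>A. f x") auto
  have "g x \<le> C" if "x \<in> A" for x
    using SUP_upper[OF that, of f] assms[OF that] C by simp
  then show "\<exists>C. \<forall>x\<in>A. g x \<le> C" by blast
next
  assume "\<exists>C. \<forall>x\<in>A. g x \<le> C"
  then obtain C where C: "\<forall>x\<in>A. g x \<le> C" by blast
  have "(SUP x\<in>A. f x) \<le> ennreal C"
    using C by (intro SUP_least) (simp add: assms ennreal_leI)
  also have "\<dots> < \<infinity>" by simp
  finally show "(SUP x\<in>A. f x) < \<infinity>" .
qed

lemma nn_integral_tail_quotient:
  assumes v: "radial_weight v" and w: "radial_weight w"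
    and i: "set_integrable lebesgue {0..<1} (tail_quotient w v)" and r: "0 \<le> r" "r < 1"
  shows "(\<integral>\<^sup>+ s\<in>{r..<1}. ennreal (tail_quotient w v s) \<partial>lebesgue) = ennreal (tail (tail_quotient w v) r)"
proof -
  have "(\<integral>\<^sup>+ s\<in>{r..<1}. ennreal (tail_quotient w v s) \<partial>lebesgue)
      = (\<integral>\<^sup>+ s. ennreal (indicator {r..<1} s *\<^sub>R tail_quotient w v s) \<partial>lebesgue)"
    by (intro nn_integral_cong) (auto simp: indicator_def)
  also have "\<dots> = ennreal (tail (tail_quotient w v) r)"
    unfolding tail_def set_lebesgue_integral_def
    using tail_quotient_integrable_on[OF i, of r 1] tail_quotient_nonneg[OF v w] r
    by (intro nn_integral_eq_integral) (auto simp: set_integrable_def indicator_def)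
  finally show ?thesis .
qed

lemma tail_quotient_integrableI:
  assumes v: "radial_weight v" and w: "radial_weight w"
    and fin: "(\<integral>\<^sup>+ s\<in>{0..<1}. ennreal (tail_quotient w v s) \<partial>lebesgue) < \<infinity>"
  shows "set_integrable lebesgue {0..<1} (tail_quotient w v)"
  unfolding set_integrable_def
proof (rule integrableI_nonneg)
  show "(\<lambda>x. indicator {0..<1} x *\<^sub>R tail_quotient w v x) \<in> borel_measurable lebesgue"
    using tail_quotient_measurable[OF v w] by (simp add: set_borel_measurable_def)
  show "AE x in lebesgue. 0 \<le> indicator {0..<1} x *\<^sub>R tail_quotient w v x"
    using tail_quotient_nonneg[OF v w] by (auto simp: indicator_def)
  have "(\<integral>\<^sup>+ x. ennreal (indicator {0..<1} x *\<^sub>R tail_quotient w v x) \<partial>lebesgue)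
      = (\<integral>\<^sup>+ s\<in>{0..<1}. ennreal (tail_quotient w v s) \<partial>lebesgue)"
    by (intro nn_integral_cong) (auto simp: indicator_def)
  then show "(\<integral>\<^sup>+ x. ennreal (indicator {0..<1} x *\<^sub>R tail_quotient w v x) \<partial>lebesgue) < \<infinity>"
    using fin by simp
qed

lemma ennreal_mult_less_top_right: "0 < c \<Longrightarrow> ennreal c * y < \<infinity> \<Longrightarrow> y < \<infinity>"
  by (auto simp: ennreal_mult_less_top less_top[symmetric] ennreal_mult_eq_top_iff top_unique)

text \<open>Integrability of the quotient is hidden in the supremum: its member at r = 0 is a
  positive factor times the full integral.\<close>

lemma tail_condition_iff:
  assumes v: "radial_weight v" and w: "radial_weight w"
  shows "(SUP r\<in>{0..<1}. ennreal (tail v r / tail w r) *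
      (\<integral>\<^sup>+ s\<in>{r..<1}. ennreal (tail_quotient w v s) \<partial>lebesgue)) < \<infinity> \<longleftrightarrow> tail_condition w v"
    (is "?S < \<infinity> \<longleftrightarrow> _")
proof -
  have bounded: "?S < \<infinity> \<longleftrightarrow> (\<exists>C. \<forall>r. 0 \<le> r \<longrightarrow> r < 1 \<longrightarrow> tail v r * tail (tail_quotient w v) r \<le> C * tail w r)"
    if i: "set_integrable lebesgue {0..<1} (tail_quotient w v)"
  proof -
    have "?S < \<infinity> \<longleftrightarrow> (\<exists>C. \<forall>r\<in>{0..<1}. tail v r / tail w r * tail (tail_quotient w v) r \<le> C)"
    proof (rule SUP_ennreal_less_top_iff)
      fix r :: real assume "r \<in> {0..<1}"
      then have r: "0 \<le> r" "r < 1" by auto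
      then show "ennreal (tail v r / tail w r) * (\<integral>\<^sup>+ s\<in>{r..<1}. ennreal (tail_quotient w v s) \<partial>lebesgue)
          = ennreal (tail v r / tail w r * tail (tail_quotient w v) r)"
        unfolding nn_integral_tail_quotient[OF v w i r] using tail_pos[OF v r] tail_pos[OF w r]
        by (intro ennreal_mult'[symmetric]) simp
    qed
    also have "\<dots> \<longleftrightarrow> (\<exists>C. \<forall>r. 0 \<le> r \<longrightarrow> r < 1 \<longrightarrow> tail v r * tail (tail_quotient w v) r \<le> C * tail w r)"
    proof (intro arg_cong[where f=Ex] ext)
      fix C
      show "(\<forall>r\<in>{0..<1}. tail v r / tail w r * tail (tail_quotient w v) r \<le> C) \<longleftrightarrow>
          (\<forall>r. 0 \<le> r \<longrightarrow> r < 1 \<longrightarrow> tail v r * tail (tail_quotient w v) r \<le> C * tail w r)"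
        using tail_pos[OF w] by (auto simp: field_simps)
    qed
    finally show ?thesis .
  qed
  show ?thesis
  proof
    assume S: "?S < \<infinity>"
    have "ennreal (tail v 0 / tail w 0) * (\<integral>\<^sup>+ s\<in>{0..<1}. ennreal (tail_quotient w v s) \<partial>lebesgue) \<le> ?S"
      by (rule SUP_upper2[where i = 0]) simp_all
    from order.strict_trans1[OF this S]
    have "(\<integral>\<^sup>+ s\<in>{0..<1}. ennreal (tail_quotient w v s) \<partial>lebesgue) < \<infinity>"
      by (rule ennreal_mult_less_top_right[rotated]) (simp add: tail_pos[OF v] tail_pos[OF w])
    then have "set_integrable lebesgue {0..<1} (tail_quotient w v)"
      by (rule tail_quotient_integrableI[OF v w])
    then show "tail_condition w v" using bounded S by (auto simp: tail_condition_def)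
  next
    assume "tail_condition w v"
    then show "?S < \<infinity>" using bounded by (auto simp: tail_condition_def)
  qed
qed

lemma moment_condition_iff:
  assumes v: "radial_weight v" and w: "radial_weight w"
  shows "(SUP x\<in>{0..}. moment v x / moment w (2 * x) * moment (tail_quotient w v) x) < \<infinity> \<longleftrightarrow> moment_condition w v"
    (is "?S < \<infinity> \<longleftrightarrow> _")
proof -
  have quot: "moment v x / moment w (2 * x) = ennreal (mom v x / mom w (2 * x))" if "0 \<le> x" for x
    using that mom_pos[OF w, of "2 * x"] mom_pos[OF v, of x]
    by (simp add: moment_eq_mom[OF v] moment_eq_mom[OF w] divide_ennreal)
  have bounded: "?S < \<infinity> \<longleftrightarrow> (\<exists>C. \<forall>x\<ge>0. mom v x * mom (tail_quotient w v) x \<le> C * mom w (2 * x))"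
    if i: "set_integrable lebesgue {0..<1} (tail_quotient w v)"
  proof -
    note s = radial_weight_tail_quotient[OF v w i]
    have "?S < \<infinity> \<longleftrightarrow> (\<exists>C. \<forall>x\<in>{0..}. mom v x / mom w (2 * x) * mom (tail_quotient w v) x \<le> C)"
    proof (rule SUP_ennreal_less_top_iff)
      fix x :: real assume "x \<in> {0..}"
      then have x: "0 \<le> x" by simp
      show "moment v x / moment w (2 * x) * moment (tail_quotient w v) x
          = ennreal (mom v x / mom w (2 * x) * mom (tail_quotient w v) x)"
        unfolding quot[OF x] moment_eq_mom[OF s x] using mom_pos[OF v x] mom_pos[OF w, of "2 * x"] x
        by (intro ennreal_mult'[symmetric]) simp
    qed
    also have "\<dots> \<longleftrightarrow> (\<exists>C. \<forall>x\<ge>0. mom v x * mom (tail_quotient w v) x \<le> C * mom w (2 * x))"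
    proof (intro arg_cong[where f=Ex] ext)
      fix C
      show "(\<forall>x\<in>{0..}. mom v x / mom w (2 * x) * mom (tail_quotient w v) x \<le> C) \<longleftrightarrow>
          (\<forall>x\<ge>0. mom v x * mom (tail_quotient w v) x \<le> C * mom w (2 * x))"
        using mom_pos[OF w] by (auto simp: field_simps)
    qed
    finally show ?thesis .
  qed
  show ?thesis
  proof
    assume S: "?S < \<infinity>"
    have "moment v 0 / moment w (2 * 0) * moment (tail_quotient w v) 0 \<le> ?S"
      by (rule SUP_upper2[where i = 0]) simp_all
    then have "ennreal (mom v 0 / mom w 0) * moment (tail_quotient w v) 0 < \<infinity>"
      using S quot[of 0] by simp
    then have "moment (tail_quotient w v) 0 < \<infinity>"
      by (rule ennreal_mult_less_top_right[rotated]) (simp add: mom_pos[OF v] mom_pos[OF w])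
    moreover have "moment (tail_quotient w v) 0 = (\<integral>\<^sup>+ s\<in>{0..<1}. ennreal (tail_quotient w v s) \<partial>lebesgue)"
      unfolding moment_def
    proof (rule nn_integral_cong_AE)
      \<comment> \<open>Since \<open>0 powr 0 = 0\<close>, the moment of order 0 and the plain
        integral have different integrands, but only at r = 0.\<close>
      have "AE r in lebesgue. r \<noteq> (0::real)" by (intro AE_completion AE_lborel_singleton)
      then show "AE r in lebesgue. ennreal (r powr 0 * tail_quotient w v r) * indicator {0..<1} r
          = ennreal (tail_quotient w v r) * indicator {0..<1} r"
        by eventually_elim auto
    qed
    ultimately have "set_integrable lebesgue {0..<1} (tail_quotient w v)"
      by (intro tail_quotient_integrableI[OF v w]) simp
    then show "moment_condition w v" using bounded S by (auto simp: moment_condition_def)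
  next
    assume "moment_condition w v"
    then show "?S < \<infinity>" using bounded by (auto simp: moment_condition_def)
  qed
qed

text \<open>With m the midpoint of r and 1, tail v r * (tail w m / tail v m) is at most tail v r
  times the tail of the quotient, hence at most C * tail w r. Doubling of w replaces tail w r by a
  multiple of tail w m, which then cancels. This is the source of the doubling of \<nu> in the whole
  development.\<close>

lemma tail_condition_D_hat:
  assumes w: "w \<in> D_hat" and v: "radial_weight v" and tc: "tail_condition w v"
  shows "v \<in> D_hat"
proof -
  note rw = D_hat_radial_weight[OF w]
  obtain C where i: "set_integrable lebesgue {0..<1} (tail_quotient w v)"
    and C: "\<And>r. 0 \<le> r \<Longrightarrow> r < 1 \<Longrightarrow> tail v r * tail (tail_quotient w v) r \<le> C * tail w r"
    using tc by (auto simp: tail_condition_def)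
  obtain E where E: "E \<ge> 1" "\<And>r. 0 \<le> r \<Longrightarrow> r < 1 \<Longrightarrow> tail w r \<le> E * tail w ((1 + r) / 2)"
    using D_hat_doubling[OF w] by blast
  note s = radial_weight_tail_quotient[OF v rw i]
  have C0: "C \<ge> 0"
  proof (rule ccontr)
    assume "\<not> 0 \<le> C"
    then have "C * tail w 0 < 0" using tail_pos[OF rw, of 0] by (simp add: mult_neg_pos)
    then show False using C[of 0] tail_pos[OF v, of 0] tail_pos[OF s, of 0]
      by (smt (verit) mult_pos_pos)
  qed
  show ?thesis
  proof (rule D_hatI[OF v, of 0 "C * E"])
    fix r :: real assume r: "0 \<le> r" "r < 1"
    define m where "m = (1 + r) / 2"
    have m: "0 \<le> m" "r \<le> m" "m < 1" using r by (auto simp: m_def)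
    have "tail v r * (tail w m / tail v m) \<le> tail v r * tail (tail_quotient w v) m"
      using tail_pos[OF v r] m by (intro mult_left_mono tail_quotient_ge[OF v rw i]) auto
    also have "\<dots> \<le> tail v r * tail (tail_quotient w v) r"
      using tail_pos[OF v r] m r by (intro mult_left_mono tail_antimono[OF s]) auto
    also have "\<dots> \<le> C * tail w r" by (rule C[OF r])
    also have "\<dots> \<le> C * (E * tail w m)" unfolding m_def using C0 r by (intro mult_left_mono E) auto
    finally show "tail v r \<le> C * E * tail v ((1 + r) / 2)"
      using tail_pos[OF rw m(1,3)] tail_pos[OF v m(1,3)] unfolding m_def[symmetric]
      by (simp add: field_simps)
  qed simp
qed

text \<open>The tail of the quotient at r is at most a multiple of tail w r / tail v r. Passing to
  the midpoint costs the doubling constant of w in the numerator, while the denominator only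
  decreases.\<close>

lemma tail_condition_quotient_D_hat:
  assumes w: "w \<in> D_hat" and v: "radial_weight v" and tc: "tail_condition w v"
  shows "tail_quotient w v \<in> D_hat"
proof -
  note rw = D_hat_radial_weight[OF w]
  obtain C where i: "set_integrable lebesgue {0..<1} (tail_quotient w v)"
    and C: "\<And>r. 0 \<le> r \<Longrightarrow> r < 1 \<Longrightarrow> tail v r * tail (tail_quotient w v) r \<le> C * tail w r"
    using tc by (auto simp: tail_condition_def)
  obtain E where E: "E \<ge> 1" "\<And>r. 0 \<le> r \<Longrightarrow> r < 1 \<Longrightarrow> tail w r \<le> E * tail w ((1 + r) / 2)"
    using D_hat_doubling[OF w] by blast
  note s = radial_weight_tail_quotient[OF v rw i]
  show ?thesis
  proof (rule D_hatI[OF s, of 0 "max C 0 * E"])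
    fix r :: real assume r: "0 \<le> r" "r < 1"
    define m where "m = (1 + r) / 2"
    have m: "0 \<le> m" "r \<le> m" "m < 1" using r by (auto simp: m_def)
    have "tail v r * tail (tail_quotient w v) r \<le> C * tail w r" by (rule C[OF r])
    also have "\<dots> \<le> max C 0 * (E * tail w m)"
      unfolding m_def using r tail_pos[OF rw r] by (intro mult_mono E) auto
    finally have "tail (tail_quotient w v) r \<le> max C 0 * E * (tail w m / tail v r)"
      using tail_pos[OF v r] by (simp add: field_simps)
    also have "\<dots> \<le> max C 0 * E * (tail w m / tail v m)"
      using tail_antimono[OF v r(1) m(2,3)] tail_pos[OF v m(1,3)] tail_pos[OF v r] tail_pos[OF rw m(1,3)] E
      by (intro mult_left_mono divide_left_mono) auto
    also have "\<dots> \<le> max C 0 * E * tail (tail_quotient w v) m"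
      using m E by (intro mult_left_mono tail_quotient_ge[OF v rw i]) auto
    finally show "tail (tail_quotient w v) r \<le> max C 0 * E * tail (tail_quotient w v) ((1 + r) / 2)"
      by (simp add: m_def)
  qed simp
qed

text \<open>The class fixes some factor above 1 for some K, and only near 1. The decay rate permits
  the factor 2 at every radius once K is enlarged.\<close>

lemma D_check_halving:
  assumes "v \<in> D_check"
  obtains K where "K > 1" "\<And>r. 0 \<le> r \<Longrightarrow> r < 1 \<Longrightarrow> 2 * tail v (1 - (1 - r) / K) \<le> tail v r"
proof -
  note v = D_check_radial_weight[OF assms]
  obtain B \<alpha> where B: "B > 0" "0 < \<alpha>"
    "\<And>r t. 0 \<le> r \<Longrightarrow> r \<le> t \<Longrightarrow> t < 1 \<Longrightarrow> tail v t \<le> B * ((1 - t) / (1 - r)) powr \<alpha> * tail v r"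
    using D_check_decay[OF assms] by metis
  \<comment> \<open>Chosen so that K^\<alpha> is at least 2B; the maximum with 2 ensures K >
    1.\<close>
  define K where "K = max 2 ((2 * B) powr (1 / \<alpha>))"
  have K: "K > 1" by (simp add: K_def)
  have "2 * B = ((2 * B) powr (1 / \<alpha>)) powr \<alpha>" using B by (simp add: powr_powr)
  also have "\<dots> \<le> K powr \<alpha>" using B by (intro powr_mono2) (auto simp: K_def)
  finally have KB: "2 * B \<le> K powr \<alpha>" .
  show thesis
  proof (rule that[OF K])
    fix r :: real assume r: "0 \<le> r" "r < 1"
    define t where "t = 1 - (1 - r) / K"
    have t: "r \<le> t" "t < 1" using r K mult_left_mono[of 1 K "1 - r"] by (auto simp: t_def field_simps)
    have "tail v t \<le> B * ((1 - t) / (1 - r)) powr \<alpha> * tail v r" using r t by (intro B) auto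
    also have "(1 - t) / (1 - r) = 1 / K" using r by (simp add: t_def)
    also have "(1 / K) powr \<alpha> = 1 / K powr \<alpha>" using K by (simp add: powr_divide)
    finally have "K powr \<alpha> * tail v t \<le> B * tail v r" using K by (simp add: field_simps)
    moreover have "2 * B * tail v t \<le> K powr \<alpha> * tail v t"
      using KB tail_pos[OF v, of t] r t by (intro mult_right_mono) auto
    ultimately have "B * (2 * tail v t) \<le> B * tail v r" by (simp add: mult_ac)
    then show "2 * tail v (1 - (1 - r) / K) \<le> tail v r" using B by (simp add: t_def)
  qed
qed

text \<open>Along \<open>r\<^sub>j = 1 - (1 - r) / K\<^sup>j\<close> summation by parts turns the tail of \<open>\<omega> / \<nu>\<close> at \<open>r\<close> into a sum
  of \<open>J\<close> quotients \<open>tail \<omega> r\<^sub>j / tail \<nu> r\<^sub>j\<close>, each of which dominates its tail at \<open>r\<^sub>J\<close>.\<close>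

lemma tail_condition_quotient_D_check:
  assumes w: "radial_weight w" and v: "v \<in> D_check" and tc: "tail_condition w v"
  shows "tail_quotient w v \<in> D_check"
proof -
  note rv = D_check_radial_weight[OF v]
  obtain C0 where i: "set_integrable lebesgue {0..<1} (tail_quotient w v)"
    and C0: "\<And>r. 0 \<le> r \<Longrightarrow> r < 1 \<Longrightarrow> tail v r * tail (tail_quotient w v) r \<le> C0 * tail w r"
    using tc by (auto simp: tail_condition_def)
  note s = radial_weight_tail_quotient[OF rv w i]
  define S where "S = tail (tail_quotient w v)"
  define C where "C = max C0 1"
  have C: "C > 0" "tail v r * S r \<le> C * tail w r" if "0 \<le> r" "r < 1" for r
  proof -
    have "C0 * tail w r \<le> C * tail w r"
      using tail_pos[OF w that] by (intro mult_right_mono) (auto simp: C_def)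
    then show "tail v r * S r \<le> C * tail w r" using C0[OF that] by (simp add: S_def)
  qed (simp add: C_def)
  have C1: "C > 0" by (simp add: C_def)
  obtain K where K: "K > 1" "\<And>r. 0 \<le> r \<Longrightarrow> r < 1 \<Longrightarrow> 2 * tail v (1 - (1 - r) / K) \<le> tail v r"
    using D_check_halving[OF v] by blast
  \<comment> \<open>With J at least 4C the factor J / (2C) in \<open>key\<close> is at least
    2.\<close>
  define J where "J = Suc (nat \<lceil>4 * C\<rceil>)"
  have J: "real J \<ge> 4 * C" unfolding J_def by linarith
  have bnd: "r \<le> 1 - (1 - r) / K ^ j \<and> 1 - (1 - r) / K ^ j < 1" if "0 \<le> r" "r < 1" for r and j :: nat
  proof -
    have "(1 - r) / K ^ j \<le> (1 - r) / 1" using that K by (intro divide_left_mono) auto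
    then show ?thesis using that K by auto
  qed
  have key: "real J / (2 * C) * S (1 - (1 - r) / K ^ J) \<le> S r" if r: "0 \<le> r" "r < 1" for r
  proof -
    define t where "t j = 1 - (1 - r) / K ^ j" for j
    have t: "r \<le> t j" "t j < 1" "0 \<le> t j" for j using bnd[OF r, of j] r by (auto simp: t_def)
    have tt: "t j \<le> t k" if "j \<le> k" for j k
      using K that r by (auto simp: t_def intro!: divide_left_mono power_increasing)
    have half: "2 * tail v (t (Suc j)) \<le> tail v (t j)" for j
      using K(2)[of "t j"] t[of j] by (simp add: t_def field_simps)
    \<comment> \<open>Since tail v halves at each step, (w_n - w_(n+1)) / v_n exceeds the
      telescoping difference w_n / v_n - w_(n+1) / v_(n+1) by at least w_(n+1) / (2 v_(n+1)), where
      w_n and v_n are the tails at t n. The surpluses accumulate in the sum, and the last boundary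
      term is finally absorbed by S at t J.\<close>
    have iter: "S (t 0) \<ge> (\<Sum>j<n. tail w (t (Suc j)) / (2 * tail v (t (Suc j)))) + S (t n)
        + tail w (t 0) / tail v (t 0) - tail w (t n) / tail v (t n)" for n
    proof (induction n)
      case (Suc n)
      have pos: "0 < tail v (t n)" "0 < tail v (t (Suc n))" "0 < tail w (t (Suc n))"
        using tail_pos[OF rv] tail_pos[OF w] t by auto
      have "(tail w (t n) - tail w (t (Suc n))) / tail v (t n) + S (t (Suc n)) \<le> S (t n)"
        unfolding S_def using t tt[of n "Suc n"] by (intro tail_quotient_diff_ge[OF rv w i]) auto
      moreover have "tail w (t (Suc n)) / tail v (t n) \<le> tail w (t (Suc n)) / (2 * tail v (t (Suc n)))"
        using half[of n] pos by (intro divide_left_mono) auto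
      ultimately show ?case using Suc by (simp add: diff_divide_distrib)
    qed simp
    have "real J / (2 * C) * S (t J) = (\<Sum>j<J. S (t J) / (2 * C))" by simp
    also have "\<dots> \<le> (\<Sum>j<J. tail w (t (Suc j)) / (2 * tail v (t (Suc j))))"
    proof (rule sum_mono)
      fix j assume "j \<in> {..<J}"
      then have "S (t J) \<le> S (t (Suc j))"
        unfolding S_def using t tt[of "Suc j" J] by (intro tail_antimono[OF s]) auto
      also have "\<dots> \<le> C * tail w (t (Suc j)) / tail v (t (Suc j))"
        using C(2)[OF t(3,2)[of "Suc j"]] tail_pos[OF rv t(3,2)[of "Suc j"]] by (simp add: field_simps)
      finally show "S (t J) / (2 * C) \<le> tail w (t (Suc j)) / (2 * tail v (t (Suc j)))"
        using C1 tail_pos[OF rv t(3,2)[of "Suc j"]] by (simp add: field_simps)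
    qed
    also have "\<dots> \<le> S (t 0)"
    proof -
      have "tail w (t J) / tail v (t J) \<le> S (t J)"
        unfolding S_def using t by (intro tail_quotient_ge[OF rv w i]) auto
      moreover have "0 \<le> tail w (t 0) / tail v (t 0)"
        using tail_pos[OF rv t(3,2)[of 0]] tail_pos[OF w t(3,2)[of 0]] by simp
      ultimately show ?thesis using iter[of J] by linarith
    qed
    finally show ?thesis by (simp add: t_def)
  qed
  show ?thesis
  proof (rule D_checkI[OF s, of 0 "K ^ J" 2])
    show "1 < K ^ J" using K by (intro one_less_power) (auto simp: J_def)
    fix r :: real assume r: "0 \<le> r" "r < 1"
    have "2 * S (1 - (1 - r) / K ^ J) \<le> real J / (2 * C) * S (1 - (1 - r) / K ^ J)"
    proof (rule mult_right_mono)
      show "2 \<le> real J / (2 * C)" using J C1 by (simp add: field_simps)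
      show "0 \<le> S (1 - (1 - r) / K ^ J)"
      proof -
        have "0 \<le> 1 - (1 - r) / K ^ J" "1 - (1 - r) / K ^ J < 1" using bnd[OF r, of J] r(1) by linarith+
        then show ?thesis unfolding S_def by (intro less_imp_le[OF tail_pos[OF s]])
      qed
    qed
    also have "\<dots> \<le> S r" by (rule key[OF r])
    finally show "2 * tail (tail_quotient w v) (1 - (1 - r) / K ^ J) \<le> tail (tail_quotient w v) r"
      by (simp add: S_def)
  qed auto
qed

text \<open>At least half of the tail of the quotient at r comes from [r, t) with t = 1 - (1 - r) /
  K. There tail v is comparable to its value at r, so multiplying by it turns the quotient back into
  w.\<close>

lemma tail_conditionI_D_class:
  assumes w: "radial_weight w" and v: "v \<in> D_hat" and q: "tail_quotient w v \<in> D_check"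
  shows "tail_condition w v"
proof -
  note rv = D_hat_radial_weight[OF v] and s = D_check_radial_weight[OF q]
  have i: "set_integrable lebesgue {0..<1} (tail_quotient w v)"
    using s by (auto simp: radial_weight_def)
  obtain K where K: "K > 1" "\<And>r. 0 \<le> r \<Longrightarrow> r < 1 \<Longrightarrow>
      2 * tail (tail_quotient w v) (1 - (1 - r) / K) \<le> tail (tail_quotient w v) r"
    using D_check_halving[OF q] by blast
  obtain A and b :: nat where A: "A \<ge> 1"
    "\<And>r t. 0 \<le> r \<Longrightarrow> r \<le> t \<Longrightarrow> t < 1 \<Longrightarrow> tail v r \<le> A * ((1 - r) / (1 - t)) ^ b * tail v t"
    using D_hat_growth[OF v] by blast
  have "tail v r * tail (tail_quotient w v) r \<le> 2 * (A * K ^ b) * tail w r" if r: "0 \<le> r" "r < 1" for r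
  proof -
    define t where "t = 1 - (1 - r) / K"
    have t: "r \<le> t" "t < 1" using r K mult_left_mono[of 1 K "1 - r"] by (auto simp: t_def field_simps)
    have "(1 - r) / (1 - t) = K" using r K by (simp add: t_def)
    then have 1: "tail v r \<le> A * K ^ b * tail v t" using A(2)[OF r(1) t] by simp
    have 2: "tail v t * (tail (tail_quotient w v) r - tail (tail_quotient w v) t) \<le> tail w r"
      using tail_quotient_diff_le[OF rv w i r(1) t] tail_pos[OF w, of t] r t by simp
    have 3: "tail (tail_quotient w v) r \<le> 2 * (tail (tail_quotient w v) r - tail (tail_quotient w v) t)"
      using K(2)[OF r] by (simp add: t_def)
    have "tail v r * tail (tail_quotient w v) r
        \<le> (A * K ^ b * tail v t) * (2 * (tail (tail_quotient w v) r - tail (tail_quotient w v) t))"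
      using 1 3 tail_pos[OF rv, of t] tail_pos[OF s, of r] r t A K
      by (intro mult_mono) (auto intro!: mult_nonneg_nonneg)
    also have "\<dots> = 2 * (A * K ^ b) * (tail v t * (tail (tail_quotient w v) r - tail (tail_quotient w v) t))"
      by simp
    also have "\<dots> \<le> 2 * (A * K ^ b) * tail w r" using 2 A K by (intro mult_left_mono) auto
    finally show ?thesis .
  qed
  then show ?thesis unfolding tail_condition_def using i by blast
qed

text \<open>The dictionary is r = 1 - 1/x. Upper bounds for the moments of v and of the quotient
  require doubling of both, which the tail condition itself supplies; for w only the universal lower
  bound is used, and its order 2x at the point 1 - 1/x produces exp 4.\<close>

lemma moment_condition_if_tail_condition:
  assumes w: "w \<in> D_hat" and v: "radial_weight v" and tc: "tail_condition w v"
  shows "moment_condition w v"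
proof -
  note rw = D_hat_radial_weight[OF w]
  obtain C0 where i: "set_integrable lebesgue {0..<1} (tail_quotient w v)"
    and C0: "\<And>r. 0 \<le> r \<Longrightarrow> r < 1 \<Longrightarrow> tail v r * tail (tail_quotient w v) r \<le> C0 * tail w r"
    using tc by (auto simp: tail_condition_def)
  note s = radial_weight_tail_quotient[OF v rw i]
  have vh: "v \<in> D_hat" and sh: "tail_quotient w v \<in> D_hat"
    using tail_condition_D_hat[OF assms] tail_condition_quotient_D_hat[OF assms] by auto
  obtain P where P: "P > 0" "\<And>x. 1 \<le> x \<Longrightarrow> mom v x \<le> P * tail v (1 - 1 / x)"
    using D_hat_mom_le[OF vh] by blast
  obtain Q where Q: "Q > 0" "\<And>x. 1 \<le> x \<Longrightarrow> mom (tail_quotient w v) x \<le> Q * tail (tail_quotient w v) (1 - 1 / x)"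
    using D_hat_mom_le[OF sh] by blast
  define C where "C = max C0 0"
  define D where "D = max (P * Q * C * exp 4) (tail v 0 * tail (tail_quotient w v) 0 / mom w 4)"
  have "mom v x * mom (tail_quotient w v) x \<le> D * mom w (2 * x)" if x: "0 \<le> x" for x
  proof (cases "2 \<le> x")
    case True
    define r where "r = 1 - 1 / x"
    have r: "0 \<le> r" "r < 1" using True by (auto simp: r_def)
    have "mom v x * mom (tail_quotient w v) x \<le> (P * tail v r) * (Q * tail (tail_quotient w v) r)"
      unfolding r_def using True mom_pos[OF s x] P tail_pos[OF v r]
      by (intro mult_mono P Q) (auto simp: r_def)
    also have "\<dots> = P * Q * (tail v r * tail (tail_quotient w v) r)" by simp
    also have "\<dots> \<le> P * Q * (C * tail w r)"
    proof (rule mult_left_mono)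
      have "C0 * tail w r \<le> C * tail w r" using tail_pos[OF rw r] by (intro mult_right_mono) (auto simp: C_def)
      then show "tail v r * tail (tail_quotient w v) r \<le> C * tail w r" using C0[OF r] by linarith
    qed (use P Q in auto)
    also have "tail w r \<le> exp 4 * mom w (2 * x)"
      using mom_ge_tail[OF rw True, of "2 * x"] True by (simp add: r_def exp_minus field_simps)
    then have "P * Q * (C * tail w r) \<le> P * Q * C * exp 4 * mom w (2 * x)"
      using P Q by (simp add: mult.assoc) (auto simp: C_def intro!: mult_left_mono)
    also have "\<dots> \<le> D * mom w (2 * x)"
      using mom_pos[OF rw, of "2 * x"] x by (intro mult_right_mono) (auto simp: D_def)
    finally show ?thesis .
  next
    case False
    have "mom v x * mom (tail_quotient w v) x \<le> tail v 0 * tail (tail_quotient w v) 0"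
      using x mom_pos[OF s x] tail_pos[OF v, of 0]
      by (intro mult_mono mom_le_tail v s) auto
    also have "\<dots> = tail v 0 * tail (tail_quotient w v) 0 / mom w 4 * mom w 4"
      using mom_pos[OF rw, of 4] by simp
    also have "\<dots> \<le> D * mom w (2 * x)"
    proof (rule mult_mono)
      show "mom w 4 \<le> mom w (2 * x)" using x False by (intro mom_antimono[OF rw]) auto
      have "0 \<le> P * Q * C * exp 4" using P Q by (auto simp: C_def)
      then show "0 \<le> D" by (simp add: D_def le_max_iff_disj)
    qed (use mom_pos[OF rw, of 4] in \<open>auto simp: D_def\<close>)
    finally show ?thesis .
  qed
  then show ?thesis unfolding moment_condition_def using i by blast
qed

text \<open>Here the regularity falls on the other side: v and the quotient are bounded below by the
  universal estimate, each at a cost of exp 2, and only w needs its moments bounded above by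
  tails.\<close>

lemma tail_condition_if_moment_condition:
  assumes w: "w \<in> D_hat" and v: "radial_weight v" and mc: "moment_condition w v"
  shows "tail_condition w v"
proof -
  note rw = D_hat_radial_weight[OF w]
  obtain C0 where i: "set_integrable lebesgue {0..<1} (tail_quotient w v)"
    and C0: "\<And>x. 0 \<le> x \<Longrightarrow> mom v x * mom (tail_quotient w v) x \<le> C0 * mom w (2 * x)"
    using mc by (auto simp: moment_condition_def)
  note s = radial_weight_tail_quotient[OF v rw i]
  obtain P where P: "P > 0" "\<And>x. 1 \<le> x \<Longrightarrow> mom w x \<le> P * tail w (1 - 1 / x)"
    using D_hat_mom_le[OF w] by blast
  define C where "C = max C0 0"
  define D where "D = max (exp 4 * C * P) (tail v 0 * tail (tail_quotient w v) 0 / tail w (1/2))"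
  have "tail v r * tail (tail_quotient w v) r \<le> D * tail w r" if r: "0 \<le> r" "r < 1" for r
  proof (cases "1/2 \<le> r")
    case True
    define x where "x = 1 / (1 - r)"
    have x: "2 \<le> x" "1 - 1 / x = r" using True r by (auto simp: x_def field_simps)
    have "tail v r \<le> exp 2 * mom v x"
      using mom_ge_tail[OF v x(1), of x] x by (simp add: exp_minus field_simps)
    moreover have "tail (tail_quotient w v) r \<le> exp 2 * mom (tail_quotient w v) x"
      using mom_ge_tail[OF s x(1), of x] x by (simp add: exp_minus field_simps)
    ultimately have "tail v r * tail (tail_quotient w v) r \<le> (exp 2 * mom v x) * (exp 2 * mom (tail_quotient w v) x)"
      using tail_pos[OF s r] mom_pos[OF v, of x] x by (intro mult_mono) auto
    also have "\<dots> = exp 4 * (mom v x * mom (tail_quotient w v) x)"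
      by (simp add: mult_exp_exp[symmetric] exp_add[symmetric])
    also have "\<dots> \<le> exp 4 * (C * (P * tail w r))"
    proof (rule mult_left_mono)
      have "mom v x * mom (tail_quotient w v) x \<le> C0 * mom w (2 * x)" using x by (intro C0) auto
      also have "\<dots> \<le> C * mom w x"
        using x mom_pos[OF rw, of "2 * x"] by (intro mult_mono mom_antimono[OF rw]) (auto simp: C_def)
      also have "\<dots> \<le> C * (P * tail w r)"
        using P(2)[of x] x by (intro mult_left_mono) (auto simp: C_def)
      finally show "mom v x * mom (tail_quotient w v) x \<le> C * (P * tail w r)" .
    qed auto
    also have "\<dots> \<le> D * tail w r"
      using tail_pos[OF rw r] unfolding D_def mult.assoc[symmetric] by (intro mult_right_mono) auto
    finally show ?thesis .
  next
    case False
    have "tail v r * tail (tail_quotient w v) r \<le> tail v 0 * tail (tail_quotient w v) 0"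
      using r tail_pos[OF s r] tail_pos[OF v, of 0] by (intro mult_mono tail_antimono v s) auto
    also have "\<dots> = tail v 0 * tail (tail_quotient w v) 0 / tail w (1/2) * tail w (1/2)"
      using tail_pos[OF rw, of "1/2"] by simp
    also have "\<dots> \<le> D * tail w r"
    proof (rule mult_mono)
      show "tail w (1/2) \<le> tail w r" using r False by (intro tail_antimono[OF rw]) auto
      have "0 \<le> exp 4 * C * P" using P by (auto simp: C_def)
      then show "0 \<le> D" by (simp add: D_def le_max_iff_disj)
    qed (use tail_pos[OF rw, of "1/2"] in \<open>auto simp: D_def\<close>)
    finally show ?thesis .
  qed
  then show ?thesis unfolding tail_condition_def using i by blast
qed

section \<open>A pointwise bound for the kernel\<close>

text \<open>The share of the n-th term in the size of the kernel at distance d from its singularity: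
  all of it while n is below about 1/d, and beyond that the decay gained from two summations by
  parts.\<close>

definition kernel_cutoff :: "nat \<Rightarrow> real \<Rightarrow> real" where
  "kernel_cutoff n d = min 1 (1 / (real (Suc n) * d)\<^sup>2)"

text \<open>Multiplication by (1 - z)^2 is summation by parts carried out twice; the first two
  summands on the right are the boundary terms.\<close>

lemma suminf_second_difference:
  fixes u :: "nat \<Rightarrow> complex"
  assumes "summable (\<lambda>n. u n * z ^ n)"
  shows "summable (\<lambda>n. (u (n + 2) - 2 * u (n + 1) + u n) * z ^ n)" (is ?A)
    and "(1 - z)\<^sup>2 * (\<Sum>n. u n * z ^ n) = u 0 * (1 - z) + (u 1 - u 0) * z
      + z\<^sup>2 * (\<Sum>n. (u (n + 2) - 2 * u (n + 1) + u n) * z ^ n)" (is ?B)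
proof -
  have "?A \<and> ?B"
  \<comment> \<open>Shifting the index cancels a factor z, so z = 0 is treated apart.\<close>
  proof (cases "z = 0")
    case True
    have "summable (\<lambda>n. a n * 0 ^ n :: complex)" for a
      by (rule summable_finite[of "{0}"]) auto
    then show ?thesis using True powser_zero[of u] by auto
  next
    case False
    have shift: "summable (\<lambda>n. a (Suc n) * z ^ n)" "(\<Sum>n. a n * z ^ n) = a 0 + z * (\<Sum>n. a (Suc n) * z ^ n)"
      if "summable (\<lambda>n. a n * z ^ n)" for a :: "nat \<Rightarrow> complex"
    proof -
      have "summable (\<lambda>n. z * (a (Suc n) * z ^ n))"
        using that by (subst (asm) summable_Suc_iff[symmetric]) (simp add: mult_ac)
      then show s: "summable (\<lambda>n. a (Suc n) * z ^ n)"
        using summable_cmult_iff[of z] False by auto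
      show "(\<Sum>n. a n * z ^ n) = a 0 + z * (\<Sum>n. a (Suc n) * z ^ n)"
        using suminf_split_head[OF that] suminf_mult[OF s, of z] by (simp add: algebra_simps)
    qed
    note s0 = assms
    note s1 = shift[OF s0]
    note s2 = shift[OF s1(1)]
    have "(\<lambda>n. u (Suc (Suc n)) * z ^ n - 2 * (u (Suc n) * z ^ n) + u n * z ^ n) sums
        ((\<Sum>n. u (Suc (Suc n)) * z ^ n) - 2 * (\<Sum>n. u (Suc n) * z ^ n) + (\<Sum>n. u n * z ^ n))"
      using s0 s1(1) s2(1) by (intro sums_add sums_diff sums_mult summable_sums)
    also have "(\<lambda>n. u (Suc (Suc n)) * z ^ n - 2 * (u (Suc n) * z ^ n) + u n * z ^ n)
        = (\<lambda>n. (u (n + 2) - 2 * u (n + 1) + u n) * z ^ n)"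
      by (simp add: fun_eq_iff algebra_simps)
    finally have sums: "(\<lambda>n. (u (n + 2) - 2 * u (n + 1) + u n) * z ^ n) sums
        ((\<Sum>n. u (Suc (Suc n)) * z ^ n) - 2 * (\<Sum>n. u (Suc n) * z ^ n) + (\<Sum>n. u n * z ^ n))" .
    have alg: "(1 - z)\<^sup>2 * S0 = u 0 * (1 - z) + (u 1 - u 0) * z + z\<^sup>2 * (S2 - 2 * S1 + S0)"
      if "S0 = u 0 + z * S1" "S1 = u (Suc 0) + z * S2" for S0 S1 S2
      unfolding that by (simp add: power2_eq_square algebra_simps)
    show ?thesis
      using sums alg[OF s1(2) s2(2)] by (auto simp: sums_iff)
  qed
  then show ?A ?B by auto
qed

text \<open>The series is split at N, about 1/\<delta> with \<delta> = |1 - z|. Below N the cutoff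
  is bounded from below and the triangle inequality suffices. From N on, dividing the second
  differences by \<delta>^2 produces exactly the cutoff. The boundary terms at N are absorbed by the
  dyadic block just before N.\<close>

lemma norm_power_series_le_cutoff:
  fixes c :: "nat \<Rightarrow> real" and z :: complex
  assumes pos: "\<And>n. 0 < c n" and mono: "\<And>m n. m \<le> n \<Longrightarrow> c m \<le> c n" and A: "0 \<le> A"
    and doubling: "\<And>n. c (2 * n + 1) \<le> A * c n"
    and diff1: "\<And>n. \<bar>c (Suc n) - c n\<bar> \<le> A * c n / real (Suc n)"
    and diff2: "\<And>n. \<bar>c (n + 2) - 2 * c (n + 1) + c n\<bar> \<le> A * c n / (real (Suc n))\<^sup>2"
    and summable: "summable (\<lambda>n. c n * cmod z ^ n)" and z: "cmod z < 1"
  shows "cmod (\<Sum>n. of_real (c n) * z ^ n)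
    \<le> (9 + 19 * A + 18 * A\<^sup>2) * (\<Sum>n. c n * cmod z ^ n * kernel_cutoff n (cmod (1 - z)))"
proof -
  define \<rho> where "\<rho> = cmod z"
  define \<delta> where "\<delta> = cmod (1 - z)"
  define q where "q n = kernel_cutoff n \<delta>" for n
  define Q where "Q = (\<Sum>n. c n * \<rho> ^ n * q n)"
  define N where "N = nat \<lceil>1 / \<delta>\<rceil>"
  have \<rho>: "0 \<le> \<rho>" "\<rho> < 1" using z by (auto simp: \<rho>_def)
  have \<delta>: "0 < \<delta>" "\<delta> \<le> 2" using z norm_triangle_ineq4[of 1 z] by (auto simp: \<delta>_def)
  have N: "1 / \<delta> \<le> N" "real N < 1 / \<delta> + 1" "N \<ge> 1"
  proof -
    have "0 < 1 / \<delta>" using \<delta> by simp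
    then show "1 / \<delta> \<le> N" "real N < 1 / \<delta> + 1" "N \<ge> 1" unfolding N_def by linarith+
  qed
  have N\<delta>: "1 \<le> real N * \<delta>" using N(1) \<delta> by (simp add: field_simps)
  have q0: "0 \<le> q n" "q n \<le> 1" for n by (auto simp: q_def kernel_cutoff_def)
  \<comment> \<open>For n < N the product (n + 1) \<delta> is at most N \<delta> <= 1 + \<delta> <=
    3, and 9 is the square of 3.\<close>
  have qlow: "1 / 9 \<le> q n" if "n < N" for n
  proof -
    have "real (Suc n) * \<delta> \<le> real N * \<delta>" using that \<delta> by (intro mult_right_mono) auto
    also have "\<dots> \<le> (1 / \<delta> + 1) * \<delta>" using N \<delta> by (intro mult_right_mono) auto
    also have "\<dots> \<le> 3" using \<delta> by (simp add: field_simps)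
    finally have "(real (Suc n) * \<delta>)\<^sup>2 \<le> 3\<^sup>2" using \<delta> by (intro power_mono) auto
    then have "1 / 9 \<le> 1 / (real (Suc n) * \<delta>)\<^sup>2" using \<delta> by (intro divide_left_mono) auto
    then show ?thesis by (simp add: q_def kernel_cutoff_def)
  qed
  have qhigh: "q n = 1 / (real (Suc n) * \<delta>)\<^sup>2" if "N \<le> n" for n
  proof -
    have "real N * \<delta> \<le> real (Suc n) * \<delta>" using that \<delta> by (intro mult_right_mono) auto
    then have "1 \<le> (real (Suc n) * \<delta>)\<^sup>2" using N\<delta> by (intro one_le_power) auto
    then have "1 / (real (Suc n) * \<delta>)\<^sup>2 \<le> 1" by (simp add: divide_le_eq_1 del: of_nat_Suc)
    then show ?thesis unfolding q_def kernel_cutoff_def by (rule min.absorb2)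
  qed
  have sumQ: "summable (\<lambda>n. c n * \<rho> ^ n * q n)"
    using q0 \<rho> less_imp_le[OF pos]
    by (intro summable_comparison_test'[OF summable]) (auto simp: \<rho>_def abs_mult intro!: mult_left_le)
  have term0: "0 \<le> c n * \<rho> ^ n * q n" for n using q0 \<rho> pos[of n] by simp
  have Qpart: "(\<Sum>n\<in>B. c n * \<rho> ^ n * q n) \<le> Q" if "finite B" for B
    unfolding Q_def using that term0 by (intro sum_le_suminf[OF sumQ]) auto
  have low: "(\<Sum>n\<in>B. c n * \<rho> ^ n) \<le> 9 * Q" if "B \<subseteq> {..<N}" for B
  proof -
    have "finite B" using that by (rule finite_subset) simp
    have "(\<Sum>n\<in>B. c n * \<rho> ^ n) \<le> (\<Sum>n\<in>B. 9 * (c n * \<rho> ^ n * q n))"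
    proof (rule sum_mono)
      fix n assume "n \<in> B"
      then have "c n * \<rho> ^ n * 1 \<le> c n * \<rho> ^ n * (9 * q n)"
        using qlow[of n] that pos[of n] \<rho> by (intro mult_left_mono) auto
      then show "c n * \<rho> ^ n \<le> 9 * (c n * \<rho> ^ n * q n)" by simp
    qed
    also have "\<dots> \<le> 9 * Q" using Qpart[OF \<open>finite B\<close>] by (simp add: sum_distrib_left[symmetric])
    finally show ?thesis .
  qed
  \<comment> \<open>The block from N div 2 to N has at least N/2 terms. On it N <= 2n + 1, so
    monotonicity and \<open>doubling\<close> give c N <= A * c n, and \<rho>^N <= \<rho>^n; the
    block itself is at most 9 Q.\<close>
  have edge: "real N * (c N * \<rho> ^ N) \<le> 18 * A * Q"
  proof -
    define B where "B = {N div 2..<N}"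
    have "real N / 2 * (c N * \<rho> ^ N) \<le> real (card B) * (c N * \<rho> ^ N)"
      using pos[of N] \<rho> by (intro mult_right_mono) (auto simp: B_def)
    also have "\<dots> = (\<Sum>n\<in>B. c N * \<rho> ^ N)" by simp
    also have "\<dots> \<le> (\<Sum>n\<in>B. A * (c n * \<rho> ^ n))"
    proof (rule sum_mono)
      fix n assume "n \<in> B"
      then have n: "N \<le> 2 * n + 1" "n < N" by (auto simp: B_def)
      have "c N \<le> A * c n" using mono[OF n(1)] doubling[of n] by linarith
      moreover have "\<rho> ^ N \<le> \<rho> ^ n" using \<rho> n by (intro power_decreasing) auto
      ultimately have "c N * \<rho> ^ N \<le> A * c n * \<rho> ^ n"
        using pos[of n] A \<rho> by (intro mult_mono) auto
      then show "c N * \<rho> ^ N \<le> A * (c n * \<rho> ^ n)" by simp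
    qed
    also have "\<dots> = A * (\<Sum>n\<in>B. c n * \<rho> ^ n)" by (simp add: sum_distrib_left)
    also have "\<dots> \<le> A * (9 * Q)" using A by (intro mult_left_mono low) (auto simp: B_def)
    finally show ?thesis by simp
  qed
  define u where "u n = (of_real (c (n + N)) :: complex)" for n
  have sum_c: "summable (\<lambda>n. of_real (c n) * z ^ n)"
    using pos by (intro summable_norm_cancel[OF summable_cong[THEN iffD1, OF _ summable]])
      (auto simp: norm_mult norm_power less_imp_le)
  have sum_shift: "summable (\<lambda>n. c (n + N) * \<rho> ^ (n + N))"
    using summable unfolding \<rho>_def by (rule summable_ignore_initial_segment)
  have sum_u: "summable (\<lambda>n. u n * z ^ n)"
  proof (cases "z = 0")
    case True
    then show ?thesis by (intro summable_finite[of "{0}"]) auto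
  next
    case False
    have "summable (\<lambda>n. z ^ N * (u n * z ^ n))"
      using summable_ignore_initial_segment[OF sum_c, of N] by (simp add: u_def power_add mult_ac)
    then show ?thesis using False summable_cmult_iff[of "z ^ N"] by auto
  qed
  define T where "T = (\<Sum>n. u n * z ^ n)"
  define R where "R = (\<Sum>n. (u (n + 2) - 2 * u (n + 1) + u n) * z ^ n)"
  have split: "(\<Sum>n. of_real (c n) * z ^ n) = (\<Sum>n<N. of_real (c n) * z ^ n) + z ^ N * T"
    using suminf_split_initial_segment[OF sum_c, of N] suminf_mult[OF sum_u, of "z ^ N"]
    by (simp add: T_def u_def power_add mult_ac)
  have id: "(1 - z)\<^sup>2 * T = u 0 * (1 - z) + (u 1 - u 0) * z + z\<^sup>2 * R"
    unfolding T_def R_def by (rule suminf_second_difference(2)[OF sum_u])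
  have R: "\<rho> ^ N * cmod R \<le> \<delta>\<^sup>2 * (A * Q)"
  proof -
    have le: "\<rho> ^ N * cmod ((u (n + 2) - 2 * u (n + 1) + u n) * z ^ n)
        \<le> \<delta>\<^sup>2 * A * (c (n + N) * \<rho> ^ (n + N) * q (n + N))" for n
    proof -
      have "u (n + 2) - 2 * u (n + 1) + u n = of_real (c (n + N + 2) - 2 * c (n + N + 1) + c (n + N))"
        by (simp add: u_def add_ac)
      then have "cmod (u (n + 2) - 2 * u (n + 1) + u n) \<le> A * c (n + N) / (real (Suc (n + N)))\<^sup>2"
        using diff2[of "n + N"] by (simp only: norm_of_real)
      also have "\<dots> = \<delta>\<^sup>2 * A * (c (n + N) * q (n + N))"
        using \<delta> by (simp add: qhigh power_mult_distrib del: of_nat_Suc)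
      finally have "\<rho> ^ (n + N) * cmod (u (n + 2) - 2 * u (n + 1) + u n)
          \<le> \<rho> ^ (n + N) * (\<delta>\<^sup>2 * A * (c (n + N) * q (n + N)))"
        using \<rho> by (intro mult_left_mono) auto
      then show ?thesis by (simp add: norm_mult norm_power \<rho>_def power_add mult_ac)
    qed
    have sumQN: "summable (\<lambda>n. c (n + N) * \<rho> ^ (n + N) * q (n + N))"
      by (rule summable_ignore_initial_segment[OF sumQ])
    have s1: "summable (\<lambda>n. \<rho> ^ N * cmod ((u (n + 2) - 2 * u (n + 1) + u n) * z ^ n))"
      using \<rho> le by (intro summable_comparison_test'[OF summable_mult[OF sumQN, of "\<delta>\<^sup>2 * A"]]) auto
    have "\<rho> ^ N * cmod R = cmod (\<Sum>n. z ^ N * ((u (n + 2) - 2 * u (n + 1) + u n) * z ^ n))"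
      using suminf_mult[OF suminf_second_difference(1)[OF sum_u], of "z ^ N"]
      by (simp add: R_def norm_mult norm_power \<rho>_def)
    also have "\<dots> \<le> (\<Sum>n. cmod (z ^ N * ((u (n + 2) - 2 * u (n + 1) + u n) * z ^ n)))"
      using s1 by (intro summable_norm) (simp add: norm_mult norm_power \<rho>_def)
    also have "\<dots> = (\<Sum>n. \<rho> ^ N * cmod ((u (n + 2) - 2 * u (n + 1) + u n) * z ^ n))"
      by (simp add: norm_mult norm_power \<rho>_def)
    also have "\<dots> \<le> (\<Sum>n. \<delta>\<^sup>2 * A * (c (n + N) * \<rho> ^ (n + N) * q (n + N)))"
      by (intro suminf_le le s1 summable_mult sumQN)
    also have "\<dots> = \<delta>\<^sup>2 * A * (\<Sum>n. c (n + N) * \<rho> ^ (n + N) * q (n + N))"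
      by (rule suminf_mult[OF sumQN])
    also have "\<dots> \<le> \<delta>\<^sup>2 * A * Q"
    proof (rule mult_left_mono)
      have "0 \<le> (\<Sum>n<N. c n * \<rho> ^ n * q n)" by (intro sum_nonneg term0)
      then show "(\<Sum>n. c (n + N) * \<rho> ^ (n + N) * q (n + N)) \<le> Q"
        unfolding Q_def using suminf_split_initial_segment[OF sumQ, of N] by simp
    qed (use A in auto)
    finally show ?thesis by (simp add: mult_ac)
  qed
  have "\<delta>\<^sup>2 * (\<rho> ^ N * cmod T) = \<rho> ^ N * cmod (u 0 * (1 - z) + (u 1 - u 0) * z + z\<^sup>2 * R)"
    unfolding id[symmetric] by (simp add: norm_mult norm_power \<delta>_def)
  also have "\<dots> \<le> \<rho> ^ N * (c N * \<delta> + A * c N / real (Suc N) + cmod R)"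
  proof (rule mult_left_mono)
    have 1: "cmod (u 0 * (1 - z)) = c N * \<delta>"
      using pos[of N] by (simp add: u_def norm_mult \<delta>_def)
    have "u 1 - u 0 = of_real (c (Suc N) - c N)" by (simp add: u_def)
    then have "cmod (u 1 - u 0) \<le> A * c N / real (Suc N)"
      using diff1[of N] by (simp only: norm_of_real)
    then have "cmod (u 1 - u 0) * cmod z \<le> A * c N / real (Suc N) * 1"
      using z A pos[of N] by (intro mult_mono) auto
    then have 2: "cmod ((u 1 - u 0) * z) \<le> A * c N / real (Suc N)" by (simp add: norm_mult)
    have 3: "cmod (z\<^sup>2 * R) \<le> cmod R"
      using z by (simp add: norm_mult norm_power mult_left_le_one_le power_le_one)
    show "cmod (u 0 * (1 - z) + (u 1 - u 0) * z + z\<^sup>2 * R) \<le> c N * \<delta> + A * c N / real (Suc N) + cmod R"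
      using norm_triangle_ineq[of "u 0 * (1 - z) + (u 1 - u 0) * z" "z\<^sup>2 * R"]
        norm_triangle_ineq[of "u 0 * (1 - z)" "(u 1 - u 0) * z"] 1 2 3 by linarith
  qed (use \<rho> in auto)
  also have "\<dots> = c N * \<rho> ^ N * \<delta> + A * (c N * \<rho> ^ N / real (Suc N)) + \<rho> ^ N * cmod R"
    by (simp add: algebra_simps)
  \<comment> \<open>Both boundary terms are brought to the form of \<open>edge\<close> through N
    \<delta> >= 1, which gives \<delta> <= \<delta>^2 N and 1 / (N + 1) <= \<delta>^2 N.\<close>
  also have "\<dots> \<le> \<delta>\<^sup>2 * (real N * (c N * \<rho> ^ N)) + A * (\<delta>\<^sup>2 * (real N * (c N * \<rho> ^ N))) + \<delta>\<^sup>2 * (A * Q)"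
  proof (intro add_mono mult_left_mono R A)
    have p: "0 \<le> c N * \<rho> ^ N" using pos[of N] \<rho> by simp
    have "1 * \<delta> \<le> (real N * \<delta>) * \<delta>" using N\<delta> \<delta> by (intro mult_right_mono) auto
    then have "c N * \<rho> ^ N * \<delta> \<le> c N * \<rho> ^ N * (real N * \<delta> * \<delta>)" using p by (intro mult_left_mono) auto
    then show "c N * \<rho> ^ N * \<delta> \<le> \<delta>\<^sup>2 * (real N * (c N * \<rho> ^ N))"
      by (simp add: power2_eq_square mult_ac)
    have "1 * 1 \<le> (real N * \<delta>) * (real N * \<delta>)" using N\<delta> by (intro mult_mono) auto
    also have "\<dots> = \<delta>\<^sup>2 * real N * real N" by (simp add: power2_eq_square mult_ac)
    also have "\<dots> \<le> \<delta>\<^sup>2 * real N * real (Suc N)" by (intro mult_left_mono) auto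
    finally have "1 / real (Suc N) \<le> \<delta>\<^sup>2 * real N" by (simp add: divide_le_eq)
    then have "c N * \<rho> ^ N * (1 / real (Suc N)) \<le> c N * \<rho> ^ N * (\<delta>\<^sup>2 * real N)"
      using p by (intro mult_left_mono) auto
    then show "c N * \<rho> ^ N / real (Suc N) \<le> \<delta>\<^sup>2 * (real N * (c N * \<rho> ^ N))"
      by (simp add: mult_ac)
  qed
  also have "\<dots> = \<delta>\<^sup>2 * ((1 + A) * (real N * (c N * \<rho> ^ N)) + A * Q)"
    by (simp add: algebra_simps)
  finally have "\<rho> ^ N * cmod T \<le> (1 + A) * (real N * (c N * \<rho> ^ N)) + A * Q"
    using \<delta> by simp
  also have "\<dots> \<le> (1 + A) * (18 * A * Q) + A * Q"
    using A edge by (intro add_mono mult_left_mono) auto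
  finally have T: "\<rho> ^ N * cmod T \<le> (1 + A) * (18 * A * Q) + A * Q" .
  have "cmod (\<Sum>n. of_real (c n) * z ^ n) \<le> cmod (\<Sum>n<N. of_real (c n) * z ^ n) + \<rho> ^ N * cmod T"
    unfolding split by (rule order.trans[OF norm_triangle_ineq]) (simp add: norm_mult norm_power \<rho>_def)
  also have "cmod (\<Sum>n<N. of_real (c n) * z ^ n) \<le> (\<Sum>n<N. c n * \<rho> ^ n)"
    using pos by (intro order.trans[OF norm_sum] sum_mono) (auto simp: norm_mult norm_power \<rho>_def less_imp_le)
  also have "\<dots> \<le> 9 * Q" by (rule low) simp
  finally have "cmod (\<Sum>n. of_real (c n) * z ^ n) \<le> 9 * Q + ((1 + A) * (18 * A * Q) + A * Q)"
    using T by linarith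
  also have "\<dots> = (9 + 19 * A + 18 * A\<^sup>2) * Q" by (simp add: algebra_simps power2_eq_square)
  finally show ?thesis by (simp add: Q_def q_def \<rho>_def \<delta>_def)
qed

section \<open>Differences of moments and of their reciprocals\<close>

lemma mom_Suc: "mom w (real (Suc k)) = (LINT r:{0..<1}|lebesgue. r ^ Suc k * w r)"
  unfolding mom_def set_lebesgue_integral_def
proof (intro Bochner_Integration.integral_cong refl)
  fix r :: real
  \<comment> \<open>At r = 0 the two powers agree because the exponent is positive; for exponent 0
    they would be 0 and 1.\<close>
  have "r powr real (Suc k) = r ^ Suc k" if "0 \<le> r"
    using that powr_realpow[of r "Suc k"] by (cases "r = 0") auto
  then show "indicator {0..<1} r *\<^sub>R (r powr real (Suc k) * w r) = indicator {0..<1} r *\<^sub>R (r ^ Suc k * w r)"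
    by (cases "0 \<le> r") (auto simp: indicator_def simp del: power_Suc of_nat_Suc)
qed

lemma power_weight_integrable:
  "radial_weight w \<Longrightarrow> set_integrable lebesgue {0..<1} (\<lambda>r. r ^ k * w r)"
  by (rule radial_weight_mult_integrable) (auto simp: power_abs[symmetric] intro: power_le_one)

lemma power_times_one_minus_le:
  fixes r :: real
  assumes "0 \<le> r" "r < 1"
  shows "r ^ n * (1 - r\<^sup>2) \<le> 2 / real (Suc n)"
proof -
  have "real (Suc n) * r ^ n = (\<Sum>k<Suc n. r ^ n)" by simp
  also have "\<dots> \<le> (\<Sum>k<Suc n. r ^ k)"
    using assms by (intro sum_mono power_decreasing) auto
  finally have "(1 - r) * (real (Suc n) * r ^ n) \<le> (1 - r) * (\<Sum>k<Suc n. r ^ k)"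
    using assms by (intro mult_left_mono) auto
  also have "\<dots> = 1 - r ^ Suc n" by (rule sum_gp_basic[of r n, unfolded lessThan_Suc_atMost[symmetric]])
  also have "\<dots> \<le> 1" using assms by simp
  finally have "real (Suc n) * (r ^ n * (1 - r)) \<le> 1" by (simp add: mult_ac)
  then have 1: "r ^ n * (1 - r) \<le> 1 / real (Suc n)" by (simp add: field_simps)
  have "r ^ n * (1 - r\<^sup>2) = (1 + r) * (r ^ n * (1 - r))" by (simp add: power2_eq_square algebra_simps)
  also have "\<dots> \<le> 2 * (1 / real (Suc n))" using assms 1 by (intro mult_mono) auto
  finally show ?thesis by simp
qed

text \<open>Of r^(2n+1) the part r^n is spent on absorbing the factor 1 - r^2 at the price 2 / (n +
  1), leaving the moment of the lower order n + 1. For doubling weights this loss of order costs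
  only a constant.\<close>

lemma mom_first_difference:
  assumes w: "radial_weight w"
  shows "mom w (real (2 * n + 1)) - mom w (real (2 * n + 3)) \<le> 2 * mom w (real (n + 1)) / real (Suc n)"
proof -
  have "mom w (real (2 * n + 1)) - mom w (real (2 * n + 3))
      = (LINT r:{0..<1}|lebesgue. r ^ Suc (2 * n) * w r - r ^ Suc (2 * n + 2) * w r)"
  proof -
    have e: "2 * n + 1 = Suc (2 * n)" "2 * n + 3 = Suc (2 * n + 2)" by simp_all
    show ?thesis
      unfolding e mom_Suc by (intro set_integral_diff(2)[symmetric] power_weight_integrable w)
  qed
  also have "\<dots> \<le> (LINT r:{0..<1}|lebesgue. 2 / real (Suc n) * (r ^ Suc n * w r))"
  proof (rule set_integral_mono)
    show "set_integrable lebesgue {0..<1} (\<lambda>r. r ^ Suc (2 * n) * w r - r ^ Suc (2 * n + 2) * w r)"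
      by (intro set_integral_diff power_weight_integrable w)
    show "set_integrable lebesgue {0..<1} (\<lambda>r. 2 / real (Suc n) * (r ^ Suc n * w r))"
      using power_weight_integrable[OF w, of "Suc n"] by (intro set_integrable_mult_right) auto
    fix r :: real assume "r \<in> {0..<1}"
    then have r: "0 \<le> r" "r < 1" by auto
    have "(r ^ n * (1 - r\<^sup>2)) * (r ^ Suc n * w r) \<le> 2 / real (Suc n) * (r ^ Suc n * w r)"
      using r radial_weight_nonneg[OF w r] by (intro mult_right_mono power_times_one_minus_le) auto
    also have "(r ^ n * (1 - r\<^sup>2)) * (r ^ Suc n * w r) = r ^ Suc (2 * n) * w r - r ^ Suc (2 * n + 2) * w r"
    proof -
      have "r ^ (2 * n) = r ^ n * r ^ n" by (simp add: power_add[symmetric] mult_2)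
      then show ?thesis by (simp add: algebra_simps power2_eq_square)
    qed
    finally show "r ^ Suc (2 * n) * w r - r ^ Suc (2 * n + 2) * w r \<le> 2 / real (Suc n) * (r ^ Suc n * w r)" .
  qed
  also have "\<dots> = 2 * mom w (real (n + 1)) / real (Suc n)"
    using mom_Suc[of w n] by simp
  finally show ?thesis .
qed

lemma mom_second_difference:
  assumes w: "radial_weight w"
  shows "\<bar>mom w (real (2 * n + 1)) - 2 * mom w (real (2 * n + 3)) + mom w (real (2 * n + 5))\<bar>
    \<le> 16 * mom w (real (n + 1)) / (real (Suc n))\<^sup>2"
proof -
  let ?f = "\<lambda>r. r ^ Suc (2 * n) * w r - 2 * (r ^ Suc (2 * n + 2) * w r) + r ^ Suc (2 * n + 4) * w r"
  have f: "?f r = (1 - r\<^sup>2)\<^sup>2 * (r ^ Suc (2 * n) * w r)" for r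
  proof -
    have "r ^ Suc (2 * n + 2) = r ^ Suc (2 * n) * r\<^sup>2" "r ^ Suc (2 * n + 4) = r ^ Suc (2 * n) * (r\<^sup>2)\<^sup>2"
    proof -
      have e: "Suc (2 * n + 2) = Suc (2 * n) + 2" "Suc (2 * n + 4) = Suc (2 * n) + 4" by simp_all
      have "(r\<^sup>2)\<^sup>2 = r ^ 4" by (simp add: power_mult[symmetric])
      then show "r ^ Suc (2 * n + 2) = r ^ Suc (2 * n) * r\<^sup>2" "r ^ Suc (2 * n + 4) = r ^ Suc (2 * n) * (r\<^sup>2)\<^sup>2"
        unfolding e by (simp_all only: power_add)
    qed
    then show ?thesis by (simp add: power2_eq_square algebra_simps del: power_Suc)
  qed
  have int: "set_integrable lebesgue {0..<1} ?f"
    by (intro set_integral_add set_integral_diff set_integrable_mult_right impI power_weight_integrable w)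
  have "mom w (real (2 * n + 1)) - 2 * mom w (real (2 * n + 3)) + mom w (real (2 * n + 5)) = (LINT r:{0..<1}|lebesgue. ?f r)"
  proof -
    have "(LINT r:{0..<1}|lebesgue. ?f r) = (LINT r:{0..<1}|lebesgue. r ^ Suc (2 * n) * w r)
        - (LINT r:{0..<1}|lebesgue. 2 * (r ^ Suc (2 * n + 2) * w r)) + (LINT r:{0..<1}|lebesgue. r ^ Suc (2 * n + 4) * w r)"
    proof -
      have i: "set_integrable lebesgue {0..<1} (\<lambda>r. r ^ k * w r)"
        "set_integrable lebesgue {0..<1} (\<lambda>r. 2 * (r ^ k * w r))" for k
        using power_weight_integrable[OF w, of k] by (auto intro: set_integrable_mult_right)
      show ?thesis
        unfolding set_integral_add(2)[OF set_integral_diff(1)[OF i(1) i(2)] i(1)] set_integral_diff(2)[OF i(1) i(2)] ..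
    qed
    also have "\<dots> = mom w (real (2 * n + 1)) - 2 * mom w (real (2 * n + 3)) + mom w (real (2 * n + 5))"
      using mom_Suc[of w "2 * n"] mom_Suc[of w "2 * n + 2"] mom_Suc[of w "2 * n + 4"] by (simp del: power_Suc add: add_ac)
    finally show ?thesis by simp
  qed
  moreover have "0 \<le> (LINT r:{0..<1}|lebesgue. ?f r)"
    unfolding set_lebesgue_integral_def f
    using radial_weight_nonneg[OF w] by (intro Bochner_Integration.integral_nonneg) (auto simp: indicator_def)
  moreover have "(LINT r:{0..<1}|lebesgue. ?f r) \<le> (LINT r:{0..<1}|lebesgue. 16 / (real (Suc n))\<^sup>2 * (r ^ Suc n * w r))"
  proof (rule set_integral_mono[OF int])
    show "set_integrable lebesgue {0..<1} (\<lambda>r. 16 / (real (Suc n))\<^sup>2 * (r ^ Suc n * w r))"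
      using power_weight_integrable[OF w, of "Suc n"] by (intro set_integrable_mult_right) auto
    fix r :: real assume "r \<in> {0..<1}"
    then have r: "0 \<le> r" "r < 1" by auto
    \<comment> \<open>Now there are two factors 1 - r^2, and each receives r^(n div 2). The price is
      4 / (n + 1) apiece, hence 16 / (n + 1)^2 together.\<close>
    define k where "k = n div 2"
    have k: "2 * k \<le> n" "real (Suc n) \<le> 2 * real (Suc k)" by (auto simp: k_def)
    have "1 - r\<^sup>2 \<ge> 0" using r by (simp add: power_le_one)
    have "r ^ k * (1 - r\<^sup>2) \<le> 2 / real (Suc k)" by (rule power_times_one_minus_le[OF r])
    also have "\<dots> \<le> 4 / real (Suc n)" using k by (simp add: field_simps)
    finally have "(r ^ k * (1 - r\<^sup>2))\<^sup>2 \<le> (4 / real (Suc n))\<^sup>2"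
      using \<open>1 - r\<^sup>2 \<ge> 0\<close> r by (intro power_mono) auto
    then have 1: "r ^ (2 * k) * (1 - r\<^sup>2)\<^sup>2 \<le> 16 / (real (Suc n))\<^sup>2"
      by (simp add: power_mult_distrib power_divide power_mult[symmetric] mult.commute)
    have "r ^ n \<le> r ^ (2 * k)" using r k by (intro power_decreasing) auto
    then have "r ^ n * (1 - r\<^sup>2)\<^sup>2 \<le> r ^ (2 * k) * (1 - r\<^sup>2)\<^sup>2" by (intro mult_right_mono) auto
    with 1 have "r ^ n * (1 - r\<^sup>2)\<^sup>2 \<le> 16 / (real (Suc n))\<^sup>2" by linarith
    then have "r ^ n * (1 - r\<^sup>2)\<^sup>2 * (r ^ Suc n * w r) \<le> 16 / (real (Suc n))\<^sup>2 * (r ^ Suc n * w r)"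
      using r radial_weight_nonneg[OF w r] by (intro mult_right_mono) auto
    moreover have "r ^ n * (1 - r\<^sup>2)\<^sup>2 * (r ^ Suc n * w r) = ?f r"
    proof -
      have e: "r ^ Suc (2 * n) = r ^ n * r ^ Suc n" by (simp add: power_add[symmetric] mult_2)
      show ?thesis unfolding f unfolding e by (simp only: mult_ac)
    qed
    ultimately show "?f r \<le> 16 / (real (Suc n))\<^sup>2 * (r ^ Suc n * w r)" by linarith
  qed
  moreover have "(LINT r:{0..<1}|lebesgue. 16 / (real (Suc n))\<^sup>2 * (r ^ Suc n * w r)) = 16 * mom w (real (n + 1)) / (real (Suc n))\<^sup>2"
    using mom_Suc[of w n] by simp
  ultimately show ?thesis by linarith
qed

text \<open>A discrete quotient rule: the reciprocals inherit the relative size of the differences,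
  at the expense of the ratio bound L between the outer terms.\<close>

lemma inverse_difference_bounds:
  fixes a b c :: real
  assumes ord: "0 < c" "c \<le> b" "b \<le> a" "a \<le> L * c" and n: "0 < n" and D: "0 \<le> D"
    and p: "a - b \<le> D * a / n" and q: "b - c \<le> D * a / n" and d: "\<bar>a - 2 * b + c\<bar> \<le> D * a / n\<^sup>2"
  shows "\<bar>1 / b - 1 / a\<bar> \<le> D * L * (1 / a) / n"
    and "\<bar>1 / c - 2 * (1 / b) + 1 / a\<bar> \<le> (L * D + 2 * L\<^sup>2 * D\<^sup>2) * (1 / a) / n\<^sup>2"
proof -
  have pos: "0 < a" "0 < b" using ord by auto
  have Lb: "1 / b \<le> L / a" "1 / c \<le> L / a"
  proof -
    have L: "0 \<le> L" using ord pos by (smt (verit) mult_nonneg_nonneg mult_less_0_iff)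
    have "a \<le> L * b" using ord mult_left_mono[of c b L] L by linarith
    then show "1 / b \<le> L / a" using pos by (simp add: field_simps)
    show "1 / c \<le> L / a" using ord pos by (simp add: field_simps)
  qed
  have "\<bar>1 / b - 1 / a\<bar> = (a - b) / a * (1 / b)"
    using pos ord by (simp add: field_simps abs_of_nonneg)
  also have "\<dots> \<le> D / n * (L / a)"
    using p pos ord n D by (intro mult_mono Lb) (auto simp: field_simps)
  finally show "\<bar>1 / b - 1 / a\<bar> \<le> D * L * (1 / a) / n" by (simp add: mult.commute)
  \<comment> \<open>The discrete form of (1/f)'' = - f'' / f^2 + 2 f'^2 / f^3. The first summand is
    controlled by the second difference and the second by the product of the two first
    differences.\<close>
  have "1 / c - 2 * (1 / b) + 1 / a = (a - 2 * b + c) * (- 1 / (a * c)) + 2 * ((a - b) * (b - c)) / (a * b * c)"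
    using pos ord by (simp add: field_simps power2_eq_square)
  have "\<bar>1 / c - 2 * (1 / b) + 1 / a\<bar> \<le> \<bar>a - 2 * b + c\<bar> / a * (1 / c) + 2 * (((a - b) / a) * ((b - c) / a)) * (a * (1 / b) * (1 / c))"
  proof -
    have "\<bar>(a - 2 * b + c) * (- 1 / (a * c))\<bar> = \<bar>a - 2 * b + c\<bar> / a * (1 / c)"
      using pos ord by (simp add: abs_mult)
    moreover have "2 * ((a - b) * (b - c)) / (a * b * c) = 2 * (((a - b) / a) * ((b - c) / a)) * (a * (1 / b) * (1 / c))"
      using pos ord by (simp add: field_simps)
    moreover have "0 \<le> 2 * ((a - b) * (b - c)) / (a * b * c)" using pos ord by simp
    ultimately show ?thesis
      using abs_triangle_ineq[of "(a - 2 * b + c) * (- 1 / (a * c))" "2 * ((a - b) * (b - c)) / (a * b * c)"]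
        \<open>1 / c - 2 * (1 / b) + 1 / a = _\<close> by linarith
  qed
  also have "\<dots> \<le> D / n\<^sup>2 * (L / a) + 2 * ((D / n) * (D / n)) * (a * (L / a) * (L / a))"
  proof -
    have pq: "0 \<le> (a - b) / a" "(a - b) / a \<le> D / n" "0 \<le> (b - c) / a" "(b - c) / a \<le> D / n"
        "\<bar>a - 2 * b + c\<bar> / a \<le> D / n\<^sup>2"
      using p q d pos ord n by (simp_all add: field_simps)
    have L0: "0 \<le> L / a" "0 \<le> L" using Lb(1) pos by (smt (verit) zero_le_divide_1_iff zero_le_divide_iff)+
    have "\<bar>a - 2 * b + c\<bar> / a * (1 / c) \<le> D / n\<^sup>2 * (L / a)"
      using pq ord D by (intro mult_mono Lb) auto
    moreover have "(a - b) / a * ((b - c) / a) \<le> D / n * (D / n)"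
      using pq D n by (intro mult_mono) auto
    moreover have "a * (1 / b) * (1 / c) \<le> a * (L / a) * (L / a)"
      using pos ord L0 by (intro mult_mono Lb mult_left_mono) auto
    moreover have "0 \<le> a * (1 / b) * (1 / c)" "0 \<le> D / n * (D / n)" using pos ord by auto
    ultimately show ?thesis
      by (intro add_mono mult_mono[of "2 * _"] mult_left_mono) auto
  qed
  also have "\<dots> = (L * D + 2 * L\<^sup>2 * D\<^sup>2) * (1 / a) / n\<^sup>2"
    using pos n by (simp add: field_simps power2_eq_square)
  finally show "\<bar>1 / c - 2 * (1 / b) + 1 / a\<bar> \<le> (L * D + 2 * L\<^sup>2 * D\<^sup>2) * (1 / a) / n\<^sup>2" .
qed

text \<open>A moment is at least t^(2n+1) times the tail at t, for every t < 1, so the reciprocals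
  grow more slowly than any fixed geometric sequence of ratio above 1.\<close>

lemma summable_inverse_mom:
  assumes w: "radial_weight w" and \<rho>: "0 \<le> \<rho>" "\<rho> < 1"
  shows "summable (\<lambda>n. 1 / mom w (real (2 * n + 1)) * \<rho> ^ n)"
proof -
  \<comment> \<open>The arithmetic mean of 1 and \<rho> has a square larger than \<rho>, so \<rho> /
    t^2 is an admissible geometric ratio.\<close>
  define t where "t = (1 + \<rho>) / 2"
  have t: "0 < t" "t < 1" using \<rho> by (auto simp: t_def)
  have "\<rho> < t\<^sup>2"
  proof -
    have "0 < (1 - \<rho>)\<^sup>2" using \<rho> by simp
    then show ?thesis by (simp add: t_def power2_eq_square field_simps)
  qed
  show ?thesis
  proof (rule summable_comparison_test')
    show "summable (\<lambda>n. 1 / (t * tail w t) * (\<rho> / t\<^sup>2) ^ n)"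
      using \<open>\<rho> < t\<^sup>2\<close> \<rho> t by (intro summable_mult summable_geometric) auto
    fix n :: nat
    have "t powr real (2 * n + 1) * tail w t \<le> mom w (real (2 * n + 1))"
      using t by (intro mom_ge[OF w]) auto
    also have "t powr real (2 * n + 1) = t * (t\<^sup>2) ^ n"
      using t powr_realpow[of t "2 * n + 1"] by (simp add: power_mult)
    finally have "1 / mom w (real (2 * n + 1)) * \<rho> ^ n \<le> 1 / (t * (t\<^sup>2) ^ n * tail w t) * \<rho> ^ n"
      using t \<rho> tail_pos[OF w, of t] mom_pos[OF w, of "real (2 * n + 1)"]
      by (intro mult_right_mono divide_left_mono) auto
    also have "\<dots> = 1 / (t * tail w t) * (\<rho> / t\<^sup>2) ^ n" by (simp add: power_divide)
    finally show "norm (1 / mom w (real (2 * n + 1)) * \<rho> ^ n) \<le> 1 / (t * tail w t) * (\<rho> / t\<^sup>2) ^ n"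
      using mom_pos[OF w, of "real (2 * n + 1)"] \<rho> by simp
  qed
qed

lemma D_hat_kernel_bound:
  assumes "w \<in> D_hat"
  obtains C where "C > 0" "\<And>z. cmod z < 1 \<Longrightarrow> cmod (\<Sum>n. of_real (1 / mom w (real (2 * n + 1))) * z ^ n)
    \<le> C * (\<Sum>n. 1 / mom w (real (2 * n + 1)) * cmod z ^ n * kernel_cutoff n (cmod (1 - z)))"
proof -
  note w = D_hat_radial_weight[OF assms]
  obtain M where M: "M \<ge> 1" "\<And>x. 0 \<le> x \<Longrightarrow> mom w x \<le> M * mom w (2 * x)"
    using D_hat_mom_doubling[OF assms] by blast
  define m where "m n = mom w (real (2 * n + 1))" for n
  \<comment> \<open>Three doublings reach the order 16n + 8, beyond the order 4n + 3 of
    \<open>m (2 * n + 1)\<close> and the order 2n + 5 of \<open>m (n + 2)\<close>. At n = 0 two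
    doublings would stop at 4, short of 5.\<close>
  define L where "L = M ^ 3"
  have pos: "0 < m n" for n unfolding m_def by (rule mom_pos[OF w]) simp
  have anti: "m k \<le> m n" if "n \<le> k" for n k
    unfolding m_def using that by (intro mom_antimono[OF w]) auto
  have M2: "mom w x \<le> M ^ k * mom w (2 ^ k * x)" if "0 \<le> x" for x and k :: nat
  proof (induction k)
    case (Suc k)
    note Suc
    also have "mom w (2 ^ k * x) \<le> M * mom w (2 * (2 ^ k * x))" using that by (intro M) auto
    finally show ?case using M(1) by (simp add: mult_ac)
  qed simp
  have L1: "1 \<le> L" using M(1) by (simp add: L_def one_le_power)
  have Lk: "m n \<le> L * mom w y" if "0 \<le> y" "y \<le> 16 * real n + 8" for n y
  proof -
    have "m n \<le> L * mom w (2 ^ 3 * real (2 * n + 1))" unfolding m_def L_def by (rule M2) simp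
    also have "\<dots> \<le> L * mom w y" using that L1 by (intro mult_left_mono mom_antimono[OF w]) auto
    finally show ?thesis .
  qed
  \<comment> \<open>The 16 comes from the second difference and M from raising the order n + 1 back
    to 2n + 1; the first differences fit under the same constant.\<close>
  define D where "D = 16 * M"
  have half: "mom w (real (n + 1)) \<le> M * m n" for n
  proof -
    have "mom w (real (n + 1)) \<le> M * mom w (2 * real (n + 1))" by (rule M) simp
    also have "\<dots> \<le> M * m n" unfolding m_def using M(1) by (intro mult_left_mono mom_antimono[OF w]) auto
    finally show ?thesis .
  qed
  have p: "m n - m (Suc n) \<le> D * m n / real (Suc n)" for n
  proof -
    have "m n - m (Suc n) \<le> 2 * mom w (real (n + 1)) / real (Suc n)"
      using mom_first_difference[OF w, of n] by (simp add: m_def algebra_simps)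
    also have "\<dots> \<le> 2 * (M * m n) / real (Suc n)"
      by (intro divide_right_mono mult_left_mono half) auto
    also have "\<dots> \<le> D * m n / real (Suc n)"
      using pos[of n] M(1) by (intro divide_right_mono) (auto simp: D_def)
    finally show ?thesis .
  qed
  have q: "m (Suc n) - m (Suc (Suc n)) \<le> D * m n / real (Suc n)" for n
  proof -
    have "D * m (Suc n) / real (Suc (Suc n)) \<le> D * m n / real (Suc n)"
      using anti[of n "Suc n"] pos[of n] pos[of "Suc n"] M(1) by (intro frac_le mult_left_mono) (auto simp: D_def)
    then show ?thesis using p[of "Suc n"] by linarith
  qed
  have d: "\<bar>m n - 2 * m (Suc n) + m (Suc (Suc n))\<bar> \<le> D * m n / (real (Suc n))\<^sup>2" for n
  proof -
    have "\<bar>m n - 2 * m (Suc n) + m (Suc (Suc n))\<bar> \<le> 16 * mom w (real (n + 1)) / (real (Suc n))\<^sup>2"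
      using mom_second_difference[OF w, of n] by (simp add: m_def algebra_simps)
    also have "\<dots> \<le> 16 * (M * m n) / (real (Suc n))\<^sup>2"
      by (intro divide_right_mono mult_left_mono half) auto
    finally show ?thesis by (simp add: D_def)
  qed
  define A where "A = L + D * L + (L * D + 2 * L\<^sup>2 * D\<^sup>2)"
  have D0: "0 \<le> D" using M(1) by (simp add: D_def)
  have A: "L \<le> A" "D * L \<le> A" "L * D + 2 * L\<^sup>2 * D\<^sup>2 \<le> A" "0 \<le> A"
    using L1 D0 by (auto simp: A_def)
  have L2: "m n \<le> L * m (Suc (Suc n))" "m n \<le> L * m (2 * n + 1)" for n
    unfolding m_def[of "Suc (Suc n)"] m_def[of "2 * n + 1"] by (rule Lk; simp)+
  note inv = inverse_difference_bounds[OF pos anti anti L2(1) _ D0 p q d]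
  show thesis
  proof (rule that[of "9 + 19 * A + 18 * A\<^sup>2"])
    show "9 + 19 * A + 18 * A\<^sup>2 > 0" using A(4) by (simp add: add_pos_nonneg)
    fix z :: complex assume z: "cmod z < 1"
    have "cmod (\<Sum>n. of_real (1 / m n) * z ^ n)
      \<le> (9 + 19 * A + 18 * A\<^sup>2) * (\<Sum>n. 1 / m n * cmod z ^ n * kernel_cutoff n (cmod (1 - z)))"
    proof (rule norm_power_series_le_cutoff[OF _ _ A(4) _ _ _ _ z])
      show "0 < 1 / m n" for n using pos[of n] by simp
      show "1 / m k \<le> 1 / m n" if "k \<le> n" for k n
        using anti[OF that] pos[of n] pos[of k] by (simp add: frac_le)
      show "1 / m (2 * n + 1) \<le> A * (1 / m n)" for n
      proof -
        have "1 / m (2 * n + 1) \<le> L * (1 / m n)" using L2(2)[of n] pos[of n] pos[of "2 * n + 1"] by (simp add: field_simps)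
        also have "\<dots> \<le> A * (1 / m n)" using A pos[of n] by (intro mult_right_mono) auto
        finally show ?thesis .
      qed
      show "\<bar>1 / m (Suc n) - 1 / m n\<bar> \<le> A * (1 / m n) / real (Suc n)" for n
      proof -
        have "\<bar>1 / m (Suc n) - 1 / m n\<bar> \<le> D * L * (1 / m n) / real (Suc n)" by (rule inv) auto
        also have "\<dots> \<le> A * (1 / m n) / real (Suc n)"
          using A pos[of n] by (intro divide_right_mono mult_right_mono) auto
        finally show ?thesis .
      qed
      show "\<bar>1 / m (n + 2) - 2 * (1 / m (n + 1)) + 1 / m n\<bar> \<le> A * (1 / m n) / (real (Suc n))\<^sup>2" for n
      proof -
        have "\<bar>1 / m (n + 2) - 2 * (1 / m (n + 1)) + 1 / m n\<bar> \<le> (L * D + 2 * L\<^sup>2 * D\<^sup>2) * (1 / m n) / (real (Suc n))\<^sup>2"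
        proof -
          have "\<bar>1 / m (Suc (Suc n)) - 2 * (1 / m (Suc n)) + 1 / m n\<bar> \<le> (L * D + 2 * L\<^sup>2 * D\<^sup>2) * (1 / m n) / (real (Suc n))\<^sup>2"
            by (rule inv(2)) auto
          then show ?thesis by simp
        qed
        also have "\<dots> \<le> A * (1 / m n) / (real (Suc n))\<^sup>2"
          using A pos[of n] by (intro divide_right_mono mult_right_mono) auto
        finally show ?thesis .
      qed
      show "summable (\<lambda>n. 1 / m n * cmod z ^ n)"
        unfolding m_def using z by (intro summable_inverse_mom[OF w]) auto
    qed
    then show "cmod (\<Sum>n. of_real (1 / mom w (real (2 * n + 1))) * z ^ n)
      \<le> (9 + 19 * A + 18 * A\<^sup>2) * (\<Sum>n. 1 / mom w (real (2 * n + 1)) * cmod z ^ n * kernel_cutoff n (cmod (1 - z)))"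
      by (simp add: m_def)
  qed
qed

section \<open>Integral means of the kernel\<close>

lemma power_weight_measurable:
  "radial_weight s \<Longrightarrow> set_borel_measurable lebesgue {0..<1} (\<lambda>r. r ^ k * s r)"
  using power_weight_integrable[of s k] by (auto simp: set_integrable_def set_borel_measurable_def)

lemma has_integral_radial_weight:
  assumes s: "radial_weight s"
  shows "has_bochner_integral disc_area (\<lambda>z. cmod z ^ k * s (cmod z)) (2 * mom s (real (Suc k)))"
proof (rule has_bochner_integral_nn_integral)
  have meas: "set_borel_measurable lebesgue {0..<1} (\<lambda>r. r ^ k * s r)"
    by (rule power_weight_measurable[OF s])
  show "(\<lambda>z. cmod z ^ k * s (cmod z)) \<in> borel_measurable disc_area"
    using borel_measurable_radial[OF meas] .
  show "AE z in disc_area. 0 \<le> cmod z ^ k * s (cmod z)"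
    by (intro AE_I2 mult_nonneg_nonneg radial_weight_nonneg[OF s]) auto
  show "0 \<le> 2 * mom s (real (Suc k))" using mom_pos[OF s, of "real (Suc k)"] by simp
  have "(\<integral>\<^sup>+ z. ennreal (cmod z ^ k * s (cmod z)) \<partial>disc_area)
      = (\<integral>\<^sup>+ r. ennreal (indicator {0..<1} r *\<^sub>R (2 * (r ^ Suc k * s r))) \<partial>lebesgue)"
    unfolding nn_integral_radial[OF meas] by (intro nn_integral_cong) (auto simp: indicator_def mult_ac)
  also have "\<dots> = ennreal (LINT r:{0..<1}|lebesgue. 2 * (r ^ Suc k * s r))"
    unfolding set_lebesgue_integral_def
    using set_integrable_mult_right[OF power_weight_integrable[OF s, of "Suc k"], of 2] radial_weight_nonneg[OF s]
    by (intro nn_integral_eq_integral) (auto simp: set_integrable_def indicator_def)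
  also have "\<dots> = ennreal (2 * mom s (real (Suc k)))"
    unfolding mom_Suc by (simp del: power_Suc)
  finally show "(\<integral>\<^sup>+ z. ennreal (cmod z ^ k * s (cmod z)) \<partial>disc_area) = ennreal (2 * mom s (real (Suc k)))" .
qed

lemma continuous_borel_measurable_disc_area:
  "continuous_on UNIV f \<Longrightarrow> f \<in> borel_measurable disc_area"
  for f :: "complex \<Rightarrow> 'a::topological_space"
  by (intro borel_measurable_disc_area borel_measurable_continuous_onI)

text \<open>Orthogonality of monomials. The common power of z and its conjugate is radial and joins
  the weight; what remains is a pure power, or by conjugation its conjugate.\<close>

lemma integral_radial_monomials:
  assumes s: "radial_weight s"
  shows "(LINT z|disc_area. of_real (s (cmod z)) * (cnj z ^ n * z ^ k))
    = (if n = k then of_real (2 * mom s (real (2 * n + 1))) else 0)"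
proof -
  have meas: "set_borel_measurable lebesgue {0..<1} (\<lambda>r. r ^ k * s r)" for k
    by (rule power_weight_measurable[OF s])
  have red: "cnj z ^ i * z ^ (i + j) = of_real (cmod z ^ (2 * i)) * z ^ j" for z :: complex and i j
  proof -
    have "cnj z ^ i * z ^ (i + j) = (z * cnj z) ^ i * z ^ j" by (simp add: power_add power_mult_distrib)
    also have "z * cnj z = of_real (cmod z ^ 2)" by (simp only: complex_norm_square)
    finally show ?thesis by (simp add: power_mult)
  qed
  have *: "(LINT z|disc_area. of_real (s (cmod z)) * (cnj z ^ i * z ^ (i + j))) = 0" if "0 < j" for i j
  proof -
    have "(LINT z|disc_area. of_real (s (cmod z)) * (cnj z ^ i * z ^ (i + j)))
        = (LINT z|disc_area. of_real (cmod z ^ (2 * i) * s (cmod z)) * z ^ j)"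
      unfolding red by (intro Bochner_Integration.integral_cong) auto
    then show ?thesis using integral_radial_power[OF meas that] by simp
  qed
  consider "n = k" | j where "0 < j" "k = n + j" | j where "0 < j" "n = k + j"
    by (metis less_imp_add_positive linorder_less_linear)
  then show ?thesis
  proof cases
    case 1
    have "(LINT z|disc_area. of_real (s (cmod z)) * (cnj z ^ n * z ^ k))
        = (LINT z|disc_area. complex_of_real (cmod z ^ (2 * n) * s (cmod z)))"
      using red[of _ n 0] 1 by (intro Bochner_Integration.integral_cong) auto
    also have "\<dots> = of_real (2 * mom s (real (Suc (2 * n))))"
      using has_bochner_integral_integral_eq[OF has_integral_radial_weight[OF s, of "2 * n"]]
      by (simp only: integral_complex_of_real)
    finally show ?thesis using 1 by (simp add: add.commute)
  next
    case 2
    then show ?thesis using *[of j n] by simp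
  next
    case 3
    have "(LINT z|disc_area. of_real (s (cmod z)) * (cnj z ^ n * z ^ k))
        = (LINT z|disc_area. cnj (of_real (s (cmod z)) * (cnj z ^ k * z ^ (k + j))))"
      using 3 by (intro Bochner_Integration.integral_cong) (auto simp: mult_ac)
    also have "\<dots> = cnj 0" unfolding Bochner_Integration.integral_cnj *[OF 3(1), of k] ..
    finally show ?thesis using 3 by simp
  qed
qed

text \<open>Absolutely summable coefficients, uniformly bounded functions and one integrable factor
  justify exchanging sum and integral. It serves the Poisson kernel, the Bergman kernel and the
  logarithmic test function alike.\<close>

lemma integral_mult_suminf:
  fixes G :: "'a \<Rightarrow> complex" and a :: "nat \<Rightarrow> complex"
  assumes G: "integrable M G" and h: "\<And>n. h n \<in> borel_measurable M"
    and h1: "\<And>n x. x \<in> space M \<Longrightarrow> cmod (h n x) \<le> 1" and a: "summable (\<lambda>n. cmod (a n))"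
  shows "integrable M (\<lambda>x. G x * (\<Sum>n. a n * h n x))"
    and "(LINT x|M. G x * (\<Sum>n. a n * h n x)) = (\<Sum>n. a n * (LINT x|M. G x * h n x))"
proof -
  define f where "f n x = a n * (G x * h n x)" for n x
  have Gh: "integrable M (\<lambda>x. G x * h n x)" for n
  proof (rule Bochner_Integration.integrable_bound[OF G])
    show "(\<lambda>x. G x * h n x) \<in> borel_measurable M" using h G by measurable
    show "AE x in M. cmod (G x * h n x) \<le> cmod (G x)"
      using h1 by (intro AE_I2) (simp add: norm_mult mult_left_le)
  qed
  have fi: "integrable M (f n)" for n
    unfolding f_def using Gh by (intro integrable_mult_right)
  have fn: "cmod (f n x) \<le> cmod (a n) * cmod (G x)" if "x \<in> space M" for n x
    unfolding f_def norm_mult using h1[OF that, of n]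
    by (intro mult_left_mono) (auto intro: mult_left_le)
  have 1: "AE x in M. summable (\<lambda>n. norm (f n x))"
    using fn by (intro AE_I2 summable_comparison_test'[OF summable_mult2[OF a]]) auto
  have 2: "summable (\<lambda>n. LINT x|M. norm (f n x))"
  proof (rule summable_comparison_test'[OF summable_mult2[OF a, of "LINT x|M. cmod (G x)"]])
    fix n
    have "(LINT x|M. norm (f n x)) \<le> (LINT x|M. cmod (a n) * cmod (G x))"
      using fi G fn by (intro integral_mono integrable_norm integrable_mult_right) auto
    then show "norm (LINT x|M. norm (f n x)) \<le> cmod (a n) * (LINT x|M. cmod (G x))" by simp
  qed
  have eq: "(\<Sum>n. f n x) = G x * (\<Sum>n. a n * h n x)" if "x \<in> space M" for x
  proof -
    have "summable (\<lambda>n. a n * h n x)"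
      using h1[OF that] by (intro summable_norm_cancel[OF summable_comparison_test'[OF a]])
        (auto simp: norm_mult intro: mult_left_le)
    then show ?thesis unfolding f_def by (subst suminf_mult[symmetric]) (simp_all add: mult_ac)
  qed
  have "integrable M (\<lambda>x. \<Sum>n. f n x)" by (rule integrable_suminf[OF fi 1 2])
  then show "integrable M (\<lambda>x. G x * (\<Sum>n. a n * h n x))"
    using eq by (subst Bochner_Integration.integrable_cong[OF refl, of _ _ "\<lambda>x. \<Sum>n. f n x"]) auto
  have "(LINT x|M. G x * (\<Sum>n. a n * h n x)) = (LINT x|M. (\<Sum>n. f n x))"
    using eq by (intro Bochner_Integration.integral_cong) auto
  also have "\<dots> = (\<Sum>n. LINT x|M. f n x)" by (rule integral_suminf[OF fi 1 2])
  also have "\<dots> = (\<Sum>n. a n * (LINT x|M. G x * h n x))" by (simp add: f_def)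
  finally show "(LINT x|M. G x * (\<Sum>n. a n * h n x)) = (\<Sum>n. a n * (LINT x|M. G x * h n x))" .
qed

text \<open>The circular means of \<open>1 / \<bar>1 - c\<zeta>\<bar>\<^sup>2\<close> are controlled by the mean value property of the Poisson kernel
  \<open>Re ((1 + c\<zeta>) / (1 - c\<zeta>))\<close>, so that no integration in polar coordinates is needed.\<close>

lemma poisson_integral_bound:
  assumes s: "radial_weight s" and c: "cmod c < 1"
  shows "(\<integral>\<^sup>+ \<zeta>. ennreal (cmod \<zeta> ^ k * s (cmod \<zeta>) / (cmod (1 - c * \<zeta>))\<^sup>2) \<partial>disc_area)
    \<le> ennreal (2 * mom s (real (Suc k)) / (1 - (cmod c)\<^sup>2))"
proof -
  \<comment> \<open>The coefficients of (1 + c\<zeta>) / (1 - c\<zeta>) = 1 + 2 c\<zeta> + 2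
    (c\<zeta>)^2 + ...; against a radial weight only the constant term survives.\<close>
  define a where "a n = (if n = 0 then 1 else 2) * c ^ n" for n :: nat
  define G where "G \<zeta> = complex_of_real (cmod \<zeta> ^ k * s (cmod \<zeta>))" for \<zeta>
  have c2: "0 < 1 - (cmod c)\<^sup>2" using c by (simp add: power_less_one_iff)
  have a: "summable (\<lambda>n. cmod (a n))"
    by (rule summable_comparison_test'[OF summable_mult[OF summable_geometric[of "cmod c"], of 2]])
       (use c in \<open>auto simp: a_def norm_mult norm_power\<close>)
  have G: "integrable disc_area G" "(LINT \<zeta>|disc_area. G \<zeta>) = of_real (2 * mom s (real (Suc k)))"
    using has_integral_radial_weight[OF s, of k]
    unfolding G_def by (auto simp: has_bochner_integral_iff integral_complex_of_real simp del: of_real_mult of_nat_Suc)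
  have meas: "set_borel_measurable lebesgue {0..<1} (\<lambda>r. r ^ k * s r)"
    by (rule power_weight_measurable[OF s])
  have h: "(\<lambda>\<zeta>::complex. \<zeta> ^ n) \<in> borel_measurable disc_area" for n
    by (intro continuous_borel_measurable_disc_area continuous_intros)
  have h1: "cmod (\<zeta> ^ n) \<le> 1" if "\<zeta> \<in> space disc_area" for n \<zeta>
    using that by (simp add: norm_power power_le_one)
  have "(LINT \<zeta>|disc_area. G \<zeta> * (\<Sum>n. a n * \<zeta> ^ n)) = (\<Sum>n. a n * (LINT \<zeta>|disc_area. G \<zeta> * \<zeta> ^ n))"
    by (rule integral_mult_suminf(2)[OF G(1) h h1 a])
  also have "\<dots> = (\<Sum>n\<in>{0}. a n * (LINT \<zeta>|disc_area. G \<zeta> * \<zeta> ^ n))"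
    using integral_radial_power[OF meas] by (intro suminf_finite) (auto simp: G_def)
  also have "\<dots> = of_real (2 * mom s (real (Suc k)))" using G(2) by (simp add: a_def)
  finally have val: "(LINT \<zeta>|disc_area. G \<zeta> * (\<Sum>n. a n * \<zeta> ^ n)) = of_real (2 * mom s (real (Suc k)))" .
  have int: "integrable disc_area (\<lambda>\<zeta>. G \<zeta> * (\<Sum>n. a n * \<zeta> ^ n))"
    by (rule integral_mult_suminf(1)[OF G(1) h h1 a])
  have bound: "0 \<le> cmod \<zeta> ^ k * s (cmod \<zeta>) / (cmod (1 - c * \<zeta>))\<^sup>2 \<and>
      cmod \<zeta> ^ k * s (cmod \<zeta>) / (cmod (1 - c * \<zeta>))\<^sup>2 \<le> Re (G \<zeta> * (\<Sum>n. a n * \<zeta> ^ n)) / (1 - (cmod c)\<^sup>2)"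
    if z: "\<zeta> \<in> unit_disc" for \<zeta>
  proof -
    define U where "U = c * \<zeta>"
    have U: "cmod U \<le> cmod c" using z by (simp add: U_def norm_mult mult_left_le)
    then have U1: "cmod U < 1" using c by simp
    have "(\<lambda>n. 2 * U ^ n - (if n = 0 then 1 else 0)) sums (2 * (1 / (1 - U)) - 1)"
      using U1 by (intro sums_diff sums_mult geometric_sums sums_If_finite[of "\<lambda>n. n = 0" "\<lambda>_. 1::complex", simplified]) auto
    moreover have "(\<lambda>n. 2 * U ^ n - (if n = 0 then 1 else 0)) = (\<lambda>n. a n * \<zeta> ^ n)"
      by (auto simp: a_def U_def power_mult_distrib fun_eq_iff)
    ultimately have sum: "(\<Sum>n. a n * \<zeta> ^ n) = 2 * (1 / (1 - U)) - 1" by (simp add: sums_iff)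
    have U0: "1 - U \<noteq> 0" using U1 by auto
    have "2 * (1 / (1 - U)) - 1 = (1 + U) * cnj (1 - U) / of_real ((cmod (1 - U))\<^sup>2)"
    proof -
      have "2 * (1 / (1 - U)) - 1 = (1 + U) / (1 - U)" using U0 by (simp add: field_simps)
      also have "\<dots> = (1 + U) * cnj (1 - U) / ((1 - U) * cnj (1 - U))"
        using U0 complex_cnj_zero_iff[of "1 - U"] by (simp del: complex_cnj_diff complex_cnj_zero_iff)
      finally show ?thesis unfolding complex_norm_square .
    qed
    then have "Re (2 * (1 / (1 - U)) - 1) = Re ((1 + U) * cnj (1 - U)) / (cmod (1 - U))\<^sup>2"
      by (simp only: Re_divide_of_real)
    also have "Re ((1 + U) * cnj (1 - U)) = 1 - (cmod U)\<^sup>2"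
      unfolding cmod_power2 by (simp add: algebra_simps power2_eq_square)
    finally have re: "Re (2 * (1 / (1 - U)) - 1) = (1 - (cmod U)\<^sup>2) / (cmod (1 - U))\<^sup>2" .
    have w0: "0 \<le> cmod \<zeta> ^ k * s (cmod \<zeta>)" using z by (intro mult_nonneg_nonneg radial_weight_nonneg[OF s]) auto
    \<comment> \<open>With U = c\<zeta> the Poisson kernel is (1 - |U|^2) / |1 - U|^2, and |U| <=
      |c|.\<close>
    have "1 - (cmod c)\<^sup>2 \<le> 1 - (cmod U)\<^sup>2" using U by (simp add: power_mono)
    then have "(1 - (cmod c)\<^sup>2) / (cmod (1 - U))\<^sup>2 \<le> Re (2 * (1 / (1 - U)) - 1)"
      unfolding re by (intro divide_right_mono) auto
    then have "cmod \<zeta> ^ k * s (cmod \<zeta>) * ((1 - (cmod c)\<^sup>2) / (cmod (1 - U))\<^sup>2)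
        \<le> cmod \<zeta> ^ k * s (cmod \<zeta>) * Re (2 * (1 / (1 - U)) - 1)"
      using w0 by (rule mult_left_mono)
    also have "\<dots> = Re (G \<zeta> * (\<Sum>n. a n * \<zeta> ^ n))"
      unfolding sum G_def by simp
    finally show ?thesis using w0 c2 by (simp add: U_def field_simps)
  qed
  have "(\<integral>\<^sup>+ \<zeta>. ennreal (cmod \<zeta> ^ k * s (cmod \<zeta>) / (cmod (1 - c * \<zeta>))\<^sup>2) \<partial>disc_area)
      \<le> (\<integral>\<^sup>+ \<zeta>. ennreal (Re (G \<zeta> * (\<Sum>n. a n * \<zeta> ^ n)) / (1 - (cmod c)\<^sup>2)) \<partial>disc_area)"
    using bound by (intro nn_integral_mono ennreal_leI) auto
  also have "\<dots> = ennreal (LINT \<zeta>|disc_area. Re (G \<zeta> * (\<Sum>n. a n * \<zeta> ^ n)) / (1 - (cmod c)\<^sup>2))"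
    using int bound by (intro nn_integral_eq_integral integrable_divide integrable_Re AE_I2) (auto intro: order.trans)
  also have "(LINT \<zeta>|disc_area. Re (G \<zeta> * (\<Sum>n. a n * \<zeta> ^ n)) / (1 - (cmod c)\<^sup>2))
      = Re (LINT \<zeta>|disc_area. G \<zeta> * (\<Sum>n. a n * \<zeta> ^ n)) / (1 - (cmod c)\<^sup>2)"
    using int by (simp del: times_complex.sel)
  finally show ?thesis by (simp add: val)
qed

text \<open>The Poisson bound degenerates as |z| tends to 1, but the cutoff is flat at scale 1 / (n
  + 1). Hence z may be moved inwards to c with 1 - |c|^2 >= 1 / (n + 1), which changes |1 -
  z\<zeta>| by at most 1 / (n + 1); the bound then costs a factor n + 1 against the prefactor 4 / (n
  + 1)^2.\<close>

lemma kernel_cutoff_integral_bound: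
  assumes s: "radial_weight s" and z: "cmod z < 1"
  shows "(\<integral>\<^sup>+ \<zeta>. ennreal (cmod \<zeta> ^ n * s (cmod \<zeta>) * kernel_cutoff n (cmod (1 - z * \<zeta>))) \<partial>disc_area)
    \<le> ennreal (8 * mom s (real (Suc n)) / real (Suc n))"
proof -
  define l where "l = real n / real (Suc n)"
  have l: "0 \<le> l" "l < 1" "1 - l = 1 / real (Suc n)" by (auto simp: l_def field_simps)
  define c where "c = of_real l * z"
  have "cmod c = l * cmod z" using l by (simp add: c_def norm_mult)
  also have "\<dots> \<le> l" using l z by (intro mult_left_le) auto
  finally have c: "cmod c \<le> l" .
  have "(cmod c)\<^sup>2 \<le> l * 1" unfolding power2_eq_square using c l by (intro mult_mono) auto
  then have c2: "1 / real (Suc n) \<le> 1 - (cmod c)\<^sup>2" using l by simp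
  have cut: "kernel_cutoff n (cmod (1 - z * \<zeta>)) \<le> 4 / (real (Suc n))\<^sup>2 * (1 / (cmod (1 - c * \<zeta>))\<^sup>2)"
    if "\<zeta> \<in> unit_disc" for \<zeta>
  proof -
    define \<delta> \<epsilon> where "\<delta> = cmod (1 - z * \<zeta>)" and "\<epsilon> = cmod (1 - c * \<zeta>)"
    have z1: "cmod (z * \<zeta>) < 1" using mult_strict_mono'[of "cmod z" 1 "cmod \<zeta>" 1] z that by (simp add: norm_mult)
    have "cmod (c * \<zeta>) < 1" using mult_strict_mono'[of "cmod c" 1 "cmod \<zeta>" 1] c l that by (simp add: norm_mult)
    then have pos: "0 < \<delta>" "0 < \<epsilon>" using z1 by (auto simp: \<delta>_def \<epsilon>_def)
    have "1 - c * \<zeta> = (1 - z * \<zeta>) + of_real (1 - l) * (z * \<zeta>)" by (simp add: c_def algebra_simps)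
    then have "\<epsilon> \<le> \<delta> + cmod (of_real (1 - l) * (z * \<zeta>))"
      unfolding \<delta>_def \<epsilon>_def by (simp only: norm_triangle_ineq)
    also have "cmod (of_real (1 - l) * (z * \<zeta>)) \<le> 1 / real (Suc n)"
      unfolding norm_mult[of "of_real _"] norm_of_real using l z1 by (simp add: divide_right_mono)
    finally have "real (Suc n) * \<epsilon> \<le> real (Suc n) * \<delta> + 1" by (simp add: field_simps)
    also have "\<dots> \<le> 2 * max 1 (real (Suc n) * \<delta>)" by simp
    finally have "(real (Suc n) * \<epsilon>)\<^sup>2 \<le> (2 * max 1 (real (Suc n) * \<delta>))\<^sup>2"
      using pos by (intro power_mono) auto
    also have "\<dots> = 4 * max 1 ((real (Suc n) * \<delta>)\<^sup>2)"
    proof -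
      have "(max 1 x)\<^sup>2 = max 1 (x\<^sup>2)" if "0 < x" for x :: real
        using that power_le_one[of x 2] one_le_power[of x 2] by (cases "x \<le> 1") (simp_all add: max_def)
      then show ?thesis using pos by (simp add: power_mult_distrib)
    qed
    finally have le: "(real (Suc n) * \<epsilon>)\<^sup>2 \<le> 4 * max 1 ((real (Suc n) * \<delta>)\<^sup>2)" .
    have "min 1 (1 / X) = 1 / max 1 X" if "0 < X" for X :: real
      using that by (auto simp: min_def max_def field_simps)
    then have "kernel_cutoff n \<delta> = 1 / max 1 ((real (Suc n) * \<delta>)\<^sup>2)"
      using pos by (simp add: kernel_cutoff_def)
    also have "\<dots> = 4 / (4 * max 1 ((real (Suc n) * \<delta>)\<^sup>2))" by simp
    also have "\<dots> \<le> 4 / (real (Suc n) * \<epsilon>)\<^sup>2"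
      using le pos by (intro divide_left_mono mult_pos_pos) auto
    also have "\<dots> = 4 / (real (Suc n))\<^sup>2 * (1 / \<epsilon>\<^sup>2)" by (simp add: power_mult_distrib del: of_nat_Suc)
    finally show ?thesis by (simp only: \<delta>_def \<epsilon>_def)
  qed
  have w0: "0 \<le> cmod \<zeta> ^ n * s (cmod \<zeta>)" if "\<zeta> \<in> unit_disc" for \<zeta>
    using that by (intro mult_nonneg_nonneg radial_weight_nonneg[OF s]) auto
  have meas: "(\<lambda>\<zeta>. cmod \<zeta> ^ n * s (cmod \<zeta>) / (cmod (1 - c * \<zeta>))\<^sup>2) \<in> borel_measurable disc_area"
  proof (intro borel_measurable_divide borel_measurable_power)
    show "(\<lambda>\<zeta>. cmod \<zeta> ^ n * s (cmod \<zeta>)) \<in> borel_measurable disc_area"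
      using has_integral_radial_weight[OF s, of n] by (auto simp: has_bochner_integral_iff)
    show "(\<lambda>\<zeta>. cmod (1 - c * \<zeta>)) \<in> borel_measurable disc_area"
      by (intro continuous_borel_measurable_disc_area continuous_intros)
  qed
  have "(\<integral>\<^sup>+ \<zeta>. ennreal (cmod \<zeta> ^ n * s (cmod \<zeta>) * kernel_cutoff n (cmod (1 - z * \<zeta>))) \<partial>disc_area)
      \<le> (\<integral>\<^sup>+ \<zeta>. ennreal (4 / (real (Suc n))\<^sup>2) * ennreal (cmod \<zeta> ^ n * s (cmod \<zeta>) / (cmod (1 - c * \<zeta>))\<^sup>2) \<partial>disc_area)"
  proof (rule nn_integral_mono)
    fix \<zeta> assume "\<zeta> \<in> space disc_area"
    then have \<zeta>: "\<zeta> \<in> unit_disc" by simp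
    have "cmod \<zeta> ^ n * s (cmod \<zeta>) * kernel_cutoff n (cmod (1 - z * \<zeta>))
        \<le> cmod \<zeta> ^ n * s (cmod \<zeta>) * (4 / (real (Suc n))\<^sup>2 * (1 / (cmod (1 - c * \<zeta>))\<^sup>2))"
      by (intro mult_left_mono cut w0 \<zeta>)
    also have "\<dots> = 4 / (real (Suc n))\<^sup>2 * (cmod \<zeta> ^ n * s (cmod \<zeta>) / (cmod (1 - c * \<zeta>))\<^sup>2)"
      by simp
    finally show "ennreal (cmod \<zeta> ^ n * s (cmod \<zeta>) * kernel_cutoff n (cmod (1 - z * \<zeta>)))
        \<le> ennreal (4 / (real (Suc n))\<^sup>2) * ennreal (cmod \<zeta> ^ n * s (cmod \<zeta>) / (cmod (1 - c * \<zeta>))\<^sup>2)"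
      by (subst ennreal_mult'[symmetric]) (auto intro: ennreal_leI)
  qed
  also have "\<dots> = ennreal (4 / (real (Suc n))\<^sup>2) * (\<integral>\<^sup>+ \<zeta>. ennreal (cmod \<zeta> ^ n * s (cmod \<zeta>) / (cmod (1 - c * \<zeta>))\<^sup>2) \<partial>disc_area)"
    using meas by (intro nn_integral_cmult) simp
  also have "\<dots> \<le> ennreal (4 / (real (Suc n))\<^sup>2) * ennreal (2 * mom s (real (Suc n)) / (1 - (cmod c)\<^sup>2))"
    using c l by (intro mult_left_mono poisson_integral_bound[OF s]) auto
  also have "\<dots> = ennreal (4 / (real (Suc n))\<^sup>2 * (2 * mom s (real (Suc n)) / (1 - (cmod c)\<^sup>2)))"
    by (rule ennreal_mult'[symmetric]) simp
  also have "\<dots> \<le> ennreal (4 / (real (Suc n))\<^sup>2 * (2 * mom s (real (Suc n)) / (1 / real (Suc n))))"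
    using c2 mom_pos[OF s, of "real (Suc n)"] less_le_trans[OF _ c2, of 0]
    by (intro ennreal_leI mult_left_mono divide_left_mono) (auto intro!: mult_pos_pos simp del: of_nat_Suc)
  also have "4 / (real (Suc n))\<^sup>2 * (2 * mom s (real (Suc n)) / (1 / real (Suc n))) = 8 * mom s (real (Suc n)) / real (Suc n)"
    by (simp add: power2_eq_square field_simps del: of_nat_Suc)
  finally show ?thesis .
qed

text \<open>Twice the Bergman kernel, as a function of the single variable u = conj z *
  \<zeta>.\<close>

definition kernel_series :: "(real \<Rightarrow> real) \<Rightarrow> complex \<Rightarrow> complex" where
  "kernel_series w u = (\<Sum>n. of_real (1 / mom w (real (2 * n + 1))) * u ^ n)"

text \<open>The pointwise bound is integrated term by term against s. The constant is chosen before
  s, so it depends on w alone.\<close>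

lemma kernel_series_integral_bound:
  assumes "w \<in> D_hat"
  obtains C where "C > 0" "\<And>s z. radial_weight s \<Longrightarrow> cmod z < 1 \<Longrightarrow>
      summable (\<lambda>n. mom s (real (Suc n)) / mom w (real (2 * n + 1)) * cmod z ^ n / real (Suc n)) \<and>
      (\<integral>\<^sup>+ \<zeta>. ennreal (cmod (kernel_series w (z * \<zeta>)) * s (cmod \<zeta>)) \<partial>disc_area)
      \<le> ennreal (C * (\<Sum>n. mom s (real (Suc n)) / mom w (real (2 * n + 1)) * cmod z ^ n / real (Suc n)))"
proof -
  note w = D_hat_radial_weight[OF assms]
  obtain C where C: "C > 0" "\<And>z. cmod z < 1 \<Longrightarrow> cmod (\<Sum>n. of_real (1 / mom w (real (2 * n + 1))) * z ^ n)
    \<le> C * (\<Sum>n. 1 / mom w (real (2 * n + 1)) * cmod z ^ n * kernel_cutoff n (cmod (1 - z)))"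
    using D_hat_kernel_bound[OF assms] by blast
  show thesis
  proof (rule that[of "C * 8"])
    fix s :: "real \<Rightarrow> real" and z :: complex
    assume s: "radial_weight s" and z: "cmod z < 1"
    define m where "m n = mom w (real (2 * n + 1))" for n
    have m: "0 < m n" for n unfolding m_def by (rule mom_pos[OF w]) simp
    have sum_m: "summable (\<lambda>n. 1 / m n * r ^ n)" if "0 \<le> r" "r < 1" for r
      unfolding m_def by (rule summable_inverse_mom[OF w that])
    have s0: "0 < mom s (real (Suc n))" for n by (rule mom_pos[OF s]) simp
    have summ: "summable (\<lambda>n. mom s (real (Suc n)) / m n * cmod z ^ n / real (Suc n))"
    proof (rule summable_comparison_test')
      show "summable (\<lambda>n. tail s 0 * (1 / m n * cmod z ^ n))"
        using z by (intro summable_mult sum_m) auto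
      fix n
      have "mom s (real (Suc n)) / m n * cmod z ^ n / real (Suc n) \<le> mom s (real (Suc n)) / m n * cmod z ^ n / 1"
        using s0[of n] m[of n] by (intro divide_left_mono) auto
      also have "\<dots> \<le> tail s 0 * (1 / m n * cmod z ^ n)"
        using mom_le_tail[OF s, of "real (Suc n)"] m[of n]
        by (simp add: divide_right_mono mult_right_mono del: of_nat_Suc)
      finally show "norm (mom s (real (Suc n)) / m n * cmod z ^ n / real (Suc n)) \<le> tail s 0 * (1 / m n * cmod z ^ n)"
        using s0[of n] m[of n] by simp
    qed
    define g where "g n \<zeta> = C / m n * cmod z ^ n * (cmod \<zeta> ^ n * s (cmod \<zeta>) * kernel_cutoff n (cmod (1 - z * \<zeta>)))"
      for n \<zeta>
    have g0: "0 \<le> g n \<zeta>" if "\<zeta> \<in> unit_disc" for n \<zeta>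
      unfolding g_def using that C(1) m[of n]
      by (intro mult_nonneg_nonneg radial_weight_nonneg[OF s]) (auto simp: kernel_cutoff_def less_imp_le)
    have pointwise: "ennreal (cmod (kernel_series w (z * \<zeta>)) * s (cmod \<zeta>)) \<le> (\<Sum>n. ennreal (g n \<zeta>))"
      if \<zeta>: "\<zeta> \<in> unit_disc" for \<zeta>
    proof -
      define q where "q n = kernel_cutoff n (cmod (1 - z * \<zeta>))" for n
      have u: "cmod (z * \<zeta>) < 1" using mult_strict_mono'[of "cmod z" 1 "cmod \<zeta>" 1] z \<zeta> by (simp add: norm_mult)
      have q: "0 \<le> q n" "q n \<le> 1" for n by (auto simp: q_def kernel_cutoff_def)
      have sq: "summable (\<lambda>n. 1 / m n * cmod (z * \<zeta>) ^ n * q n)"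
        using u q m by (intro summable_comparison_test'[OF sum_m[of "cmod (z * \<zeta>)"]])
          (auto simp: abs_mult less_imp_le intro!: divide_right_mono mult_left_le)
      \<comment> \<open>The power |z\<zeta>|^n splits: |z|^n stays in the series, while |\<zeta>|^n
        joins the weight and becomes the moment of s of order n + 1 after integration.\<close>
      have geq: "g n \<zeta> = C * s (cmod \<zeta>) * (1 / m n * cmod (z * \<zeta>) ^ n * q n)" for n
        by (simp add: g_def q_def norm_mult power_mult_distrib)
      have "cmod (kernel_series w (z * \<zeta>)) * s (cmod \<zeta>) \<le> C * (\<Sum>n. 1 / m n * cmod (z * \<zeta>) ^ n * q n) * s (cmod \<zeta>)"
        unfolding kernel_series_def m_def q_def using \<zeta>
        by (intro mult_right_mono C(2) u radial_weight_nonneg[OF s]) auto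
      also have "\<dots> = (\<Sum>n. g n \<zeta>)"
        unfolding geq by (subst suminf_mult[OF sq]) (simp add: mult_ac)
      finally have "ennreal (cmod (kernel_series w (z * \<zeta>)) * s (cmod \<zeta>)) \<le> ennreal (\<Sum>n. g n \<zeta>)"
        by (rule ennreal_leI)
      also have "\<dots> = (\<Sum>n. ennreal (g n \<zeta>))"
        using g0[OF \<zeta>] summable_mult[OF sq] by (intro suminf_ennreal2[symmetric]) (simp_all add: geq)
      finally show ?thesis .
    qed
    have gm: "(\<lambda>\<zeta>. cmod \<zeta> ^ n * s (cmod \<zeta>) * kernel_cutoff n (cmod (1 - z * \<zeta>))) \<in> borel_measurable disc_area" for n
    proof (rule borel_measurable_times)
      show "(\<lambda>\<zeta>. cmod \<zeta> ^ n * s (cmod \<zeta>)) \<in> borel_measurable disc_area"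
        using has_integral_radial_weight[OF s, of n] by (auto simp: has_bochner_integral_iff)
      have "(\<lambda>\<zeta>. cmod (1 - z * \<zeta>)) \<in> borel_measurable disc_area"
        by (intro continuous_borel_measurable_disc_area continuous_intros)
      then show "(\<lambda>\<zeta>. kernel_cutoff n (cmod (1 - z * \<zeta>))) \<in> borel_measurable disc_area"
        unfolding kernel_cutoff_def by measurable
    qed
    have "(\<integral>\<^sup>+ \<zeta>. ennreal (cmod (kernel_series w (z * \<zeta>)) * s (cmod \<zeta>)) \<partial>disc_area)
        \<le> (\<integral>\<^sup>+ \<zeta>. (\<Sum>n. ennreal (g n \<zeta>)) \<partial>disc_area)"
      using pointwise by (intro nn_integral_mono) auto
    also have "\<dots> = (\<Sum>n. \<integral>\<^sup>+ \<zeta>. ennreal (g n \<zeta>) \<partial>disc_area)"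
      using gm by (intro nn_integral_suminf) (simp add: g_def)
    also have "\<dots> \<le> (\<Sum>n. ennreal (C * 8 * (mom s (real (Suc n)) / m n * cmod z ^ n / real (Suc n))))"
    proof (rule suminf_le)
      fix n
      have c0: "0 \<le> C / m n * cmod z ^ n" using C(1) m[of n] by simp
      have "(\<integral>\<^sup>+ \<zeta>. ennreal (g n \<zeta>) \<partial>disc_area) = ennreal (C / m n * cmod z ^ n) *
          (\<integral>\<^sup>+ \<zeta>. ennreal (cmod \<zeta> ^ n * s (cmod \<zeta>) * kernel_cutoff n (cmod (1 - z * \<zeta>))) \<partial>disc_area)"
        unfolding g_def ennreal_mult'[OF c0] using gm by (intro nn_integral_cmult) simp
      also have "\<dots> \<le> ennreal (C / m n * cmod z ^ n) * ennreal (8 * mom s (real (Suc n)) / real (Suc n))"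
        by (intro mult_left_mono kernel_cutoff_integral_bound[OF s z]) auto
      also have "\<dots> = ennreal (C / m n * cmod z ^ n * (8 * mom s (real (Suc n)) / real (Suc n)))"
        by (rule ennreal_mult'[OF c0, symmetric])
      also have "C / m n * cmod z ^ n * (8 * mom s (real (Suc n)) / real (Suc n))
          = C * 8 * (mom s (real (Suc n)) / m n * cmod z ^ n / real (Suc n))"
        by simp
      finally show "(\<integral>\<^sup>+ \<zeta>. ennreal (g n \<zeta>) \<partial>disc_area) \<le> ennreal (C * 8 * (mom s (real (Suc n)) / m n * cmod z ^ n / real (Suc n)))" .
    qed auto
    also have "\<dots> = ennreal (\<Sum>n. C * 8 * (mom s (real (Suc n)) / m n * cmod z ^ n / real (Suc n)))"
      using C(1) m s0 by (intro suminf_ennreal2 summable_mult summ) (auto simp: less_imp_le simp del: of_nat_Suc)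
    also have "(\<Sum>n. C * 8 * (mom s (real (Suc n)) / m n * cmod z ^ n / real (Suc n)))
        = C * 8 * (\<Sum>n. mom s (real (Suc n)) / m n * cmod z ^ n / real (Suc n))"
      by (rule suminf_mult[OF summ])
    finally show "summable (\<lambda>n. mom s (real (Suc n)) / mom w (real (2 * n + 1)) * cmod z ^ n / real (Suc n)) \<and>
      (\<integral>\<^sup>+ \<zeta>. ennreal (cmod (kernel_series w (z * \<zeta>)) * s (cmod \<zeta>)) \<partial>disc_area)
      \<le> ennreal (C * 8 * (\<Sum>n. mom s (real (Suc n)) / mom w (real (2 * n + 1)) * cmod z ^ n / real (Suc n)))"
      using summ by (simp add: m_def)
  qed (use C in simp)
qed

section \<open>Sufficiency of the moment condition\<close>

text \<open>Concavity gives \<alpha> m^(\<alpha> - 1) <= m^\<alpha> - (m - 1)^\<alpha>, and the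
  right side telescopes.\<close>

lemma powr_sum_le:
  assumes \<alpha>: "0 < \<alpha>" "\<alpha> \<le> 1"
  shows "\<alpha> * (\<Sum>n<k. real (Suc n) powr (\<alpha> - 1)) \<le> real k powr \<alpha>"
proof (induction k)
  case (Suc k)
  have "\<alpha> * real (Suc k) powr (\<alpha> - 1) + real k powr \<alpha> \<le> real (Suc k) powr \<alpha>"
  proof (cases "k = 0")
    case False
    define t where "t = 1 / real (Suc k)"
    have t: "0 < 1 - t" using False by (simp add: t_def)
    \<comment> \<open>Young's inequality with one entry equal to 1 is the Bernoulli inequality (1 -
      t)^\<alpha> <= 1 - \<alpha> t.\<close>
    have "(1 - t) powr \<alpha> * 1 powr (1 - \<alpha>) \<le> \<alpha> * (1 - t) + (1 - \<alpha>) * 1"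
      using \<alpha> t by (intro Youngs_inequality_0) auto
    then have "real (Suc k) powr \<alpha> * (1 - t) powr \<alpha> \<le> real (Suc k) powr \<alpha> * (1 - \<alpha> * t)"
      by (intro mult_left_mono) (auto simp: algebra_simps)
    also have "real (Suc k) powr \<alpha> * (1 - t) powr \<alpha> = real k powr \<alpha>"
    proof -
      have "real (Suc k) powr \<alpha> * (1 - t) powr \<alpha> = (real (Suc k) * (1 - t)) powr \<alpha>"
        by (rule powr_mult[symmetric])
      also have "real (Suc k) * (1 - t) = real k" by (simp add: t_def field_simps)
      finally show ?thesis .
    qed
    also have "real (Suc k) powr \<alpha> * (1 - \<alpha> * t) = real (Suc k) powr \<alpha> - \<alpha> * real (Suc k) powr (\<alpha> - 1)"
      by (simp add: t_def powr_diff algebra_simps del: of_nat_Suc)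
    finally show ?thesis by simp
  qed (use \<alpha> in auto)
  then show ?case using Suc by (simp add: distrib_left)
qed simp

text \<open>With u = 1 / (2x) the geometric series is at most (1 + u) / u = 2x (1 + u), and u <= 1/2
  makes this at most 3x.\<close>

lemma geometric_exp_sum_le:
  assumes x: "1 \<le> x"
  shows "(\<Sum>n<k. 1 / x * exp (- real (Suc n) / (2 * x))) \<le> 3"
proof -
  define u where "u = 1 / (2 * x)"
  have u: "0 < u" "u \<le> 1 / 2" using x by (auto simp: u_def field_simps)
  have "exp (- u) \<le> 1 / (1 + u)"
    using exp_ge_add_one_self[of u] u by (simp add: exp_minus field_simps)
  then have e: "u / (1 + u) \<le> 1 - exp (- u)" using u by (simp add: field_simps)
  have "0 < u / (1 + u)" using u by simp
  with e have e1: "0 < 1 - exp (- u)" by linarith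
  have "(\<Sum>n<k. exp (- real (Suc n) / (2 * x))) \<le> (\<Sum>n<k. exp (- u) ^ n)"
  proof (rule sum_mono)
    fix n
    have "exp (- real (Suc n) / (2 * x)) \<le> exp (real n * (- u))"
      using u by (simp add: u_def field_simps)
    then show "exp (- real (Suc n) / (2 * x)) \<le> exp (- u) ^ n"
      by (simp only: exp_of_nat_mult)
  qed
  also have "\<dots> \<le> (\<Sum>n. exp (- u) ^ n)"
    using u by (intro sum_le_suminf summable_geometric) auto
  also have "\<dots> = 1 / (1 - exp (- u))" using u by (intro suminf_geometric) auto
  also have "\<dots> \<le> 1 / (u / (1 + u))" using e e1 u by (intro divide_left_mono) auto
  also have "\<dots> = 2 * x * (1 + u)" using x by (simp add: u_def)
  also have "\<dots> \<le> 2 * x * (3 / 2)" using x u by (intro mult_left_mono) auto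
  finally have "1 / x * (\<Sum>n<k. exp (- real (Suc n) / (2 * x))) \<le> 1 / x * (2 * x * (3 / 2))"
    using x by (intro mult_left_mono) auto
  also have "\<dots> = 3" using x by simp
  finally show ?thesis by (simp only: sum_distrib_left)
qed

text \<open>The order 1 lies outside \<open>mom_ge_tail\<close> and is covered by the ratio of
  \<open>mom v 1\<close> to \<open>tail v 0\<close>.\<close>

lemma mom_ge_tail_Suc:
  assumes v: "radial_weight v"
  obtains c where "c > 0" "\<And>n. c * tail v (1 - 1 / real (Suc n)) \<le> mom v (real (Suc n))"
proof -
  define c where "c = min (exp (- 2)) (mom v 1 / tail v 0)"
  show thesis
  proof (rule that[of c])
    show "c > 0" using mom_pos[OF v, of 1] tail_pos[OF v, of 0] by (simp add: c_def)
    fix n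
    show "c * tail v (1 - 1 / real (Suc n)) \<le> mom v (real (Suc n))"
    proof (cases "n = 0")
      case True
      have "c * tail v 0 \<le> mom v 1 / tail v 0 * tail v 0"
        using tail_pos[OF v, of 0] by (intro mult_right_mono) (auto simp: c_def)
      then show ?thesis using True tail_pos[OF v, of 0] by simp
    next
      case False
      have "c * tail v (1 - 1 / real (Suc n)) \<le> exp (- 2) * tail v (1 - 1 / real (Suc n))"
        using tail_pos[OF v, of "1 - 1 / real (Suc n)"] by (intro mult_right_mono) (auto simp: c_def)
      also have "exp (- 2) * tail v (1 - 1 / real (Suc n)) \<le> mom v (real (Suc n))"
        using mom_ge_tail[OF v, of "real (Suc n)" "real (Suc n)"] False by (simp del: of_nat_Suc)
      finally show ?thesis .
    qed
  qed
qed

text \<open>The sum is split at m = n + 1 near x = 1 / (1 - \<rho>). Below, the decay from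
  \<open>D_check\<close> bounds the terms by (m / x)^\<alpha> / m, whose sum is of order 1 /
  \<alpha>. Above, the polynomial growth (m / x)^b from \<open>D_hat\<close> is beaten by \<rho>^n,
  leaving exp (-m / (2x)) / x.\<close>

lemma inverse_moment_series_bound:
  assumes vh: "v \<in> D_hat" and vc: "v \<in> D_check"
  obtains C where "\<And>\<rho> k. 0 \<le> \<rho> \<Longrightarrow> \<rho> < 1 \<Longrightarrow>
    tail v \<rho> * (\<Sum>n<k. \<rho> ^ n / (real (Suc n) * mom v (real (Suc n)))) \<le> C"
proof -
  note v = D_hat_radial_weight[OF vh]
  obtain A and b :: nat where A: "A \<ge> 1"
    "\<And>r t. 0 \<le> r \<Longrightarrow> r \<le> t \<Longrightarrow> t < 1 \<Longrightarrow> tail v r \<le> A * ((1 - r) / (1 - t)) ^ b * tail v t"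
    using D_hat_growth[OF vh] by blast
  obtain B \<alpha> where B: "B > 0" "0 < \<alpha>" "\<alpha> \<le> 1"
    "\<And>r t. 0 \<le> r \<Longrightarrow> r \<le> t \<Longrightarrow> t < 1 \<Longrightarrow> tail v t \<le> B * ((1 - t) / (1 - r)) powr \<alpha> * tail v r"
    using D_check_decay[OF vc] by metis
  obtain c where c: "c > 0" "\<And>n. c * tail v (1 - 1 / real (Suc n)) \<le> mom v (real (Suc n))"
    using mom_ge_tail_Suc[OF v] by blast
  define E where "E = A * (2 ^ b * fact b) * exp 1"
  have E0: "0 \<le> E" using A(1) by (simp add: E_def)
  show thesis
  proof (rule that[of "B / c / \<alpha> + E / c * 3"])
    fix \<rho> :: real and k :: nat assume \<rho>: "0 \<le> \<rho>" "\<rho> < 1"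
    define x where "x = 1 / (1 - \<rho>)"
    have x: "1 \<le> x" "1 - \<rho> = 1 / x" using \<rho> by (auto simp: x_def)
    define K where "K = nat \<lfloor>x\<rfloor>"
    have K: "real K \<le> x" using x by (simp add: K_def)
    have term_le: "tail v \<rho> * (\<rho> ^ n / (real (Suc n) * mom v (real (Suc n))))
        \<le> (if n < K then B / c * (x powr (- \<alpha>) * real (Suc n) powr (\<alpha> - 1)) else 0)
          + E / c * (1 / x * exp (- real (Suc n) / (2 * x)))" for n
    proof -
      define m where "m = real (Suc n)"
      define t where "t = 1 - 1 / m"
      have m: "1 \<le> m" by (simp add: m_def)
      have t: "0 \<le> t" "t < 1" "1 - t = 1 / m" using m by (auto simp: t_def)
      have Tt: "0 < tail v t" using tail_pos[OF v t(1,2)] .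
      have T\<rho>: "0 < tail v \<rho>" using tail_pos[OF v \<rho>] .
      have mm: "c * tail v t \<le> mom v m" using c(2)[of n] by (simp only: m_def t_def)
      have \<rho>n: "0 \<le> \<rho> ^ n" "\<rho> ^ n \<le> 1" using \<rho> by (auto simp: power_le_one)
      have "tail v \<rho> * (\<rho> ^ n / (m * mom v m)) \<le> tail v \<rho> * (\<rho> ^ n / (m * (c * tail v t)))"
        using mm m c(1) Tt T\<rho> \<rho>n
        by (intro mult_left_mono divide_left_mono mult_pos_pos) (auto intro: less_le_trans[of 0 "c * tail v t"])
      also have "\<dots> = tail v \<rho> / tail v t * \<rho> ^ n / (c * m)" by simp
      finally have 1: "tail v \<rho> * (\<rho> ^ n / (m * mom v m)) \<le> tail v \<rho> / tail v t * \<rho> ^ n / (c * m)" .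
      show ?thesis
      proof (cases "n < K")
        case True
        then have mx: "m \<le> x" using K by (simp add: m_def)
        have "t \<le> \<rho>"
        proof -
          have "1 / x \<le> 1 / m" using mx m by (intro divide_left_mono) auto
          then show ?thesis using x(2) t(3) by linarith
        qed
        then have "tail v \<rho> \<le> B * ((1 - \<rho>) / (1 - t)) powr \<alpha> * tail v t" using t \<rho> by (intro B) auto
        then have "tail v \<rho> / tail v t \<le> B * ((1 - \<rho>) / (1 - t)) powr \<alpha>" using Tt by (simp add: field_simps)
        also have "(1 - \<rho>) / (1 - t) = m / x" unfolding x(2) t(3) by simp
        finally have "tail v \<rho> / tail v t \<le> B * (m / x) powr \<alpha>" .
        then have "tail v \<rho> / tail v t * \<rho> ^ n / (c * m) \<le> B * (m / x) powr \<alpha> * 1 / (c * m)"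
          using \<rho>n B(1) c(1) m Tt T\<rho> by (intro divide_right_mono mult_mono) auto
        also have "\<dots> = B / c * (x powr (- \<alpha>) * m powr (\<alpha> - 1))"
          using m x by (simp add: powr_divide powr_minus powr_diff field_simps)
        finally have "tail v \<rho> * (\<rho> ^ n / (m * mom v m)) \<le> B / c * (x powr (- \<alpha>) * m powr (\<alpha> - 1))"
          using 1 by linarith
        moreover have "0 \<le> E / c * (1 / x * exp (- real (Suc n) / (2 * x)))" using E0 c(1) x by simp
        ultimately show ?thesis using True by (simp add: m_def)
      next
        case False
        have mx: "x \<le> m" using False by (simp add: K_def m_def) linarith
        have y: "0 \<le> m / x" using m x by simp
        have "\<rho> \<le> t"
        proof -
          have "1 / m \<le> 1 / x" using mx m x by (intro divide_left_mono) auto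
          then show ?thesis using x(2) t(3) by linarith
        qed
        then have "tail v \<rho> \<le> A * ((1 - \<rho>) / (1 - t)) ^ b * tail v t" using t \<rho> by (intro A) auto
        then have "tail v \<rho> / tail v t \<le> A * ((1 - \<rho>) / (1 - t)) ^ b" using Tt by (simp add: field_simps)
        also have "(1 - \<rho>) / (1 - t) = m / x" unfolding x(2) t(3) by simp
        also have "A * (m / x) ^ b \<le> A * (2 ^ b * fact b * exp (m / x / 2))"
          using A(1) y by (intro mult_left_mono power_le_exp_half) auto
        finally have 2: "tail v \<rho> / tail v t \<le> A * (2 ^ b * fact b * exp (m / x / 2))" .
        \<comment> \<open>Since n = m - 1, the factor exp (1/x) <= e is lost. Half of the decay exp
          (-m/x) compensates exp (m / (2x)) in the growth bound and the other half is left for the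
          geometric sum.\<close>
        have 3: "\<rho> ^ n \<le> exp 1 * exp (- (m / x))"
        proof -
          have "\<rho> \<le> exp (- (1 / x))" using exp_ge_add_one_self[of "- (1 / x)"] x(2) by linarith
          then have "\<rho> ^ n \<le> exp (- (1 / x)) ^ n" using \<rho> by (intro power_mono) auto
          also have "\<dots> = exp (real n * (- (1 / x)))" by (simp only: exp_of_nat_mult)
          also have "real n * (- (1 / x)) = 1 / x - m / x" using x(1) by (simp add: m_def field_simps)
          also have "exp (1 / x - m / x) \<le> exp (1 - m / x)" using x(1) by simp
          also have "\<dots> = exp 1 * exp (- (m / x))" by (simp add: exp_add[symmetric])
          finally show ?thesis .
        qed
        have "tail v \<rho> / tail v t * \<rho> ^ n \<le> A * (2 ^ b * fact b * exp (m / x / 2)) * (exp 1 * exp (- (m / x)))"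
          using 2 3 \<rho>n A(1) by (intro mult_mono) auto
        also have "\<dots> = E * (exp (m / x / 2) * exp (- (m / x)))" by (simp add: E_def)
        also have "exp (m / x / 2) * exp (- (m / x)) = exp (- m / (2 * x))"
          using x(1) by (simp add: exp_add[symmetric] field_simps)
        finally have "tail v \<rho> / tail v t * \<rho> ^ n / (c * m) \<le> E * exp (- m / (2 * x)) / (c * m)"
          using c(1) m by (intro divide_right_mono) auto
        also have "\<dots> \<le> E * exp (- m / (2 * x)) / (c * x)"
          using c(1) m x mx E0 by (intro divide_left_mono mult_left_mono mult_pos_pos) auto
        finally have "tail v \<rho> * (\<rho> ^ n / (m * mom v m)) \<le> E * exp (- m / (2 * x)) / (c * x)"
          using 1 by linarith
        then show ?thesis using False by (simp add: m_def)
      qed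
    qed
    have "tail v \<rho> * (\<Sum>n<k. \<rho> ^ n / (real (Suc n) * mom v (real (Suc n))))
        \<le> (\<Sum>n<k. (if n < K then B / c * (x powr (- \<alpha>) * real (Suc n) powr (\<alpha> - 1)) else 0)
          + E / c * (1 / x * exp (- real (Suc n) / (2 * x))))"
      unfolding sum_distrib_left by (intro sum_mono term_le)
    also have "\<dots> = (\<Sum>n<k. if n < K then B / c * (x powr (- \<alpha>) * real (Suc n) powr (\<alpha> - 1)) else 0)
        + E / c * (\<Sum>n<k. 1 / x * exp (- real (Suc n) / (2 * x)))"
      by (simp only: sum.distrib sum_distrib_left)
    also have "\<dots> \<le> B / c / \<alpha> + E / c * 3"
    proof (rule add_mono)
      have "(\<Sum>n<k. if n < K then B / c * (x powr (- \<alpha>) * real (Suc n) powr (\<alpha> - 1)) else 0)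
          = (\<Sum>n\<in>{..<k} \<inter> {..<K}. B / c * (x powr (- \<alpha>) * real (Suc n) powr (\<alpha> - 1)))"
        by (subst sum.inter_restrict) (auto intro!: sum.cong)
      also have "\<dots> \<le> (\<Sum>n<K. B / c * (x powr (- \<alpha>) * real (Suc n) powr (\<alpha> - 1)))"
        using B c by (intro sum_mono2) auto
      also have "\<dots> = B / c * x powr (- \<alpha>) * (\<Sum>n<K. real (Suc n) powr (\<alpha> - 1))"
        by (simp add: sum_distrib_left mult_ac)
      also have "\<dots> \<le> B / c * x powr (- \<alpha>) * (x powr \<alpha> / \<alpha>)"
      proof (rule mult_left_mono)
        have "\<alpha> * (\<Sum>n<K. real (Suc n) powr (\<alpha> - 1)) \<le> real K powr \<alpha>" using B by (intro powr_sum_le)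
        also have "\<dots> \<le> x powr \<alpha>" using K B by (intro powr_mono2) auto
        finally show "(\<Sum>n<K. real (Suc n) powr (\<alpha> - 1)) \<le> x powr \<alpha> / \<alpha>"
          using B(2) by (simp add: field_simps)
      qed (use B c in auto)
      also have "\<dots> = B / c / \<alpha>" using x by (simp add: powr_minus field_simps)
      finally show "(\<Sum>n<k. if n < K then B / c * (x powr (- \<alpha>) * real (Suc n) powr (\<alpha> - 1)) else 0) \<le> B / c / \<alpha>" .
      show "E / c * (\<Sum>n<k. 1 / x * exp (- real (Suc n) / (2 * x))) \<le> E / c * 3"
        using E0 c(1) x by (intro mult_left_mono geometric_exp_sum_le) auto
    qed
    finally show "tail v \<rho> * (\<Sum>n<k. \<rho> ^ n / (real (Suc n) * mom v (real (Suc n)))) \<le> B / c / \<alpha> + E / c * 3" .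
  qed
qed

section \<open>Power series of the kernel and of the projection\<close>

lemma kernel_series_summable:
  assumes w: "radial_weight w" and u: "cmod u < 1"
  shows "summable (\<lambda>n. of_real (1 / mom w (real (2 * n + 1))) * u ^ n :: complex)"
proof (rule summable_norm_cancel)
  show "summable (\<lambda>n. cmod (of_real (1 / mom w (real (2 * n + 1))) * u ^ n))"
    using summable_inverse_mom[OF w, of "cmod u"] u mom_pos[OF w]
    by (simp add: norm_mult norm_power norm_divide less_imp_le)
qed

lemma bergman_kernel_eq:
  assumes w: "radial_weight w" and z: "z \<in> unit_disc" and \<zeta>: "\<zeta> \<in> unit_disc"
  shows "bergman_kernel w z \<zeta> = kernel_series w (cnj z * \<zeta>) / 2"
    and "cnj (bergman_kernel w z \<zeta>) = (\<Sum>n. of_real (1 / (2 * mom w (real (2 * n + 1)))) * z ^ n * cnj \<zeta> ^ n)"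
proof -
  have u: "cmod (cnj z * \<zeta>) < 1"
    using mult_strict_mono'[of "cmod z" 1 "cmod \<zeta>" 1] z \<zeta> by (simp add: norm_mult)
  note s = kernel_series_summable[OF w u]
  have eq: "(cnj z * \<zeta>) ^ n / of_real (2 * enn2real (moment w (real (2 * n + 1))))
      = (of_real (1 / mom w (real (2 * n + 1))) * (cnj z * \<zeta>) ^ n) / 2" for n
    using mom_pos[OF w, of "real (2 * n + 1)"] by (simp add: moment_eq_mom[OF w] del: of_nat_add of_nat_mult)
  show 1: "bergman_kernel w z \<zeta> = kernel_series w (cnj z * \<zeta>) / 2"
    unfolding bergman_kernel_def kernel_series_def eq by (rule suminf_divide[OF s])
  have "cnj (bergman_kernel w z \<zeta>) = cnj (\<Sum>n. (of_real (1 / mom w (real (2 * n + 1))) * (cnj z * \<zeta>) ^ n) / 2)"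
    by (simp only: bergman_kernel_def eq)
  also have "\<dots> = (\<Sum>n. cnj ((of_real (1 / mom w (real (2 * n + 1))) * (cnj z * \<zeta>) ^ n) / 2))"
    using summable_divide[OF s, of 2] by (rule bounded_linear.suminf[OF bounded_linear_cnj])
  also have "\<dots> = (\<Sum>n. of_real (1 / (2 * mom w (real (2 * n + 1)))) * z ^ n * cnj \<zeta> ^ n)"
    by (simp add: power_mult_distrib mult_ac)
  finally show "cnj (bergman_kernel w z \<zeta>) = (\<Sum>n. of_real (1 / (2 * mom w (real (2 * n + 1)))) * z ^ n * cnj \<zeta> ^ n)" .
qed

text \<open>For fixed z the coefficients of the conjugate kernel are absolutely summable and
  |\<zeta>| <= 1, so the kernel may be integrated termwise. The Taylor coefficients obtained are the
  same for all z, which yields holomorphy and makes the projection of test functions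
  computable.\<close>

lemma bergman_projection_series:
  assumes w: "radial_weight w" and f: "integrable disc_area (\<lambda>\<zeta>. f \<zeta> * of_real (w (cmod \<zeta>)))"
    and z: "z \<in> unit_disc"
  shows "integrable disc_area (bergman_integrand w f z)"
    and "(\<lambda>n. of_real (1 / (2 * mom w (real (2 * n + 1)))) *
        (LINT \<zeta>|disc_area. f \<zeta> * of_real (w (cmod \<zeta>)) * cnj \<zeta> ^ n) * z ^ n) sums bergman_projection w f z"
proof -
  define a where "a n = of_real (1 / (2 * mom w (real (2 * n + 1)))) * z ^ n" for n
  have "summable (\<lambda>n. 1 / 2 * (1 / mom w (real (2 * n + 1)) * cmod z ^ n))"
    using z by (intro summable_mult summable_inverse_mom[OF w]) auto
  then have a: "summable (\<lambda>n. cmod (a n))"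
    using mom_pos[OF w] by (simp add: a_def norm_mult norm_power norm_divide less_imp_le)
  have h: "(\<lambda>\<zeta>. cnj \<zeta> ^ n) \<in> borel_measurable disc_area" for n
    by (intro continuous_borel_measurable_disc_area continuous_intros)
  have h1: "cmod (cnj \<zeta> ^ n) \<le> 1" if "\<zeta> \<in> space disc_area" for n \<zeta>
    using that by (simp add: norm_power power_le_one)
  have eq: "bergman_integrand w f z \<zeta> = f \<zeta> * of_real (w (cmod \<zeta>)) * (\<Sum>n. a n * cnj \<zeta> ^ n)"
    if "\<zeta> \<in> space disc_area" for \<zeta>
    using that bergman_kernel_eq(2)[OF w z, of \<zeta>] by (simp add: bergman_integrand_def a_def)
  show "integrable disc_area (bergman_integrand w f z)"
    using integral_mult_suminf(1)[OF f h h1 a] eq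
    by (subst Bochner_Integration.integrable_cong[OF refl]) auto
  have "bergman_projection w f z = (LINT \<zeta>|disc_area. f \<zeta> * of_real (w (cmod \<zeta>)) * (\<Sum>n. a n * cnj \<zeta> ^ n))"
    unfolding bergman_projection_def using eq by (intro Bochner_Integration.integral_cong) auto
  also have "\<dots> = (\<Sum>n. a n * (LINT \<zeta>|disc_area. f \<zeta> * of_real (w (cmod \<zeta>)) * cnj \<zeta> ^ n))"
    by (rule integral_mult_suminf(2)[OF f h h1 a])
  finally have val: "bergman_projection w f z = (\<Sum>n. a n * (LINT \<zeta>|disc_area. f \<zeta> * of_real (w (cmod \<zeta>)) * cnj \<zeta> ^ n))" .
  have int: "integrable disc_area (\<lambda>\<zeta>. cmod (f \<zeta> * of_real (w (cmod \<zeta>))))" using f by (rule integrable_norm)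
  have "summable (\<lambda>n. a n * (LINT \<zeta>|disc_area. f \<zeta> * of_real (w (cmod \<zeta>)) * cnj \<zeta> ^ n))"
  proof (rule summable_norm_cancel, rule summable_comparison_test'[OF summable_mult2[OF a]])
    fix n
    have "cmod (LINT \<zeta>|disc_area. f \<zeta> * of_real (w (cmod \<zeta>)) * cnj \<zeta> ^ n)
        \<le> (LINT \<zeta>|disc_area. cmod (f \<zeta> * of_real (w (cmod \<zeta>))))"
    proof (rule order.trans[OF Bochner_Integration.integral_norm_bound], rule integral_mono[OF integrable_norm int])
      show "integrable disc_area (\<lambda>\<zeta>. f \<zeta> * of_real (w (cmod \<zeta>)) * cnj \<zeta> ^ n)"
      proof (rule Bochner_Integration.integrable_bound[OF f])
        show "(\<lambda>\<zeta>. f \<zeta> * of_real (w (cmod \<zeta>)) * cnj \<zeta> ^ n) \<in> borel_measurable disc_area"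
          using borel_measurable_integrable[OF f] h by (rule borel_measurable_times)
        show "AE \<zeta> in disc_area. cmod (f \<zeta> * of_real (w (cmod \<zeta>)) * cnj \<zeta> ^ n) \<le> cmod (f \<zeta> * of_real (w (cmod \<zeta>)))"
          using h1 by (intro AE_I2) (simp add: norm_mult mult_left_le)
      qed
      fix \<zeta> assume "\<zeta> \<in> space disc_area"
      then show "cmod (f \<zeta> * of_real (w (cmod \<zeta>)) * cnj \<zeta> ^ n) \<le> cmod (f \<zeta> * of_real (w (cmod \<zeta>)))"
        using h1 by (simp add: norm_mult mult_left_le)
    qed
    then show "norm (norm (a n * (LINT \<zeta>|disc_area. f \<zeta> * of_real (w (cmod \<zeta>)) * cnj \<zeta> ^ n)))
        \<le> cmod (a n) * (LINT \<zeta>|disc_area. cmod (f \<zeta> * of_real (w (cmod \<zeta>))))"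
      unfolding norm_mult[of "a n"] by (simp add: mult_left_mono)
  qed
  then have "(\<lambda>n. a n * (LINT \<zeta>|disc_area. f \<zeta> * of_real (w (cmod \<zeta>)) * cnj \<zeta> ^ n)) sums bergman_projection w f z"
    unfolding val by (rule summable_sums)
  then show "(\<lambda>n. of_real (1 / (2 * mom w (real (2 * n + 1)))) *
        (LINT \<zeta>|disc_area. f \<zeta> * of_real (w (cmod \<zeta>)) * cnj \<zeta> ^ n) * z ^ n) sums bergman_projection w f z"
    by (simp add: a_def mult_ac)
qed

lemma bergman_projection_holomorphic:
  assumes w: "radial_weight w" and f: "integrable disc_area (\<lambda>\<zeta>. f \<zeta> * of_real (w (cmod \<zeta>)))"
  shows "bergman_projection w f holomorphic_on unit_disc"
proof (rule power_series_holomorphic)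
  fix z assume "z \<in> unit_disc"
  from bergman_projection_series(2)[OF w f this]
  show "(\<lambda>n. of_real (1 / (2 * mom w (real (2 * n + 1)))) *
        (LINT \<zeta>|disc_area. f \<zeta> * of_real (w (cmod \<zeta>)) * cnj \<zeta> ^ n) * (z - 0) ^ n) sums bergman_projection w f z"
    by (simp only: diff_zero)
qed

section \<open>Weighted sup norms\<close>

lemma radial_weight_measurable:
  assumes "radial_weight w"
  shows "(\<lambda>\<zeta>. w (cmod \<zeta>)) \<in> borel_measurable disc_area"
  using has_integral_radial_weight[OF assms, of 0] by (auto simp: has_bochner_integral_iff)

lemma tail_measurable:
  assumes "radial_weight v"
  shows "(\<lambda>\<zeta>. tail v (cmod \<zeta>)) \<in> borel_measurable disc_area"
proof -
  have "(cmod :: complex \<Rightarrow> real) \<in> borel_measurable borel" by measurable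
  from measurable_compose[OF this tail_borel_measurable[OF assms]]
  have "(\<lambda>\<zeta>. indicator {0..<1} (cmod \<zeta>) * tail v (cmod \<zeta>)) \<in> borel_measurable borel" .
  then have "(\<lambda>\<zeta>. indicator {0..<1} (cmod \<zeta>) * tail v (cmod \<zeta>)) \<in> borel_measurable disc_area"
    by (rule borel_measurable_disc_area)
  then show ?thesis by (subst measurable_cong) auto
qed

lemma holomorphic_measurable_disc_area:
  "f holomorphic_on unit_disc \<Longrightarrow> f \<in> borel_measurable disc_area"
  unfolding measurable_disc_area
  by (intro continuous_imp_measurable_on_sets_lebesgue holomorphic_on_imp_continuous_on) auto

lemma Linf_AE_bound:
  assumes "f \<in> Linf v"
  obtains b where "b \<ge> 0" "Linf_norm v f = ennreal b" "AE \<zeta> in disc_area. cmod (f \<zeta>) * tail v (cmod \<zeta>) \<le> b"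
proof -
  have "Linf_norm v f < \<infinity>" using assms by (simp add: Linf_def)
  then obtain b where b: "b \<ge> 0" "Linf_norm v f = ennreal b"
    by (cases "Linf_norm v f") auto
  have "AE \<zeta> in disc_area. ennreal (cmod (f \<zeta>) * tail v (cmod \<zeta>)) \<le> ennreal b"
    using esssup_AE[of "\<lambda>\<zeta>. ennreal (cmod (f \<zeta>) * tail v (cmod \<zeta>))" disc_area] b(2)
    by (simp add: Linf_norm_def)
  then have "AE \<zeta> in disc_area. cmod (f \<zeta>) * tail v (cmod \<zeta>) \<le> b"
    by eventually_elim (use b(1) in \<open>simp add: ennreal_le_iff\<close>)
  with b show thesis by (rule that)
qed

lemma Linf_weight_bound:
  assumes v: "radial_weight v" and w: "radial_weight w"
    and "AE \<zeta> in disc_area. cmod (f \<zeta>) * tail v (cmod \<zeta>) \<le> b"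
  shows "AE \<zeta> in disc_area. cmod (f \<zeta> * of_real (w (cmod \<zeta>))) \<le> b * tail_quotient w v (cmod \<zeta>)"
proof -
  have "AE \<zeta> in disc_area. \<zeta> \<in> unit_disc" using AE_space[of disc_area] by simp
  with assms(3) show ?thesis
  proof eventually_elim
    case (elim \<zeta>)
    have T: "0 < tail v (cmod \<zeta>)" and W: "0 \<le> w (cmod \<zeta>)"
      using elim(2) by (auto intro: tail_pos[OF v] radial_weight_nonneg[OF w])
    have "cmod (f \<zeta>) \<le> b / tail v (cmod \<zeta>)" using elim(1) T by (simp add: field_simps)
    then have "cmod (f \<zeta>) * w (cmod \<zeta>) \<le> b / tail v (cmod \<zeta>) * w (cmod \<zeta>)"
      using W by (rule mult_right_mono)
    then show ?case using W by (simp add: norm_mult tail_quotient_def)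
  qed
qed

lemma Linf_integrable:
  assumes v: "radial_weight v" and w: "radial_weight w" and s: "radial_weight (tail_quotient w v)"
    and f: "f \<in> Linf v"
  shows "integrable disc_area (\<lambda>\<zeta>. f \<zeta> * of_real (w (cmod \<zeta>)))"
proof -
  obtain b where b: "b \<ge> 0" "AE \<zeta> in disc_area. cmod (f \<zeta>) * tail v (cmod \<zeta>) \<le> b"
    using Linf_AE_bound[OF f] by metis
  have "integrable disc_area (\<lambda>\<zeta>. b * tail_quotient w v (cmod \<zeta>))"
    using has_integral_radial_weight[OF s, of 0] by (intro integrable_mult_right) (auto simp: has_bochner_integral_iff)
  then show ?thesis
  proof (rule Bochner_Integration.integrable_bound)
    have "f \<in> borel_measurable disc_area" using f by (simp add: Linf_def)
    then show "(\<lambda>\<zeta>. f \<zeta> * of_real (w (cmod \<zeta>))) \<in> borel_measurable disc_area"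
      using radial_weight_measurable[OF w] by measurable
    show "AE \<zeta> in disc_area. cmod (f \<zeta> * of_real (w (cmod \<zeta>))) \<le> norm (b * tail_quotient w v (cmod \<zeta>))"
      using Linf_weight_bound[OF v w b(2)] by eventually_elim auto
  qed
qed

text \<open>The moment condition trades each coefficient for a multiple of 1 /
  \<open>mom v (real (Suc n))\<close>, which reduces the series to
  \<open>inverse_moment_series_bound\<close>.\<close>

lemma moment_condition_series_bound:
  assumes w: "w \<in> D_hat" and vh: "v \<in> D_hat" and vc: "v \<in> D_check" and mc: "moment_condition w v"
  obtains C where "\<And>\<rho>. 0 \<le> \<rho> \<Longrightarrow> \<rho> < 1 \<Longrightarrow>
    summable (\<lambda>n. mom (tail_quotient w v) (real (Suc n)) / mom w (real (2 * n + 1)) * \<rho> ^ n / real (Suc n)) \<Longrightarrow>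
    tail v \<rho> * (\<Sum>n. mom (tail_quotient w v) (real (Suc n)) / mom w (real (2 * n + 1)) * \<rho> ^ n / real (Suc n)) \<le> C"
proof -
  note rw = D_hat_radial_weight[OF w] and v = D_hat_radial_weight[OF vh]
  obtain C0 where i: "set_integrable lebesgue {0..<1} (tail_quotient w v)"
    and C0: "\<And>x. 0 \<le> x \<Longrightarrow> mom v x * mom (tail_quotient w v) x \<le> C0 * mom w (2 * x)"
    using mc by (auto simp: moment_condition_def)
  note s = radial_weight_tail_quotient[OF v rw i]
  obtain C1 where C1: "\<And>\<rho> k. 0 \<le> \<rho> \<Longrightarrow> \<rho> < 1 \<Longrightarrow>
    tail v \<rho> * (\<Sum>n<k. \<rho> ^ n / (real (Suc n) * mom v (real (Suc n)))) \<le> C1"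
    using inverse_moment_series_bound[OF vh vc] by blast
  define C where "C = max C0 0"
  have coeff: "mom (tail_quotient w v) (real (Suc n)) / mom w (real (2 * n + 1)) \<le> C / mom v (real (Suc n))" for n
  proof -
    \<comment> \<open>The half-integer makes 2x equal to the odd order 2n + 1 of the kernel; the
      other two moments of order n + 1 are then bounded by monotonicity.\<close>
    define x where "x = real n + 1 / 2"
    have x: "0 \<le> x" "x \<le> real (Suc n)" "2 * x = real (2 * n + 1)" by (auto simp: x_def)
    have "mom v (real (Suc n)) * mom (tail_quotient w v) (real (Suc n)) \<le> mom v x * mom (tail_quotient w v) x"
      using x mom_pos[OF v x(1)] mom_pos[OF s, of "real (Suc n)"]
      by (intro mult_mono mom_antimono v s) auto
    also have "\<dots> \<le> C0 * mom w (real (2 * n + 1))" using C0[OF x(1)] x(3) by simp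
    also have "\<dots> \<le> C * mom w (real (2 * n + 1))"
      using mom_pos[OF rw, of "real (2 * n + 1)"] by (intro mult_right_mono) (auto simp: C_def)
    finally show ?thesis
      using mom_pos[OF rw, of "real (2 * n + 1)"] mom_pos[OF v, of "real (Suc n)"]
      by (simp add: field_simps del: of_nat_Suc of_nat_add of_nat_mult)
  qed
  show thesis
  proof (rule that[of "C * C1"])
    fix \<rho> :: real assume \<rho>: "0 \<le> \<rho>" "\<rho> < 1"
    let ?f = "\<lambda>n. mom (tail_quotient w v) (real (Suc n)) / mom w (real (2 * n + 1)) * \<rho> ^ n / real (Suc n)"
    assume summ: "summable ?f"
    have T: "0 < tail v \<rho>" using tail_pos[OF v \<rho>] .
    have "(\<Sum>n. ?f n) \<le> C * C1 / tail v \<rho>"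
    proof (rule suminf_le_const[OF summ])
      fix k
      have "(\<Sum>n<k. ?f n) \<le> (\<Sum>n<k. C * (\<rho> ^ n / (real (Suc n) * mom v (real (Suc n)))))"
      proof (rule sum_mono)
        fix n
        have "?f n \<le> C / mom v (real (Suc n)) * \<rho> ^ n / real (Suc n)"
          using coeff[of n] \<rho> by (intro divide_right_mono mult_right_mono) auto
        then show "?f n \<le> C * (\<rho> ^ n / (real (Suc n) * mom v (real (Suc n))))" by (simp add: mult_ac)
      qed
      also have "\<dots> = C * (\<Sum>n<k. \<rho> ^ n / (real (Suc n) * mom v (real (Suc n))))" by (simp add: sum_distrib_left)
      also have "\<dots> \<le> C * (C1 / tail v \<rho>)"
        using C1[OF \<rho>, of k] T by (intro mult_left_mono) (auto simp: C_def field_simps)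
      finally show "(\<Sum>n<k. ?f n) \<le> C * C1 / tail v \<rho>" by simp
    qed
    then show "tail v \<rho> * (\<Sum>n. ?f n) \<le> C * C1" using T by (simp add: field_simps)
  qed
qed

text \<open>If |f| tail v is at most b almost everywhere, then |f| w is at most b times the quotient
  weight. The projection is thus dominated by b/2 times the integral of the modulus of
  \<open>kernel_series\<close> against that weight.\<close>

lemma bergman_projection_bounded_if_moment_condition:
  assumes w: "w \<in> D_hat" and vh: "v \<in> D_hat" and vc: "v \<in> D_check" and mc: "moment_condition w v"
  shows "bergman_projection_bounded w v"
proof -
  note rw = D_hat_radial_weight[OF w] and v = D_hat_radial_weight[OF vh]
  have i: "set_integrable lebesgue {0..<1} (tail_quotient w v)" using mc by (simp add: moment_condition_def)
  define s where "s = tail_quotient w v"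
  have s: "radial_weight s" unfolding s_def by (rule radial_weight_tail_quotient[OF v rw i])
  define S where "S = (\<lambda>\<rho> n. mom s (real (Suc n)) / mom w (real (2 * n + 1)) * \<rho> ^ n / real (Suc n))"
  obtain C1 where C1': "\<And>\<rho>. 0 \<le> \<rho> \<Longrightarrow> \<rho> < 1 \<Longrightarrow>
    summable (\<lambda>n. mom (tail_quotient w v) (real (Suc n)) / mom w (real (2 * n + 1)) * \<rho> ^ n / real (Suc n)) \<Longrightarrow>
    tail v \<rho> * (\<Sum>n. mom (tail_quotient w v) (real (Suc n)) / mom w (real (2 * n + 1)) * \<rho> ^ n / real (Suc n)) \<le> C1"
    by (rule moment_condition_series_bound[OF w vh vc mc]) (rule that)
  have C1: "tail v \<rho> * (\<Sum>n. S \<rho> n) \<le> C1" if "0 \<le> \<rho>" "\<rho> < 1" "summable (S \<rho>)" for \<rho>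
    using C1'[OF that(1,2)] that(3) by (simp only: S_def s_def)
  obtain C2 where C2: "C2 > 0" "\<And>s z. radial_weight s \<Longrightarrow> cmod z < 1 \<Longrightarrow>
      summable (\<lambda>n. mom s (real (Suc n)) / mom w (real (2 * n + 1)) * cmod z ^ n / real (Suc n)) \<and>
      (\<integral>\<^sup>+ \<zeta>. ennreal (cmod (kernel_series w (z * \<zeta>)) * s (cmod \<zeta>)) \<partial>disc_area)
      \<le> ennreal (C2 * (\<Sum>n. mom s (real (Suc n)) / mom w (real (2 * n + 1)) * cmod z ^ n / real (Suc n)))"
    by (rule kernel_series_integral_bound[OF w]) (rule that)
  have C2': "summable (S (cmod z)) \<and>
      (\<integral>\<^sup>+ \<zeta>. ennreal (cmod (kernel_series w (z * \<zeta>)) * s (cmod \<zeta>)) \<partial>disc_area) \<le> ennreal (C2 * (\<Sum>n. S (cmod z) n))"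
    if "cmod z < 1" for z
    using C2(2)[OF s that] by (simp only: S_def)
  define C where "C = C2 / 2 * max C1 0"
  have C: "0 \<le> C" using C2(1) by (simp add: C_def)
  have main: "cmod (bergman_projection w f z) * tail v (cmod z) \<le> C * b"
    if z: "z \<in> unit_disc" and f: "f \<in> Linf v" and b: "b \<ge> 0" "AE \<zeta> in disc_area. cmod (f \<zeta>) * tail v (cmod \<zeta>) \<le> b" for f z b
  proof -
    note int = bergman_projection_series(1)[OF rw Linf_integrable[OF v rw s[unfolded s_def] f] z]
    have z': "cmod (cnj z) < 1" "cmod z < 1" using z by auto
    have SS: "summable (S (cmod z))" using C2'[OF z'(2)] by simp
    have T: "0 < tail v (cmod z)" using z' by (intro tail_pos[OF v]) auto
    have "ennreal (cmod (bergman_projection w f z)) \<le> (\<integral>\<^sup>+ \<zeta>. norm (bergman_integrand w f z \<zeta>) \<partial>disc_area)"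
      unfolding bergman_projection_def by (rule integral_norm_bound_ennreal[OF int])
    also have "\<dots> \<le> (\<integral>\<^sup>+ \<zeta>. ennreal (b / 2) * ennreal (cmod (kernel_series w (cnj z * \<zeta>)) * s (cmod \<zeta>)) \<partial>disc_area)"
    proof (rule nn_integral_mono_AE)
      have "AE \<zeta> in disc_area. \<zeta> \<in> unit_disc" using AE_space[of disc_area] by simp
      with Linf_weight_bound[OF v rw b(2)]
      show "AE \<zeta> in disc_area. ennreal (norm (bergman_integrand w f z \<zeta>))
          \<le> ennreal (b / 2) * ennreal (cmod (kernel_series w (cnj z * \<zeta>)) * s (cmod \<zeta>))"
      proof eventually_elim
        case (elim \<zeta>)
        have "norm (bergman_integrand w f z \<zeta>) = cmod (f \<zeta> * of_real (w (cmod \<zeta>))) * (cmod (kernel_series w (cnj z * \<zeta>)) / 2)"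
          unfolding bergman_integrand_def bergman_kernel_eq(1)[OF rw z elim(2)]
          by (simp only: norm_mult complex_mod_cnj norm_divide norm_numeral mult_ac)
        also have "\<dots> \<le> b * s (cmod \<zeta>) * (cmod (kernel_series w (cnj z * \<zeta>)) / 2)"
          using elim(1) by (intro mult_right_mono) (auto simp: s_def)
        also have "\<dots> = b / 2 * (cmod (kernel_series w (cnj z * \<zeta>)) * s (cmod \<zeta>))" by simp
        finally show ?case using b(1) by (subst ennreal_mult'[symmetric]) (auto intro: ennreal_leI)
      qed
    qed
    also have "\<dots> = ennreal (b / 2) * (\<integral>\<^sup>+ \<zeta>. ennreal (cmod (kernel_series w (cnj z * \<zeta>)) * s (cmod \<zeta>)) \<partial>disc_area)"
    proof (rule nn_integral_cmult)
      have "continuous_on unit_disc (\<lambda>u. kernel_series w u)"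
      proof (intro holomorphic_on_imp_continuous_on power_series_holomorphic)
        fix u :: complex assume "u \<in> unit_disc"
        then show "(\<lambda>n. of_real (1 / mom w (real (2 * n + 1))) * (u - 0) ^ n) sums kernel_series w u"
          unfolding kernel_series_def using kernel_series_summable[OF rw, of u] by (simp add: summable_sums)
      qed
      then have "continuous_on unit_disc (\<lambda>\<zeta>. kernel_series w (cnj z * \<zeta>))"
      proof (rule continuous_on_compose2)
        show "continuous_on unit_disc (\<lambda>\<zeta>. cnj z * \<zeta>)" by (intro continuous_intros)
        show "(\<lambda>\<zeta>. cnj z * \<zeta>) ` unit_disc \<subseteq> unit_disc"
        proof (rule image_subsetI)
          fix \<zeta> assume "\<zeta> \<in> unit_disc"
          then show "cnj z * \<zeta> \<in> unit_disc"
            using mult_strict_mono'[of "cmod z" 1 "cmod \<zeta>" 1] z' by (simp add: norm_mult)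
        qed
      qed
      then have "(\<lambda>\<zeta>. kernel_series w (cnj z * \<zeta>)) \<in> borel_measurable disc_area"
        unfolding measurable_disc_area by (intro continuous_imp_measurable_on_sets_lebesgue) auto
      then show "(\<lambda>\<zeta>. ennreal (cmod (kernel_series w (cnj z * \<zeta>)) * s (cmod \<zeta>))) \<in> borel_measurable disc_area"
        using radial_weight_measurable[OF s] by measurable
    qed
    also have "\<dots> \<le> ennreal (b / 2) * ennreal (C2 * (\<Sum>n. S (cmod z) n))"
      using C2'[OF z'(1)] by (intro mult_left_mono) auto
    also have "\<dots> = ennreal (b / 2 * (C2 * (\<Sum>n. S (cmod z) n)))"
      using b(1) by (intro ennreal_mult'[symmetric]) simp
    finally have le: "ennreal (cmod (bergman_projection w f z)) \<le> ennreal (b / 2 * (C2 * (\<Sum>n. S (cmod z) n)))" .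
    have "0 \<le> S (cmod z) n" for n
      using mom_pos[OF s, of "real (Suc n)"] mom_pos[OF rw, of "real (2 * n + 1)"] by (simp add: S_def)
    then have "0 \<le> (\<Sum>n. S (cmod z) n)" by (rule suminf_nonneg[OF SS])
    then have "0 \<le> b / 2 * (C2 * (\<Sum>n. S (cmod z) n))" using b(1) C2(1) by simp
    with le have "cmod (bergman_projection w f z) \<le> b / 2 * (C2 * (\<Sum>n. S (cmod z) n))"
      by (simp only: ennreal_le_iff)
    then have "cmod (bergman_projection w f z) * tail v (cmod z) \<le> b / 2 * (C2 * (\<Sum>n. S (cmod z) n)) * tail v (cmod z)"
      using T by (intro mult_right_mono) auto
    also have "\<dots> = b * (C2 / 2) * (tail v (cmod z) * (\<Sum>n. S (cmod z) n))" by simp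
    also have "\<dots> \<le> b * (C2 / 2) * max C1 0"
      using C1[OF _ z'(2) SS] b(1) C2(1) by (intro mult_left_mono) (auto simp: le_max_iff_disj)
    finally show ?thesis by (simp add: C_def mult_ac)
  qed
  show ?thesis unfolding bergman_projection_bounded_def
  proof (rule exI[of _ C], intro conjI ballI C)
    fix f assume f: "f \<in> Linf v"
    note int = Linf_integrable[OF v rw s[unfolded s_def] f]
    show "integrable disc_area (bergman_integrand w f z)" if "z \<in> unit_disc" for z
      by (rule bergman_projection_series(1)[OF rw int that])
    have hol: "bergman_projection w f holomorphic_on unit_disc"
      by (rule bergman_projection_holomorphic[OF rw int])
    then have meas: "bergman_projection w f \<in> borel_measurable disc_area"
      by (rule holomorphic_measurable_disc_area)
    obtain b where b: "b \<ge> 0" "Linf_norm v f = ennreal b" "AE \<zeta> in disc_area. cmod (f \<zeta>) * tail v (cmod \<zeta>) \<le> b"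
      using Linf_AE_bound[OF f] .
    have "Linf_norm v (bergman_projection w f) \<le> ennreal (C * b)"
      unfolding Linf_norm_def
    proof (rule esssup_I)
      show "(\<lambda>z. ennreal (cmod (bergman_projection w f z) * tail v (cmod z))) \<in> borel_measurable disc_area"
        using meas tail_measurable[OF v] by measurable
      show "AE z in disc_area. ennreal (cmod (bergman_projection w f z) * tail v (cmod z)) \<le> ennreal (C * b)"
        using main[OF _ f b(1,3)] by (intro AE_I2 ennreal_leI) auto
    qed
    also have "\<dots> = ennreal C * Linf_norm v f" using C by (simp add: b(2) ennreal_mult')
    finally show le: "Linf_norm v (bergman_projection w f) \<le> ennreal C * Linf_norm v f" .
    have "ennreal C * Linf_norm v f < \<infinity>" by (simp add: b(2) ennreal_mult_less_top)
    then show "bergman_projection w f \<in> Hinf v"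
      using le meas hol by (auto simp: Hinf_def Linf_def intro: order.strict_trans1)
  qed
qed

section \<open>Necessity\<close>

text \<open>An essential bound becomes a bound at each point other than 0: a violation at z would
  persist on a nonempty open set of points nearer to the origin.\<close>

lemma Linf_norm_bound_everywhere:
  assumes v: "radial_weight v" and F: "continuous_on unit_disc F"
    and le: "AE z in disc_area. cmod (F z) * tail v (cmod z) \<le> b"
    and z: "z \<in> unit_disc" "z \<noteq> 0"
  shows "cmod (F z) * tail v (cmod z) \<le> b"
proof (rule ccontr)
  assume "\<not> cmod (F z) * tail v (cmod z) \<le> b"
  then have gt: "b < cmod (F z) * tail v (cmod z)" by simp
  have T: "0 < tail v (cmod z)" using z by (intro tail_pos[OF v]) auto
  define V where "V = {u \<in> unit_disc. cmod (F u) \<in> {b / tail v (cmod z)<..}}"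
  have "open V"
    unfolding V_def by (intro continuous_open_preimage[unfolded vimage_def Int_def Collect_conj_eq[symmetric], simplified] continuous_intros F) auto
  \<comment> \<open>Inside this ball the tail is at least its value at |z|, so continuity of F alone
    keeps the product above b. Since z is not 0, it lies in the closure of the ball, and U is
    nonempty.\<close>
  define U where "U = V \<inter> ball 0 (cmod z)"
  have "z \<in> V" using gt T z by (simp add: V_def field_simps)
  moreover have "z \<in> closure (ball 0 (cmod z))" using z by simp
  ultimately have "U \<noteq> {}" using \<open>open V\<close> open_Int_closure_eq_empty[of V "ball 0 (cmod z)"] by (auto simp: U_def)
  moreover have "open U" using \<open>open V\<close> by (simp add: U_def open_Int)
  ultimately have "\<not> negligible U" by (simp add: open_not_negligible)
  moreover have "AE u in lborel. u \<notin> U"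
    using le unfolding AE_disc_area
  proof eventually_elim
    case (elim u)
    show ?case
    proof
      assume "u \<in> U"
      then have u: "u \<in> unit_disc" "cmod u < cmod z" "b < cmod (F u) * tail v (cmod z)"
        using T by (auto simp: U_def V_def field_simps)
      have "cmod (F u) * tail v (cmod z) \<le> cmod (F u) * tail v (cmod u)"
        using u z by (intro mult_left_mono tail_antimono[OF v]) auto
      then show False using u elim by auto
    qed
  qed
  then have "U \<in> null_sets lebesgue"
    by (simp add: completion.null_sets_iff_AE AE_completion)
  ultimately show False by (simp add: negligible_iff_null_sets)
qed

lemma bergman_kernel_0: "bergman_kernel w 0 \<zeta> = 1 / of_real (2 * enn2real (moment w 1))"
proof -
  have "bergman_kernel w 0 \<zeta> = (\<Sum>n\<in>{0}. (cnj 0 * \<zeta>) ^ n / of_real (2 * enn2real (moment w (real (2 * n + 1)))))"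
    unfolding bergman_kernel_def by (rule suminf_finite) auto
  then show ?thesis by simp
qed

lemma Linf_quotient:
  assumes v: "radial_weight v" and g: "g \<in> borel_measurable disc_area" and b: "0 \<le> b"
    and le: "\<And>\<zeta>. \<zeta> \<in> unit_disc \<Longrightarrow> cmod (g \<zeta>) \<le> b"
  shows "(\<lambda>\<zeta>. g \<zeta> / of_real (tail v (cmod \<zeta>))) \<in> Linf v"
    and "Linf_norm v (\<lambda>\<zeta>. g \<zeta> / of_real (tail v (cmod \<zeta>))) \<le> ennreal b"
proof -
  let ?f = "\<lambda>\<zeta>. g \<zeta> / of_real (tail v (cmod \<zeta>))"
  have f: "?f \<in> borel_measurable disc_area" using g tail_measurable[OF v] by measurable
  have T: "0 < tail v (cmod \<zeta>)" if "\<zeta> \<in> unit_disc" for \<zeta> using that by (intro tail_pos[OF v]) auto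
  show norm: "Linf_norm v ?f \<le> ennreal b"
    unfolding Linf_norm_def
  proof (rule esssup_I)
    show "(\<lambda>\<zeta>. ennreal (cmod (?f \<zeta>) * tail v (cmod \<zeta>))) \<in> borel_measurable disc_area"
      using f tail_measurable[OF v] by measurable
    show "AE \<zeta> in disc_area. ennreal (cmod (?f \<zeta>) * tail v (cmod \<zeta>)) \<le> ennreal b"
    proof (intro AE_I2 ennreal_leI)
      fix \<zeta> assume "\<zeta> \<in> space disc_area"
      then have "\<zeta> \<in> unit_disc" by simp
      from T[OF this] le[OF this] show "cmod (?f \<zeta>) * tail v (cmod \<zeta>) \<le> b"
        by (simp add: norm_divide)
    qed
  qed
  show "?f \<in> Linf v"
    unfolding Linf_def using f order.strict_trans1[OF norm, of \<infinity>] by simp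
qed

text \<open>At z = 0 the kernel is constant. Convergence of the integral defining the projection of
  1 / tail v at this single point is therefore integrability of the quotient over the disc.\<close>

lemma bergman_projection_bounded_imp_integrable:
  assumes v: "radial_weight v" and w: "radial_weight w" and bp: "bergman_projection_bounded w v"
  shows "set_integrable lebesgue {0..<1} (tail_quotient w v)"
proof -
  define f where "f \<zeta> = (1::complex) / of_real (tail v (cmod \<zeta>))" for \<zeta> :: complex
  have "f \<in> Linf v"
    unfolding f_def by (rule Linf_quotient(1)[OF v, of _ 1]) auto
  then have int: "integrable disc_area (bergman_integrand w f 0)"
    using bp by (auto simp: bergman_projection_bounded_def)
  define m where "m = 2 * enn2real (moment w 1)"
  have m: "0 < m" using mom_pos[OF w, of 1] by (simp add: m_def moment_eq_mom[OF w])
  have "integrable disc_area (\<lambda>\<zeta>. of_real m * bergman_integrand w f 0 \<zeta>)"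
    using int by (rule integrable_mult_right)
  also have "(\<lambda>\<zeta>. of_real m * bergman_integrand w f 0 \<zeta>) = (\<lambda>\<zeta>. of_real (tail_quotient w v (cmod \<zeta>)))"
    using m by (simp add: bergman_integrand_def bergman_kernel_0 f_def tail_quotient_def fun_eq_iff m_def[symmetric])
  finally have "integrable disc_area (\<lambda>\<zeta>. complex_of_real (tail_quotient w v (cmod \<zeta>)))" .
  then have "(\<integral>\<^sup>+ \<zeta>. ennreal (tail_quotient w v (cmod \<zeta>)) \<partial>disc_area) < \<infinity>"
  proof (subst (asm) integrable_iff_bounded)
    have "(\<integral>\<^sup>+ \<zeta>. ennreal (norm (complex_of_real (tail_quotient w v (cmod \<zeta>)))) \<partial>disc_area)
        = (\<integral>\<^sup>+ \<zeta>. ennreal (tail_quotient w v (cmod \<zeta>)) \<partial>disc_area)"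
      using tail_quotient_nonneg[OF v w] by (intro nn_integral_cong) simp
    then show ?thesis
      if "(\<lambda>\<zeta>. complex_of_real (tail_quotient w v (cmod \<zeta>))) \<in> borel_measurable disc_area \<and>
        (\<integral>\<^sup>+ \<zeta>. ennreal (norm (complex_of_real (tail_quotient w v (cmod \<zeta>)))) \<partial>disc_area) < \<infinity>"
      using that by simp
  qed
  then have fin: "(\<integral>\<^sup>+ r\<in>{0..<1}. ennreal (2 * r * tail_quotient w v r) \<partial>lebesgue) < \<infinity>"
    by (simp add: nn_integral_radial[OF tail_quotient_measurable[OF v w]])
  have meas: "(\<lambda>r. indicator {0..<1} r *\<^sub>R tail_quotient w v r) \<in> borel_measurable lebesgue"
    using tail_quotient_measurable[OF v w] by (simp add: set_borel_measurable_def)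
  \<comment> \<open>The area integral carries the Jacobian 2r, which is at least 1 only on [1/2, 1);
    the inner part is covered by \<open>tail_quotient_integrable_below\<close>.\<close>
  have "set_integrable lebesgue {1/2..<1} (tail_quotient w v)"
    unfolding set_integrable_def
  proof (rule integrableI_bounded)
    show "(\<lambda>r. indicator {1/2..<1} r *\<^sub>R tail_quotient w v r) \<in> borel_measurable lebesgue"
      using set_borel_measurable_subset[OF tail_quotient_measurable[OF v w], of "{1/2..<1}"]
      by (simp add: set_borel_measurable_def)
    have "(\<integral>\<^sup>+ r. ennreal (norm (indicator {1/2..<1} r *\<^sub>R tail_quotient w v r)) \<partial>lebesgue)
        \<le> (\<integral>\<^sup>+ r\<in>{0..<1}. ennreal (2 * r * tail_quotient w v r) \<partial>lebesgue)"
    proof (rule nn_integral_mono)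
      fix r :: real
      show "ennreal (norm (indicator {1/2..<1} r *\<^sub>R tail_quotient w v r))
          \<le> ennreal (2 * r * tail_quotient w v r) * indicator {0..<1} r"
      proof (cases "r \<in> {1/2..<1}")
        case True
        then have "1 * tail_quotient w v r \<le> 2 * r * tail_quotient w v r" "0 \<le> tail_quotient w v r"
          using tail_quotient_nonneg[OF v w, of r] mult_right_mono[of 1 "2 * r" "tail_quotient w v r"] by auto
        then show ?thesis using True by (auto intro!: ennreal_leI)
      qed auto
    qed
    then show "(\<integral>\<^sup>+ r. ennreal (norm (indicator {1/2..<1} r *\<^sub>R tail_quotient w v r)) \<partial>lebesgue) < \<infinity>"
      using fin by (rule order.strict_trans1)
  qed
  moreover have "set_integrable lebesgue {0..<1/2} (tail_quotient w v)"
    by (rule tail_quotient_integrable_below[OF v w]) auto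
  ultimately have "set_integrable lebesgue ({0..<1/2} \<union> {1/2..<1}) (tail_quotient w v)"
    by (intro set_integrable_Un) auto
  also have "{0..<1/2} \<union> {1/2..<1} = {0..<1::real}" by auto
  finally show ?thesis .
qed

text \<open>The bounded function \<open>\<theta> \<mapsto> 2i \<Sum> t\<^sup>n sin(n\<theta>) / n\<close>, in its extension \<open>-2i Im (Ln (1 - t\<zeta>))\<close> to the disc: testing
  the projection on it replaces Hardy's inequality for the circular means of the kernel.\<close>

definition log_test :: "real \<Rightarrow> complex \<Rightarrow> complex" where
  "log_test t \<zeta> = cnj (Ln (1 - of_real t * \<zeta>)) - Ln (1 - of_real t * \<zeta>)"

text \<open>The real part of 1 - t\<zeta> is positive, so its argument is less than pi/2 in modulus,
  and the bound pi does not depend on t. The coefficient is written with the factor 2 so that the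
  remaining functions are bounded by 1, as \<open>integral_mult_suminf\<close> asks.\<close>

lemma log_test_properties:
  assumes t: "0 \<le> t" "t < 1" and \<zeta>: "\<zeta> \<in> unit_disc"
  shows "cmod (log_test t \<zeta>) \<le> pi"
    and "(\<lambda>n. of_real (2 * (t ^ n / real n)) * ((\<zeta> ^ n - cnj \<zeta> ^ n) / 2)) sums log_test t \<zeta>"
proof -
  define u where "u = of_real t * \<zeta>"
  have u: "cmod u < 1" using mult_strict_mono'[of t 1 "cmod \<zeta>" 1] t \<zeta> by (simp add: u_def norm_mult)
  have "Re u < 1" using u complex_Re_le_cmod[of u] by linarith
  then have re: "0 < Re (1 - u)" by simp
  then have "\<bar>Im (Ln (1 - u))\<bar> < pi / 2" by (subst Re_Ln_pos_lt) auto
  moreover have "log_test t \<zeta> = of_real (- 2 * Im (Ln (1 - u))) * \<i>"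
    by (simp add: log_test_def u_def complex_eq_iff)
  then have "cmod (log_test t \<zeta>) = 2 * \<bar>Im (Ln (1 - u))\<bar>" by (simp add: norm_mult)
  ultimately show "cmod (log_test t \<zeta>) \<le> pi" by simp
  have 1: "(\<lambda>n. - ((-1) ^ Suc n / of_nat n * (- u) ^ n)) sums - Ln (1 + (- u))"
    using Ln_series[of "- u"] u by (intro sums_minus) simp
  have e: "- ((-1) ^ Suc n / of_nat n * (- u) ^ n) = of_real (t ^ n / real n) * \<zeta> ^ n" for n
  proof -
    have "(- 1) ^ n * (- u) ^ n = u ^ n" by (simp add: power_mult_distrib[symmetric])
    then have "- ((-1) ^ Suc n / of_nat n * (- u) ^ n) = u ^ n / of_nat n" by simp
    then show ?thesis by (simp add: u_def power_mult_distrib)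
  qed
  have 2: "(\<lambda>n. of_real (t ^ n / real n) * \<zeta> ^ n) sums - Ln (1 - u)"
    using 1 unfolding e by simp
  then have "(\<lambda>n. cnj (of_real (t ^ n / real n) * \<zeta> ^ n)) sums cnj (- Ln (1 - u))"
    by (simp only: sums_cnj)
  from sums_diff[OF 2 this]
  have "(\<lambda>n. of_real (t ^ n / real n) * \<zeta> ^ n - cnj (of_real (t ^ n / real n) * \<zeta> ^ n)) sums log_test t \<zeta>"
    by (simp add: log_test_def u_def)
  also have "(\<lambda>n. of_real (t ^ n / real n) * \<zeta> ^ n - cnj (of_real (t ^ n / real n) * \<zeta> ^ n))
      = (\<lambda>n. of_real (2 * (t ^ n / real n)) * ((\<zeta> ^ n - cnj \<zeta> ^ n) / 2))"
  proof
    fix n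
    have "of_real (2 * b) * (d / 2) = of_real b * d" for b and d :: complex by simp
    then show "of_real (t ^ n / real n) * \<zeta> ^ n - cnj (of_real (t ^ n / real n) * \<zeta> ^ n)
        = of_real (2 * (t ^ n / real n)) * ((\<zeta> ^ n - cnj \<zeta> ^ n) / 2)"
      by (simp only: complex_cnj_mult complex_cnj_complex_of_real complex_cnj_power right_diff_distrib)
  qed
  finally show "(\<lambda>n. of_real (2 * (t ^ n / real n)) * ((\<zeta> ^ n - cnj \<zeta> ^ n) / 2)) sums log_test t \<zeta>" .
qed

lemma log_test_measurable:
  assumes t: "0 \<le> t" "t < 1"
  shows "log_test t \<in> borel_measurable disc_area"
proof -
  have "continuous_on unit_disc (\<lambda>\<zeta>. Ln (1 - of_real t * \<zeta>))"
  proof (intro continuous_intros)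
    fix \<zeta> :: complex assume "\<zeta> \<in> unit_disc"
    then have "cmod (of_real t * \<zeta>) < 1" using mult_strict_mono'[of t 1 "cmod \<zeta>" 1] t by (simp add: norm_mult)
    then have "Re (of_real t * \<zeta>) < 1" using complex_Re_le_cmod[of "of_real t * \<zeta>"] by linarith
    then show "1 - of_real t * \<zeta> \<notin> \<real>\<^sub>\<le>\<^sub>0" by (auto simp: complex_nonpos_Reals_iff)
  qed
  then have "continuous_on unit_disc (log_test t)"
    unfolding log_test_def by (intro continuous_on_diff continuous_on_cnj)
  then show ?thesis
    unfolding measurable_disc_area by (intro continuous_imp_measurable_on_sets_lebesgue) auto
qed

text \<open>The antianalytic half of \<open>log_test\<close> produces conj \<zeta>^(n+k) with k > 0,
  which integrates to 0 against a radial weight. From the analytic half the term k = n remains, and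
  its coefficient is nonnegative.\<close>

lemma integral_log_test:
  assumes s: "radial_weight s" and t: "0 \<le> t" "t < 1"
  shows "(LINT \<zeta>|disc_area. of_real (s (cmod \<zeta>)) * log_test t \<zeta> * cnj \<zeta> ^ n)
    = of_real (t ^ n / real n * (2 * mom s (real (2 * n + 1))))"
proof -
  define G where "G \<zeta> = of_real (s (cmod \<zeta>)) * cnj \<zeta> ^ n" for \<zeta> :: complex
  define a where "a k = complex_of_real (2 * (t ^ k / real k))" for k
  define h where "h k \<zeta> = (\<zeta> ^ k - cnj \<zeta> ^ k) / 2" for k and \<zeta> :: complex
  have mono_int: "integrable disc_area (\<lambda>\<zeta>. of_real (s (cmod \<zeta>)) * (cnj \<zeta> ^ i * \<zeta> ^ j))" for i j
  proof (rule Bochner_Integration.integrable_bound)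
    show "integrable disc_area (\<lambda>\<zeta>. s (cmod \<zeta>))"
      using has_integral_radial_weight[OF s, of 0] by (auto simp: has_bochner_integral_iff)
    have "(\<lambda>\<zeta>::complex. cnj \<zeta> ^ i * \<zeta> ^ j) \<in> borel_measurable disc_area"
      by (intro continuous_borel_measurable_disc_area continuous_intros)
    then show "(\<lambda>\<zeta>. complex_of_real (s (cmod \<zeta>)) * (cnj \<zeta> ^ i * \<zeta> ^ j)) \<in> borel_measurable disc_area"
      using radial_weight_measurable[OF s] by measurable
    show "AE \<zeta> in disc_area. norm (complex_of_real (s (cmod \<zeta>)) * (cnj \<zeta> ^ i * \<zeta> ^ j)) \<le> norm (s (cmod \<zeta>))"
      by (intro AE_I2) (auto simp: norm_mult norm_power intro!: mult_left_le mult_le_one power_le_one)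
  qed
  have G: "integrable disc_area G" using mono_int[of n 0] unfolding G_def by simp
  have h: "h k \<in> borel_measurable disc_area" for k
    unfolding h_def by (intro continuous_borel_measurable_disc_area continuous_intros) auto
  have h1: "cmod (h k \<zeta>) \<le> 1" if "\<zeta> \<in> space disc_area" for k \<zeta>
  proof -
    have "cmod (\<zeta> ^ k) \<le> 1" "cmod (cnj \<zeta> ^ k) \<le> 1" using that by (simp_all add: norm_power power_le_one)
    then show ?thesis using norm_triangle_ineq4[of "\<zeta> ^ k" "cnj \<zeta> ^ k"] by (simp add: h_def norm_divide)
  qed
  have a: "summable (\<lambda>k. cmod (a k))"
  proof (rule summable_comparison_test'[OF summable_mult[OF summable_geometric[of t], of 2]])
    fix k
    have "t ^ k / real k \<le> t ^ k / 1" if "k \<noteq> 0" using that t by (intro divide_left_mono) auto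
    then show "norm (cmod (a k)) \<le> 2 * t ^ k" using t by (cases "k = 0") (auto simp: a_def norm_mult norm_divide norm_power)
  qed (use t in simp)
  have Gh: "(LINT \<zeta>|disc_area. G \<zeta> * h k \<zeta>) = (if n = k then of_real (mom s (real (2 * n + 1))) else 0)" if "k \<noteq> 0" for k
  proof -
    have "(LINT \<zeta>|disc_area. G \<zeta> * h k \<zeta>) = (LINT \<zeta>|disc_area. (of_real (s (cmod \<zeta>)) * (cnj \<zeta> ^ n * \<zeta> ^ k)
        - of_real (s (cmod \<zeta>)) * (cnj \<zeta> ^ (n + k) * \<zeta> ^ 0)) / 2)"
      by (intro Bochner_Integration.integral_cong) (auto simp: G_def h_def algebra_simps power_add diff_divide_distrib)
    also have "\<dots> = ((LINT \<zeta>|disc_area. of_real (s (cmod \<zeta>)) * (cnj \<zeta> ^ n * \<zeta> ^ k))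
        - (LINT \<zeta>|disc_area. of_real (s (cmod \<zeta>)) * (cnj \<zeta> ^ (n + k) * \<zeta> ^ 0))) / 2"
      using mono_int[of n k] mono_int[of "n + k" 0]
      by (subst integral_divide_zero, subst Bochner_Integration.integral_diff) auto
    also have "\<dots> = (if n = k then of_real (mom s (real (2 * n + 1))) else 0)"
      using that by (simp only: integral_radial_monomials[OF s]) auto
    finally show ?thesis .
  qed
  \<comment> \<open>Division by zero yields 0, so the term of index 0 agrees with the missing
    constant term of the logarithm.\<close>
  have a0: "a 0 = 0" by (simp add: a_def)
  have "(LINT \<zeta>|disc_area. of_real (s (cmod \<zeta>)) * log_test t \<zeta> * cnj \<zeta> ^ n) = (LINT \<zeta>|disc_area. G \<zeta> * (\<Sum>k. a k * h k \<zeta>))"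
  proof (intro Bochner_Integration.integral_cong refl)
    fix \<zeta> assume "\<zeta> \<in> space disc_area"
    then have "(\<Sum>k. a k * h k \<zeta>) = log_test t \<zeta>"
      using log_test_properties(2)[OF t, of \<zeta>] by (simp add: a_def h_def sums_iff)
    then show "of_real (s (cmod \<zeta>)) * log_test t \<zeta> * cnj \<zeta> ^ n = G \<zeta> * (\<Sum>k. a k * h k \<zeta>)"
      by (simp add: G_def)
  qed
  also have "\<dots> = (\<Sum>k. a k * (LINT \<zeta>|disc_area. G \<zeta> * h k \<zeta>))"
    by (rule integral_mult_suminf(2)[OF G h h1 a])
  also have "\<dots> = (\<Sum>k\<in>{n}. a k * (LINT \<zeta>|disc_area. G \<zeta> * h k \<zeta>))"
  proof (rule suminf_finite)
    fix k assume "k \<notin> {n}"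
    then show "a k * (LINT \<zeta>|disc_area. G \<zeta> * h k \<zeta>) = 0"
      using a0 Gh[of k] by (cases "k = 0") auto
  qed simp
  also have "\<dots> = a n * of_real (mom s (real (2 * n + 1)))"
    using a0 Gh[of n] by (cases "n = 0") auto
  also have "\<dots> = of_real (t ^ n / real n * (2 * mom s (real (2 * n + 1))))"
    by (simp add: a_def)
  finally show ?thesis .
qed

text \<open>At a real point \<rho> the projection of \<open>log_test t\<close> divided by tail v is
  a series with nonnegative terms, so its modulus controls every partial sum. The bound is uniform
  in t, which allows t to be removed.\<close>

lemma bergman_projection_bounded_imp_series_bound:
  assumes v: "radial_weight v" and w: "radial_weight w" and bp: "bergman_projection_bounded w v"
  obtains C where "C \<ge> 0" "\<And>\<rho> k. 0 < \<rho> \<Longrightarrow> \<rho> < 1 \<Longrightarrow>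
    tail v \<rho> * (\<Sum>n<k. \<rho> ^ n * (mom (tail_quotient w v) (real (2 * n + 1)) / (real n * mom w (real (2 * n + 1))))) \<le> C"
proof -
  define s where "s = tail_quotient w v"
  have s: "radial_weight s"
    unfolding s_def by (intro radial_weight_tail_quotient v w bergman_projection_bounded_imp_integrable bp)
  define x where "x n = mom s (real (2 * n + 1)) / (real n * mom w (real (2 * n + 1)))" for n
  have x0: "0 \<le> x n" for n
    using mom_pos[OF s, of "real (2 * n + 1)"] mom_pos[OF w, of "real (2 * n + 1)"] by (simp add: x_def)
  obtain C where C: "C \<ge> 0" "\<And>f. f \<in> Linf v \<Longrightarrow> bergman_projection w f \<in> Hinf v"
      "\<And>f. f \<in> Linf v \<Longrightarrow> Linf_norm v (bergman_projection w f) \<le> ennreal C * Linf_norm v f"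
    using bp unfolding bergman_projection_bounded_def by blast
  have dil: "tail v \<rho> * (\<Sum>n<k. (t * \<rho>) ^ n * x n) \<le> C * pi" if \<rho>: "0 < \<rho>" "\<rho> < 1" and t: "0 \<le> t" "t < 1" for \<rho> t k
  proof -
    define f where "f \<zeta> = log_test t \<zeta> / of_real (tail v (cmod \<zeta>))" for \<zeta>
    have f: "f \<in> Linf v" "Linf_norm v f \<le> ennreal pi"
      unfolding f_def using Linf_quotient[OF v log_test_measurable[OF t], of pi] log_test_properties(1)[OF t] by auto
    define F where "F = bergman_projection w f"
    have "F \<in> Hinf v" unfolding F_def by (rule C(2)[OF f(1)])
    then have hol: "F holomorphic_on unit_disc" by (simp add: Hinf_def)
    have "Linf_norm v F \<le> ennreal C * ennreal pi"
      unfolding F_def using f(2) by (intro order.trans[OF C(3)[OF f(1)]] mult_left_mono) auto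
    also have "\<dots> = ennreal (C * pi)" using C(1) by (simp add: ennreal_mult')
    finally have norm: "Linf_norm v F \<le> ennreal (C * pi)" .
    have "AE z in disc_area. ennreal (cmod (F z) * tail v (cmod z)) \<le> Linf_norm v F"
      unfolding Linf_norm_def by (rule esssup_AE)
    then have AE: "AE z in disc_area. cmod (F z) * tail v (cmod z) \<le> C * pi"
    proof eventually_elim
      case (elim z)
      then have "ennreal (cmod (F z) * tail v (cmod z)) \<le> ennreal (C * pi)" using norm by (rule order.trans)
      then show ?case using C(1) by (subst (asm) ennreal_le_iff) auto
    qed
    have z: "complex_of_real \<rho> \<in> unit_disc" "complex_of_real \<rho> \<noteq> 0" using \<rho> by auto
    have "cmod (F (of_real \<rho>)) * tail v (cmod (of_real \<rho>)) \<le> C * pi"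
      by (rule Linf_norm_bound_everywhere[OF v holomorphic_on_imp_continuous_on[OF hol] AE z])
    then have bound: "cmod (F (of_real \<rho>)) * tail v \<rho> \<le> C * pi" using \<rho> by simp
    have int: "integrable disc_area (\<lambda>\<zeta>. f \<zeta> * of_real (w (cmod \<zeta>)))"
      by (rule Linf_integrable[OF v w s[unfolded s_def] f(1)])
    have coeff: "(LINT \<zeta>|disc_area. f \<zeta> * of_real (w (cmod \<zeta>)) * cnj \<zeta> ^ n)
        = of_real (t ^ n / real n * (2 * mom s (real (2 * n + 1))))" for n
    proof -
      have "(LINT \<zeta>|disc_area. f \<zeta> * of_real (w (cmod \<zeta>)) * cnj \<zeta> ^ n)
          = (LINT \<zeta>|disc_area. of_real (s (cmod \<zeta>)) * log_test t \<zeta> * cnj \<zeta> ^ n)"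
        by (intro Bochner_Integration.integral_cong) (auto simp: f_def s_def tail_quotient_def)
      then show ?thesis using integral_log_test[OF s t, of n] by simp
    qed
    have "(\<lambda>n. of_real (1 / (2 * mom w (real (2 * n + 1)))) *
        (LINT \<zeta>|disc_area. f \<zeta> * of_real (w (cmod \<zeta>)) * cnj \<zeta> ^ n) * of_real \<rho> ^ n) sums F (of_real \<rho>)"
      unfolding F_def by (rule bergman_projection_series(2)[OF w int z(1)])
    also have "(\<lambda>n. of_real (1 / (2 * mom w (real (2 * n + 1)))) *
        (LINT \<zeta>|disc_area. f \<zeta> * of_real (w (cmod \<zeta>)) * cnj \<zeta> ^ n) * of_real \<rho> ^ n)
        = (\<lambda>n. complex_of_real ((t * \<rho>) ^ n * x n))"
      unfolding coeff x_def by (simp add: fun_eq_iff power_mult_distrib mult_ac)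
    finally have sums: "(\<lambda>n. complex_of_real ((t * \<rho>) ^ n * x n)) sums F (of_real \<rho>)" .
    then have re: "(\<lambda>n. (t * \<rho>) ^ n * x n) sums Re (F (of_real \<rho>))"
      using sums_Re[OF sums] by (simp only: Re_complex_of_real)
    have "(\<Sum>n<k. (t * \<rho>) ^ n * x n) \<le> (\<Sum>n. (t * \<rho>) ^ n * x n)"
      using re t \<rho> x0 by (intro sum_le_suminf) (auto simp: sums_iff)
    also have "\<dots> = Re (F (of_real \<rho>))" using re by (simp add: sums_iff)
    also have "\<dots> \<le> cmod (F (of_real \<rho>))" by (rule complex_Re_le_cmod)
    finally have "tail v \<rho> * (\<Sum>n<k. (t * \<rho>) ^ n * x n) \<le> tail v \<rho> * cmod (F (of_real \<rho>))"
      using tail_pos[OF v, of \<rho>] \<rho> by (intro mult_left_mono) auto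
    then show ?thesis using bound by (simp add: mult.commute)
  qed
  show thesis
  proof (rule that[of "C * pi"])
    show "C * pi \<ge> 0" using C(1) by simp
    fix \<rho> :: real and k :: nat assume \<rho>: "0 < \<rho>" "\<rho> < 1"
    \<comment> \<open>The partial sums are polynomials in t, so the limit t to 1 can be taken
      although \<open>log_test\<close> itself is used for t < 1 only.\<close>
    have "tail v \<rho> * (\<Sum>n<k. (1 * \<rho>) ^ n * x n) \<le> C * pi"
    proof (rule tendsto_upperbound)
      show "((\<lambda>t. tail v \<rho> * (\<Sum>n<k. (t * \<rho>) ^ n * x n)) \<longlongrightarrow> tail v \<rho> * (\<Sum>n<k. (1 * \<rho>) ^ n * x n)) (at_left 1)"
        by (intro tendsto_intros)
      have "\<forall>\<^sub>F t in at_left 1. 0 < t \<and> t < (1::real)"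
        by (auto simp: eventually_at_left_field intro!: exI[of _ 0])
      then show "\<forall>\<^sub>F t in at_left 1. tail v \<rho> * (\<Sum>n<k. (t * \<rho>) ^ n * x n) \<le> C * pi"
        by eventually_elim (rule dil[OF \<rho>], auto)
    qed auto
    then show "tail v \<rho> * (\<Sum>n<k. \<rho> ^ n * (mom (tail_quotient w v) (real (2 * n + 1)) / (real n * mom w (real (2 * n + 1))))) \<le> C * pi"
      by (simp add: x_def s_def)
  qed
qed

section \<open>Dyadic lower bounds and the two necessary conditions\<close>

lemma harmonic_sum_ge:
  assumes "N \<ge> 1"
  shows "real J / 2 \<le> (\<Sum>n\<in>{N..<2 ^ J * N}. 1 / real n)"
proof (induction J)
  case (Suc J)
  let ?M = "2 ^ J * N"
  have M: "?M \<ge> 1" "N \<le> ?M" using assms by auto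
  have "real (Suc J) / 2 = real J / 2 + real ?M * (1 / real (2 * ?M))" using M by (simp add: field_simps)
  also have "real ?M * (1 / real (2 * ?M)) = (\<Sum>n\<in>{?M..<2 * ?M}. 1 / real (2 * ?M))" by simp
  also have "\<dots> \<le> (\<Sum>n\<in>{?M..<2 * ?M}. 1 / real n)"
  proof (rule sum_mono)
    fix n assume "n \<in> {?M..<2 * ?M}"
    then have "real n \<le> real (2 * ?M)" "0 < n" using M by (simp_all only: of_nat_le_iff) auto
    then show "1 / real (2 * ?M) \<le> 1 / real n" by (intro divide_left_mono) auto
  qed
  finally have "real (Suc J) / 2 \<le> (\<Sum>n\<in>{N..<?M}. 1 / real n) + (\<Sum>n\<in>{?M..<2 * ?M}. 1 / real n)"
    using Suc by linarith
  also have "\<dots> = (\<Sum>n\<in>{N..<2 * ?M}. 1 / real n)"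
    using M by (intro sum.atLeastLessThan_concat) auto
  finally show ?case by (simp add: mult.assoc)
qed simp

text \<open>As long as u n is bounded, (1 - u)^n stays above exp (-L), and each of the J dyadic
  blocks of the harmonic series contributes at least 1/2.\<close>

lemma series_block_lower_bound:
  fixes x :: "nat \<Rightarrow> real"
  assumes N: "N \<ge> 1" and u: "0 \<le> u" "u \<le> 1/2" and L: "\<And>n. n < 2 ^ J * N \<Longrightarrow> 2 * u * real n \<le> L" and x: "\<And>n. 0 \<le> x n"
    and \<kappa>: "0 \<le> \<kappa>" "\<And>n. N \<le> n \<Longrightarrow> n < 2 ^ J * N \<Longrightarrow> \<kappa> \<le> x n"
  shows "exp (- L) * \<kappa> * (real J / 2) \<le> (\<Sum>n<2 ^ J * N. (1 - u) ^ n * (x n / real n))"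
proof -
  have "exp (- L) * \<kappa> * (real J / 2) \<le> exp (- L) * \<kappa> * (\<Sum>n\<in>{N..<2 ^ J * N}. 1 / real n)"
    using \<kappa>(1) by (intro mult_left_mono harmonic_sum_ge[OF N]) auto
  also have "\<dots> = (\<Sum>n\<in>{N..<2 ^ J * N}. exp (- L) * (\<kappa> / real n))"
    by (simp add: sum_distrib_left)
  also have "\<dots> \<le> (\<Sum>n\<in>{N..<2 ^ J * N}. (1 - u) ^ n * (x n / real n))"
  proof (rule sum_mono)
    fix n assume "n \<in> {N..<2 ^ J * N}"
    then have n: "N \<le> n" "n < 2 ^ J * N" by auto
    have "exp (- L) \<le> exp (- 2 * u * real n)" using L[OF n(2)] by simp
    also have "\<dots> \<le> (1 - u) powr real n" using u by (intro exp_le_one_minus_powr) auto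
    also have "\<dots> = (1 - u) ^ n" using u by (intro powr_realpow) auto
    finally show "exp (- L) * (\<kappa> / real n) \<le> (1 - u) ^ n * (x n / real n)"
      using \<kappa>(1) \<kappa>(2)[OF n] u by (intro mult_mono divide_right_mono) auto
  qed
  also have "\<dots> \<le> (\<Sum>n<2 ^ J * N. (1 - u) ^ n * (x n / real n))"
    using u x by (intro sum_mono2) auto
  finally show ?thesis .
qed

text \<open>The two conclusions differ in the radius at which the series is evaluated. For the tail
  condition it is r itself, with n of order 1 / (1 - r). For \<open>D_check\<close> it is so close
  to 1 that J blocks starting at this order are all undamped, while the weight in front of the
  series is the tail at the closer radius.\<close>

lemma bergman_projection_bounded_imp_conditions:
  assumes v: "radial_weight v" and w: "w \<in> D_hat" and bp: "bergman_projection_bounded w v"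
  shows "tail_condition w v" "v \<in> D_check"
proof -
  note rw = D_hat_radial_weight[OF w]
  have i: "set_integrable lebesgue {0..<1} (tail_quotient w v)"
    by (rule bergman_projection_bounded_imp_integrable[OF v rw bp])
  define s where "s = tail_quotient w v"
  have s: "radial_weight s" unfolding s_def by (rule radial_weight_tail_quotient[OF v rw i])
  obtain C where C: "C \<ge> 0" "\<And>\<rho> k. 0 < \<rho> \<Longrightarrow> \<rho> < 1 \<Longrightarrow>
    tail v \<rho> * (\<Sum>n<k. \<rho> ^ n * (mom (tail_quotient w v) (real (2 * n + 1)) / (real n * mom w (real (2 * n + 1))))) \<le> C"
    using bergman_projection_bounded_imp_series_bound[OF v rw bp] by blast
  obtain P where P: "P > 0" "\<And>x. 1 \<le> x \<Longrightarrow> mom w x \<le> P * tail w (1 - 1 / x)"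
    using D_hat_mom_le[OF w] by blast
  define y where "y n = mom s (real (2 * n + 1)) / mom w (real (2 * n + 1))" for n
  have y0: "0 \<le> y n" for n
    using mom_pos[OF s, of "real (2 * n + 1)"] mom_pos[OF rw, of "real (2 * n + 1)"] by (simp add: y_def)
  have Cy: "tail v \<rho> * (\<Sum>n<k. \<rho> ^ n * (y n / real n)) \<le> C" if "0 < \<rho>" "\<rho> < 1" for \<rho> k
    using C(2)[OF that, of k] by (simp add: y_def s_def mult.commute)
  show "tail_condition w v"
  proof -
    define D where "D = max (2 * C * P * exp 26) (tail v 0 * tail s 0 / tail w (1/2))"
    have "tail v r * tail s r \<le> D * tail w r" if r: "0 \<le> r" "r < 1" for r
    proof (cases "1/2 \<le> r")
      case True
      define x where "x = 1 / (1 - r)"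
      define N where "N = nat \<lceil>x\<rceil>"
      have x: "2 \<le> x" "1 - 1 / x = r" using True r by (auto simp: x_def field_simps)
      have N: "x \<le> real N" "real N \<le> 2 * x" "N \<ge> 1" using x(1) unfolding N_def by linarith+
      have Tw: "0 < tail w r" and Tv: "0 < tail v r" and Ts: "0 < tail s r"
        using tail_pos[OF rw r] tail_pos[OF v r] tail_pos[OF s r] by auto
      \<comment> \<open>On this block 2n + 1 lies between x and 9x, so \<open>mom_ge_tail\<close>
        loses at most exp 18.\<close>
      define \<kappa> where "\<kappa> = exp (- 18) * tail s r / (P * tail w r)"
      have \<kappa>0: "0 \<le> \<kappa>" using Ts Tw P(1) by (simp add: \<kappa>_def)
      have \<kappa>: "\<kappa> \<le> y n" if n: "N \<le> n" "n < 2 ^ 1 * N" for n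
      proof -
        have n': "x \<le> real (2 * n + 1)" "real (2 * n + 1) \<le> 9 * x" using n N x by auto
        have "- 18 \<le> - 2 * real (2 * n + 1) / x" using n'(2) x(1) by (simp add: field_simps)
        then have "exp (- 18) * tail s r \<le> exp (- 2 * real (2 * n + 1) / x) * tail s (1 - 1 / x)"
          unfolding x(2) using Ts by (intro mult_right_mono) auto
        also have "\<dots> \<le> mom s (real (2 * n + 1))" using x(1) by (intro mom_ge_tail[OF s]) auto
        finally have 1: "exp (- 18) * tail s r \<le> mom s (real (2 * n + 1))" .
        have "mom w (real (2 * n + 1)) \<le> mom w x" using n' x(1) by (intro mom_antimono[OF rw]) auto
        also have "\<dots> \<le> P * tail w r" using P(2)[of x] x by simp
        finally have 2: "mom w (real (2 * n + 1)) \<le> P * tail w r" .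
        show "\<kappa> \<le> y n"
          unfolding \<kappa>_def y_def using 1 2 mom_pos[OF s, of "real (2 * n + 1)"] mom_pos[OF rw, of "real (2 * n + 1)"]
          by (intro frac_le) auto
      qed
      have "exp (- 8) * \<kappa> * (real 1 / 2) \<le> (\<Sum>n<2 ^ 1 * N. (1 - 1 / x) ^ n * (y n / real n))"
      proof (rule series_block_lower_bound[OF N(3) _ _ _ y0 \<kappa>0])
        \<comment> \<open>Here n < 2N <= 4x. The resulting exp 8 and the exp 18 in \<kappa> combine
          to the exp 26 in D.\<close>
        show "2 * (1 / x) * real n \<le> 8" if "n < 2 ^ 1 * N" for n
          using that N x by (simp add: field_simps)
      qed (use x \<kappa> N in \<open>auto simp: field_simps\<close>)
      then have "tail v r * (exp (- 8) * \<kappa> * (1 / 2)) \<le> tail v r * (\<Sum>n<2 ^ 1 * N. r ^ n * (y n / real n))"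
        unfolding x(2) using Tv by (intro mult_left_mono) auto
      also have "\<dots> \<le> C" using True r by (intro Cy) auto
      finally have "tail v r * (exp (- 8) * (exp (- 18) * tail s r / (P * tail w r)) * (1 / 2)) \<le> C"
        by (simp only: \<kappa>_def)
      then have "exp (- 8) * exp (- 18) * (tail v r * tail s r) \<le> 2 * C * P * tail w r"
        using Tw P(1) by (simp add: field_simps)
      also have "exp (- 8) * exp (- 18) = exp (- 26 :: real)" by (simp add: exp_add[symmetric])
      finally have "tail v r * tail s r \<le> 2 * C * P * exp 26 * tail w r"
        by (simp add: exp_minus field_simps)
      also have "\<dots> \<le> D * tail w r" using Tw by (intro mult_right_mono) (auto simp: D_def)
      finally show ?thesis .
    next
      case False
      have "tail v r * tail s r \<le> tail v 0 * tail s 0"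
        using r tail_pos[OF s r] tail_pos[OF v, of 0] by (intro mult_mono tail_antimono v s) auto
      also have "\<dots> = tail v 0 * tail s 0 / tail w (1/2) * tail w (1/2)"
        using tail_pos[OF rw, of "1/2"] by simp
      also have "\<dots> \<le> D * tail w r"
      proof (rule mult_mono)
        show "tail w (1/2) \<le> tail w r" using r False by (intro tail_antimono[OF rw]) auto
        have "0 \<le> 2 * C * P * exp 26" using P C(1) by auto
        then show "0 \<le> D" by (simp add: D_def le_max_iff_disj)
      qed (use tail_pos[OF rw, of "1/2"] in \<open>auto simp: D_def\<close>)
      finally show ?thesis .
    qed
    then show ?thesis unfolding tail_condition_def s_def using i by blast
  qed
  show "v \<in> D_check"
  proof -
    \<comment> \<open>Fixed before r, since it depends on constants only. The final estimate reads
      tail v (1 - u) * J/2 <= C P exp 4 * tail v r, and J/4 >= C P exp 4 turns this into a halving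
      of the tail.\<close>
    define J where "J = Suc (nat \<lceil>4 * (C * P * exp 4)\<rceil>)"
    have J: "4 * (C * P * exp 4) \<le> real J" "J \<ge> 1" unfolding J_def by linarith+
    show ?thesis
    proof (rule D_checkI[OF v, of "1/2" "2 ^ Suc J" 2])
      show "(1::real) < 2 ^ Suc J" by (rule one_less_power) auto
      fix r :: real assume r: "1/2 \<le> r" "0 \<le> r" "r < 1"
      define x where "x = 1 / (1 - r)"
      define N where "N = nat \<lceil>x\<rceil>"
      \<comment> \<open>The distance to 1 is 2^(J+1) times smaller than 1 - r = 1/x. As n < 2^J N <=
        2^(J+1) x, the product u n is at most 1 in all J blocks.\<close>
      define u where "u = 1 / (2 ^ Suc J * x)"
      have x: "2 \<le> x" "1 - 1 / x = r" using r by (auto simp: x_def field_simps)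
      have N: "x \<le> real N" "real N \<le> 2 * x" "N \<ge> 1" using x(1) unfolding N_def by linarith+
      have "1 * 2 \<le> 2 ^ Suc J * x" using x(1) by (intro mult_mono one_le_power) auto
      then have u: "0 < u" "u \<le> 1/2" using x(1) by (auto simp: u_def field_simps)
      have ur: "1 - (1 - r) / 2 ^ Suc J = 1 - u" by (simp add: u_def x_def)
      have Tv: "0 < tail v r" using tail_pos[OF v r(2,3)] .
      have Tu: "0 < tail v (1 - u)" using u by (intro tail_pos[OF v]) auto
      \<comment> \<open>A bound common to all blocks: at t = 1 - 1/m with m = 2n + 1 the quotient
        tail is at least tail w t / tail v t, the factor tail w t cancels against the moment of w,
        and t >= r gives tail v t <= tail v r.\<close>
      define \<kappa> where "\<kappa> = exp (- 2) / (P * tail v r)"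
      have \<kappa>0: "0 \<le> \<kappa>" using Tv P(1) by (simp add: \<kappa>_def)
      have \<kappa>: "\<kappa> \<le> y n" if n: "N \<le> n" for n
      proof -
        define m where "m = real (2 * n + 1)"
        have m: "x \<le> m" "2 \<le> m" using n N x by (auto simp: m_def)
        define t where "t = 1 - 1 / m"
        have t: "r \<le> t" "t < 1" "0 \<le> t"
        proof -
          have "1 / m \<le> 1 / x" using m x by (intro divide_left_mono) auto
          then show "r \<le> t" using x(2) by (simp add: t_def)
          then show "0 \<le> t" using r by simp
          show "t < 1" using m by (simp add: t_def)
        qed
        have T: "0 < tail w t" "0 < tail v t" using tail_pos[OF rw t(3,2)] tail_pos[OF v t(3,2)] by auto
        have "tail v t \<le> tail v r" using t r by (intro tail_antimono[OF v]) auto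
        then have "\<kappa> \<le> exp (- 2) / (P * tail v t)"
          unfolding \<kappa>_def using P(1) T by (intro divide_left_mono mult_left_mono) auto
        also have "\<dots> = exp (- 2) * (tail w t / tail v t) / (P * tail w t)" using T by simp
        also have "\<dots> \<le> mom s m / mom w m"
        proof (rule frac_le)
          have "exp (- 2) * (tail w t / tail v t) \<le> exp (- 2) * tail s t"
            unfolding s_def using t by (intro mult_left_mono tail_quotient_ge[OF v rw i]) auto
          also have "\<dots> \<le> mom s m" using mom_ge_tail[OF s m(2), of m] m by (simp add: t_def)
          finally show "exp (- 2) * (tail w t / tail v t) \<le> mom s m" .
          show "mom w m \<le> P * tail w t" unfolding t_def using m by (intro P(2)) auto
        qed (use T mom_pos[OF s, of m] mom_pos[OF rw, of m] m in auto)
        finally show ?thesis by (simp only: y_def m_def)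
      qed
      have "exp (- 2) * \<kappa> * (real J / 2) \<le> (\<Sum>n<2 ^ J * N. (1 - u) ^ n * (y n / real n))"
      proof (rule series_block_lower_bound[OF N(3) _ u(2) _ y0 \<kappa>0])
        show "2 * u * real n \<le> 2" if "n < 2 ^ J * N" for n
        proof -
          have "real n \<le> real (2 ^ J * N)" using that by (simp only: of_nat_le_iff)
          also have "\<dots> \<le> 2 ^ J * (2 * x)" using N(2) by simp
          finally have "2 * u * real n \<le> 2 * u * (2 ^ J * (2 * x))" using u by (intro mult_left_mono) auto
          also have "\<dots> = 2" using x by (simp add: u_def)
          finally show ?thesis .
        qed
      qed (use u \<kappa> in auto)
      then have "tail v (1 - u) * (exp (- 2) * \<kappa> * (real J / 2)) \<le> tail v (1 - u) * (\<Sum>n<2 ^ J * N. (1 - u) ^ n * (y n / real n))"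
        using Tu by (intro mult_left_mono) auto
      also have "\<dots> \<le> C" using u by (intro Cy) auto
      finally have "tail v (1 - u) * (exp (- 2) * (exp (- 2) / (P * tail v r)) * (real J / 2)) \<le> C"
        by (simp only: \<kappa>_def)
      then have "exp (- 2) * exp (- 2) * (tail v (1 - u) * (real J / 2)) \<le> C * P * tail v r"
        using Tv P(1) by (simp add: field_simps)
      also have "exp (- 2) * exp (- 2) = exp (- 4 :: real)" by (simp add: exp_add[symmetric])
      finally have 1: "tail v (1 - u) * (real J / 2) \<le> C * P * exp 4 * tail v r"
        by (simp add: exp_minus field_simps)
      show "2 * tail v (1 - (1 - r) / 2 ^ Suc J) \<le> tail v r"
      proof -
        have "tail v (1 - u) * (real J / 2) \<le> real J / 4 * tail v r"
          using 1 mult_right_mono[of "C * P * exp 4" "real J / 4" "tail v r"] J Tv by linarith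
        then have "real J * (2 * tail v (1 - u)) \<le> real J * tail v r" by (simp add: mult_ac)
        then have "2 * tail v (1 - u) \<le> tail v r" using J(2) by (subst (asm) mult_le_cancel_left_pos) auto
        then show ?thesis by (simp only: ur)
      qed
    qed auto
  qed
qed

theorem theorem3:
  fixes \<nu> \<omega> :: "real \<Rightarrow> real"
  assumes "radial_weight \<nu>" and "\<omega> \<in> D_hat"
  defines "\<sigma> \<equiv> (\<lambda>r. \<omega> r / tail \<nu> r)"
  defines "c1 \<equiv> bergman_projection_bounded \<omega> \<nu>"
  defines "c2 \<equiv> \<nu> \<in> D_check \<and>
             (SUP x\<in>{0..}. moment \<nu> x / moment \<omega> (2 * x) * moment \<sigma> x) < \<infinity>"
  defines "c3 \<equiv> \<nu> \<in> D_check \<and>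
             (SUP r\<in>{0..<1}. ennreal (tail \<nu> r / tail \<omega> r) *
                (\<integral>\<^sup>+ s\<in>{r..<1}. ennreal (\<sigma> s) \<partial>lebesgue)) < \<infinity>"
  defines "c4 \<equiv> \<sigma> \<in> D_class \<and> \<nu> \<in> D_class"
  shows "(c1 \<longleftrightarrow> c2) \<and> (c2 \<longleftrightarrow> c3) \<and> (c3 \<longleftrightarrow> c4)"
proof -
  note v = assms(1) and w = assms(2)
  note rw = D_hat_radial_weight[OF w]
  have \<sigma>: "\<sigma> = tail_quotient \<omega> \<nu>" by (simp add: \<sigma>_def tail_quotient_def fun_eq_iff)
  have c2: "c2 \<longleftrightarrow> \<nu> \<in> D_check \<and> moment_condition \<omega> \<nu>"
    unfolding c2_def \<sigma> moment_condition_iff[OF v rw] ..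
  have c3: "c3 \<longleftrightarrow> \<nu> \<in> D_check \<and> tail_condition \<omega> \<nu>"
    unfolding c3_def \<sigma> tail_condition_iff[OF v rw] ..
  have "c2 \<longleftrightarrow> c3"
    unfolding c2 c3 using moment_condition_if_tail_condition[OF w v] tail_condition_if_moment_condition[OF w v] by blast
  moreover have "c3 \<longleftrightarrow> c4"
    unfolding c3 c4_def \<sigma> D_class_def
    using tail_condition_D_hat[OF w v] tail_condition_quotient_D_hat[OF w v]
      tail_condition_quotient_D_check[OF rw] tail_conditionI_D_class[OF rw] by blast
  moreover have "c1 \<Longrightarrow> c3"
    unfolding c1_def c3 using bergman_projection_bounded_imp_conditions[OF v w] by blast
  \<comment> \<open>The sufficiency lemma takes doubling of \<nu> as a hypothesis; it is recovered
    from the moment condition by way of the tail condition.\<close>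
  moreover have "c2 \<Longrightarrow> c1"
    unfolding c1_def c2
    using bergman_projection_bounded_if_moment_condition[OF w tail_condition_D_hat[OF w v]]
      tail_condition_if_moment_condition[OF w v] by blast
  ultimately show ?thesis by blast
qed

end
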